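(* The adjunction $\mathbf{Sk}_{\rm Frith}\dashv\mathbf B_+$, where $\mathbf{Sk}_{\rm Frith}:\mathbf{Frith}\to\mathbf{BiFrm}$ and $\mathbf B_+:\mathbf{BiFrm}\to\mathbf{Frith}$, restricts to an equivalence of categories between the category $\mathbf{CFrith}$ of complete Frith frames and the category $\mathbf{BiFrm}_{\rm KZ}$ of compact and zero-dimensional biframes.
   Context: A Frith frame is a pair $(L,S)$ with $L$ a frame and $S$ a bounded sublattice of $L$ such that every element of $L$ is a join of elements of $S$. A morphism $(L,S)\to(M,T)$ is a frame homomorphism $h:L\to M$ with $h[S]\subseteq T$; the category is $\mathbf{Frith}$. It is dense if $h(a)=0$ implies $a=0$, and it is an extremal epimorphism if and only if $h[S]=T$. $(L,S)$ is symmetric if $S$ is a Boolean algebra. For a frame $L$, $\mathcal CL$ is the frame of congruences of $L$ ordered by inclusion; for $a\in L$, $\nabla_a=\{(x,y)\mid a\vee x=a\vee y\}$ and $\Delta_a=\{(x,y)\mid a\wedge x=a\wedge y\}$ (complements of each other in $\mathcal CL$). $\nabla L=\{\nabla_a\mid a\in L\}$, $\Delta S$ is the subframe of $\mathcal CL$ generated by $\{\Delta_s\mid s\in S\}$, and $\mathcal C_SL$ is the subframe of $\mathcal CL$ generated by $\nabla L\cup\Delta S$. Every frame homomorphism $h:L\to M$ with $h(s)$ complemented for all $s\in S$ extends uniquely along $a\mapsto\nabla_a$ to a frame homomorphism $\mathcal C_SL\to M$. Let $\overline S$ be the sublattice of $\mathcal C_SL$ generated by $\{\nabla_s,\Delta_s\mid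 s\in S\}$. Completeness: a symmetric Frith frame $(L,B)$ is complete if every dense extremal epimorphism $(M,C)\to(L,B)$ with $(M,C)$ symmetric is an isomorphism. A Frith frame $(L,S)$ is complete if the symmetric Frith frame $(\mathcal C_SL,\overline S)$ is complete. $\mathbf{CFrith}$ is the full subcategory of $\mathbf{Frith}$ determined by the complete ones. A biframe is a triple $\mathcal L=(L,L_+,L_-)$ where $L_+,L_-$ are subframes of the frame $L$ and every element of $L$ is a join of finite meets of elements of $L_+\cup L_-$; a morphism $(L,L_+,L_-)\to(M,M_+,M_-)$ is a frame homomorphism $h:L\to M$ with $h[L_+]\subseteq M_+$ and $h[L_-]\subseteq M_-$; the category is $\mathbf{BiFrm}$. An element of $L_+$ (resp. $L_-$) is positive (resp. negative) bicomplemented if it is complemented in $L$ with complement in $L_-$ (resp. $L_+$); $\mathrm B_+(\mathcal L)$ is the lattice of positive bicomplemented elements. $\mathcal L$ is compact if the frame $L$ is compact; it is zero-dimensional if $L_+$ and $L_-$ are both join-generated by their bicomplemented elements. $\mathbf{BiFrm}_{\rm KZ}$ is a full subcategory of $\mathbf{BiFrm}$. $\mathbf{Sk}_{\rm Frith}(L,S)=(\mathcal C_SL,\nabla L,\Delta S)$, and $\mathbf{Sk}_{\rm Frith}(h)$, for $h:(L,S)\to(M,T)$, is the unique frame homomorphism $\overline h:\mathcal C_SL\to\mathcal C_TM$ with $\overline h(\nabla_a)=\nabla_{h(a)}$. $\mathbf B_+(\mathcal L)=(\langle \mathrm B_+(\mathcal L)\rangle,\mathrm B_+(\mathcal L))$,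 where $\langle \mathrm B_+(\mathcal L)\rangle$ is the subframe of $L_+$ generated by $\mathrm B_+(\mathcal L)$; on morphisms it is restriction and co-restriction. *)

theory Defs
  imports "HOL-Algebra.Complete_Lattice" "HOL-Library.FuncSet"
begin

section \<open>Frames\<close>

text \<open>Ordered structures are those of HOL-Algebra.  A subframe \<open>X\<close> of \<open>L\<close> is given by its set
  of elements; regarded as a frame it is \<open>L\<lparr>carrier := X\<rparr>\<close>.\<close>

locale frame = complete_lattice L for L (structure) +
  assumes meet_sup_distrib:
    "\<lbrakk>a \<in> carrier L; X \<subseteq> carrier L\<rbrakk> \<Longrightarrow> a \<sqinter> (\<Squnion>X) = \<Squnion>((\<lambda>x. a \<sqinter> x) ` X)"

text \<open>Maps are extensional (undefined outside the carrier), so that equality of morphisms is equality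
  of functions; identities are \<open>\<lambda>x\<in>carrier L. x\<close> and composition is \<open>compose\<close>.\<close>

definition frame_hom ::
  "('a, 'x) gorder_scheme \<Rightarrow> ('b, 'y) gorder_scheme \<Rightarrow> ('a \<Rightarrow> 'b) set" where
  "frame_hom L M = {h \<in> carrier L \<rightarrow>\<^sub>E carrier M.
     h \<top>\<^bsub>L\<^esub> = \<top>\<^bsub>M\<^esub> \<and>
     (\<forall>x\<in>carrier L. \<forall>y\<in>carrier L. h (x \<sqinter>\<^bsub>L\<^esub> y) = h x \<sqinter>\<^bsub>M\<^esub> h y) \<and>
     (\<forall>X. X \<subseteq> carrier L \<longrightarrow> h (\<Squnion>\<^bsub>L\<^esub> X) = \<Squnion>\<^bsub>M\<^esub> (h ` X))}"

definition subframe :: "('a, 'x) gorder_scheme \<Rightarrow> 'a set \<Rightarrow> bool" where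
  "subframe L X \<longleftrightarrow> X \<subseteq> carrier L \<and> \<top>\<^bsub>L\<^esub> \<in> X \<and>
     (\<forall>x\<in>X. \<forall>y\<in>X. x \<sqinter>\<^bsub>L\<^esub> y \<in> X) \<and> (\<forall>Y. Y \<subseteq> X \<longrightarrow> \<Squnion>\<^bsub>L\<^esub> Y \<in> X)"

definition subframe_gen :: "('a, 'x) gorder_scheme \<Rightarrow> 'a set \<Rightarrow> 'a set" where
  "subframe_gen L G = \<Inter>{X. subframe L X \<and> G \<subseteq> X}"

definition bounded_sublattice :: "('a, 'x) gorder_scheme \<Rightarrow> 'a set \<Rightarrow> bool" where
  "bounded_sublattice L S \<longleftrightarrow> S \<subseteq> carrier L \<and> \<bottom>\<^bsub>L\<^esub> \<in> S \<and> \<top>\<^bsub>L\<^esub> \<in> S \<and>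
     (\<forall>x\<in>S. \<forall>y\<in>S. x \<sqinter>\<^bsub>L\<^esub> y \<in> S \<and> x \<squnion>\<^bsub>L\<^esub> y \<in> S)"

definition bounded_sublattice_gen :: "('a, 'x) gorder_scheme \<Rightarrow> 'a set \<Rightarrow> 'a set" where
  "bounded_sublattice_gen L G = \<Inter>{S. bounded_sublattice L S \<and> G \<subseteq> S}"

definition complements :: "('a, 'x) gorder_scheme \<Rightarrow> 'a \<Rightarrow> 'a \<Rightarrow> bool" where
  "complements L x y \<longleftrightarrow> x \<sqinter>\<^bsub>L\<^esub> y = \<bottom>\<^bsub>L\<^esub> \<and> x \<squnion>\<^bsub>L\<^esub> y = \<top>\<^bsub>L\<^esub>"

definition compact_frame :: "('a, 'x) gorder_scheme \<Rightarrow> bool" where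
  "compact_frame L \<longleftrightarrow> frame L \<and>
     (\<forall>X. X \<subseteq> carrier L \<and> \<Squnion>\<^bsub>L\<^esub> X = \<top>\<^bsub>L\<^esub> \<longrightarrow> (\<exists>F. F \<subseteq> X \<and> finite F \<and> \<Squnion>\<^bsub>L\<^esub> F = \<top>\<^bsub>L\<^esub>))"

section \<open>The category of Frith frames\<close>

record 'a frith = "'a gorder" +
  base :: "'a set"

definition frith_frame :: "'a frith \<Rightarrow> bool" where
  "frith_frame A \<longleftrightarrow> frame A \<and> bounded_sublattice A (base A) \<and>
     (\<forall>a\<in>carrier A. \<exists>X. X \<subseteq> base A \<and> a = \<Squnion>\<^bsub>A\<^esub> X)"

definition frith_hom :: "'a frith \<Rightarrow> 'b frith \<Rightarrow> ('a \<Rightarrow> 'b) set" where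
  "frith_hom A B = {h \<in> frame_hom A B. h ` base A \<subseteq> base B}"

definition frith_iso :: "'a frith \<Rightarrow> 'b frith \<Rightarrow> ('a \<Rightarrow> 'b) \<Rightarrow> bool" where
  "frith_iso A B h \<longleftrightarrow> h \<in> frith_hom A B \<and>
     (\<exists>k\<in>frith_hom B A. compose (carrier A) k h = (\<lambda>x\<in>carrier A. x) \<and>
                        compose (carrier B) h k = (\<lambda>y\<in>carrier B. y))"

definition dense_map ::
  "('a, 'x) gorder_scheme \<Rightarrow> ('b, 'y) gorder_scheme \<Rightarrow> ('a \<Rightarrow> 'b) \<Rightarrow> bool" where
  "dense_map L M h \<longleftrightarrow> (\<forall>a\<in>carrier L. h a = \<bottom>\<^bsub>M\<^esub> \<longrightarrow> a = \<bottom>\<^bsub>L\<^esub>)"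

text \<open>``Extremal epimorphism'' of Frith frames means \<open>h[S] = T\<close>.  The condition that every mono
  through which \<open>h\<close> factors be invertible would not do: a dense morphism with symmetric domain is monic,
  so with that condition every symmetric Frith frame would be complete.\<close>

definition extremal_epi :: "'a frith \<Rightarrow> 'b frith \<Rightarrow> ('a \<Rightarrow> 'b) \<Rightarrow> bool" where
  "extremal_epi A B h \<longleftrightarrow> h \<in> frith_hom A B \<and> h ` base A = base B"

text \<open>The base is a bounded distributive lattice, so it is a Boolean algebra as soon as it is closed
  under complements.\<close>

definition symmetric_frith :: "'a frith \<Rightarrow> bool" where
  "symmetric_frith A \<longleftrightarrow> frith_frame A \<and> (\<forall>x\<in>base A. \<exists>y\<in>base A. complements A x y)"

text \<open>Completeness of a symmetric Frith frame.  The bound variable \<open>M\<close> needs a fixed type.  The type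
  \<open>'a set\<close> loses nothing: the theorem \<open>complete_symmetric_any_type\<close> at the end of this theory extends
  the property to \<open>M\<close> over an arbitrary type.\<close>

definition complete_symmetric :: "'a frith \<Rightarrow> bool" where
  "complete_symmetric A \<longleftrightarrow> symmetric_frith A \<and>
     (\<forall>(M :: 'a set frith) h. symmetric_frith M \<and> dense_map M A h \<and> extremal_epi M A h
        \<longrightarrow> frith_iso M A h)"

section \<open>Congruence frames\<close>

text \<open>Congruences are the equivalence relations on the carrier that are closed under finite meets and
  arbitrary joins, computed componentwise.\<close>

definition frame_congruence :: "('a, 'x) gorder_scheme \<Rightarrow> ('a \<times> 'a) set \<Rightarrow> bool" where
  "frame_congruence L \<theta> \<longleftrightarrow> equiv (carrier L) \<theta> \<and>
     (\<forall>(x, y)\<in>\<theta>. \<forall>(x', y')\<in>\<theta>. (x \<sqinter>\<^bsub>L\<^esub> x', y \<sqinter>\<^bsub>L\<^esub> y') \<in> \<theta>) \<and>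
     (\<forall>R. R \<subseteq> \<theta> \<longrightarrow> (\<Squnion>\<^bsub>L\<^esub> (fst ` R), \<Squnion>\<^bsub>L\<^esub> (snd ` R)) \<in> \<theta>)"

definition congruence_frame :: "('a, 'x) gorder_scheme \<Rightarrow> ('a \<times> 'a) set gorder" where
  "congruence_frame L = \<lparr>carrier = {\<theta>. frame_congruence L \<theta>}, eq = (=), le = (\<subseteq>)\<rparr>"

definition nabla :: "('a, 'x) gorder_scheme \<Rightarrow> 'a \<Rightarrow> ('a \<times> 'a) set" where
  "nabla L a = {(x, y) \<in> carrier L \<times> carrier L. a \<squnion>\<^bsub>L\<^esub> x = a \<squnion>\<^bsub>L\<^esub> y}"

definition delta :: "('a, 'x) gorder_scheme \<Rightarrow> 'a \<Rightarrow> ('a \<times> 'a) set" where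
  "delta L a = {(x, y) \<in> carrier L \<times> carrier L. a \<sqinter>\<^bsub>L\<^esub> x = a \<sqinter>\<^bsub>L\<^esub> y}"

definition delta_subframe :: "'a frith \<Rightarrow> ('a \<times> 'a) set set" where
  "delta_subframe A = subframe_gen (congruence_frame A) (delta A ` base A)"

definition CS :: "'a frith \<Rightarrow> ('a \<times> 'a) set gorder" where
  "CS A = (congruence_frame A)
     \<lparr>carrier := subframe_gen (congruence_frame A) (nabla A ` carrier A \<union> delta_subframe A)\<rparr>"

text \<open>The frame homomorphism \<open>\<C>\<^sub>SL \<rightarrow> M\<close> extending \<open>h\<close> along \<open>a \<mapsto> \<nabla>\<^sub>a\<close>.\<close>

definition CS_extension ::
  "'a frith \<Rightarrow> ('b, 'y) gorder_scheme \<Rightarrow> ('a \<Rightarrow> 'b) \<Rightarrow> ('a \<times> 'a) set \<Rightarrow> 'b" where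
  "CS_extension A M h = (THE g. g \<in> frame_hom (CS A) M \<and> (\<forall>a\<in>carrier A. g (nabla A a) = h a))"

definition symmetrization :: "'a frith \<Rightarrow> ('a \<times> 'a) set frith" where
  "symmetrization A = \<lparr>carrier = carrier (CS A), eq = eq (CS A), le = le (CS A),
     base = bounded_sublattice_gen (CS A) (nabla A ` base A \<union> delta A ` base A)\<rparr>"

definition complete_frith :: "'a frith \<Rightarrow> bool" where
  "complete_frith A \<longleftrightarrow> frith_frame A \<and> complete_symmetric (symmetrization A)"

section \<open>The category of biframes\<close>

record 'a biframe = "'a gorder" +
  pos :: "'a set"
  neg :: "'a set"

definition is_biframe :: "'a biframe \<Rightarrow> bool" where
  "is_biframe K \<longleftrightarrow> frame K \<and> subframe K (pos K) \<and> subframe K (neg K) \<and>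
     (\<forall>a\<in>carrier K. \<exists>X. X \<subseteq> {\<Sqinter>\<^bsub>K\<^esub> F | F. finite F \<and> F \<subseteq> pos K \<union> neg K} \<and> a = \<Squnion>\<^bsub>K\<^esub> X)"

definition biframe_hom :: "'a biframe \<Rightarrow> 'b biframe \<Rightarrow> ('a \<Rightarrow> 'b) set" where
  "biframe_hom K N = {h \<in> frame_hom K N. h ` pos K \<subseteq> pos N \<and> h ` neg K \<subseteq> neg N}"

definition biframe_iso :: "'a biframe \<Rightarrow> 'b biframe \<Rightarrow> ('a \<Rightarrow> 'b) \<Rightarrow> bool" where
  "biframe_iso K N h \<longleftrightarrow> h \<in> biframe_hom K N \<and>
     (\<exists>k\<in>biframe_hom N K. compose (carrier K) k h = (\<lambda>x\<in>carrier K. x) \<and>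
                          compose (carrier N) h k = (\<lambda>y\<in>carrier N. y))"

definition pos_bicomplemented :: "'a biframe \<Rightarrow> 'a set" where
  "pos_bicomplemented K = {a \<in> pos K. \<exists>b\<in>neg K. complements K a b}"

definition neg_bicomplemented :: "'a biframe \<Rightarrow> 'a set" where
  "neg_bicomplemented K = {b \<in> neg K. \<exists>a\<in>pos K. complements K b a}"

definition zero_dimensional :: "'a biframe \<Rightarrow> bool" where
  "zero_dimensional K \<longleftrightarrow>
     (\<forall>a\<in>pos K. \<exists>X. X \<subseteq> pos_bicomplemented K \<and> a = \<Squnion>\<^bsub>K\<^esub> X) \<and>
     (\<forall>b\<in>neg K. \<exists>X. X \<subseteq> neg_bicomplemented K \<and> b = \<Squnion>\<^bsub>K\<^esub> X)"

definition KZ_biframe :: "'a biframe \<Rightarrow> bool" where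
  "KZ_biframe K \<longleftrightarrow> is_biframe K \<and> compact_frame K \<and> zero_dimensional K"

section \<open>The two functors, unit and counit\<close>

definition Sk :: "'a frith \<Rightarrow> ('a \<times> 'a) set biframe" where
  "Sk A = \<lparr>carrier = carrier (CS A), eq = eq (CS A), le = le (CS A),
     pos = nabla A ` carrier A, neg = delta_subframe A\<rparr>"

definition Sk_map :: "'a frith \<Rightarrow> 'b frith \<Rightarrow> ('a \<Rightarrow> 'b) \<Rightarrow> ('a \<times> 'a) set \<Rightarrow> ('b \<times> 'b) set" where
  "Sk_map A B h = CS_extension A (CS B) (\<lambda>a. nabla B (h a))"

definition Bplus :: "'a biframe \<Rightarrow> 'a frith" where
  "Bplus K = \<lparr>carrier = subframe_gen (K\<lparr>carrier := pos K\<rparr>) (pos_bicomplemented K),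
     eq = eq K, le = le K, base = pos_bicomplemented K\<rparr>"

definition Bplus_map :: "'a biframe \<Rightarrow> 'b biframe \<Rightarrow> ('a \<Rightarrow> 'b) \<Rightarrow> 'a \<Rightarrow> 'b" where
  "Bplus_map K N h = restrict h (carrier (Bplus K))"

definition unit_map :: "'a frith \<Rightarrow> 'a \<Rightarrow> ('a \<times> 'a) set" where
  "unit_map A = (\<lambda>a\<in>carrier A. nabla A a)"

definition counit_map :: "'a biframe \<Rightarrow> ('a \<times> 'a) set \<Rightarrow> 'a" where
  "counit_map K = CS_extension (Bplus K) K (\<lambda>a. a)"

section \<open>Completeness does not depend on the type of the test objects\<close>

lemma frith_frameD:
  assumes "frith_frame A"
  shows "frame A" "complete_lattice A" "base A \<subseteq> carrier A"
  using assms by (auto simp: frith_frame_def bounded_sublattice_def frame_def)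

locale order_isomorphism =
  fixes L :: "('a, 'x) gorder_scheme" and M :: "('b, 'y) gorder_scheme" and f :: "'a \<Rightarrow> 'b"
  assumes L: "complete_lattice L" and eqM: "eq M = (=)"
    and bij: "bij_betw f (carrier L) (carrier M)"
    and le_iff: "\<And>x y. \<lbrakk>x \<in> carrier L; y \<in> carrier L\<rbrakk> \<Longrightarrow> le M (f x) (f y) \<longleftrightarrow> le L x y"
begin

interpretation L: complete_lattice L by (rule L)

lemma carrier_eq: "carrier M = f ` carrier L"
  using bij by (simp add: bij_betw_def)

lemma inj: "inj_on f (carrier L)"
  using bij by (simp add: bij_betw_def)

lemma partial_order: "partial_order M"
proof
  show "eq M = (=)" by (rule eqM)
  show "le M x z" if "le M x y" "le M y z" "x \<in> carrier M" "y \<in> carrier M" "z \<in> carrier M" for x y z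
    using that unfolding carrier_eq by (elim imageE) (metis le_iff L.le_trans)
  show "eq M x y" if "le M x y" "le M y x" "x \<in> carrier M" "y \<in> carrier M" for x y
    using that unfolding carrier_eq eqM by (elim imageE) (metis le_iff L.le_antisym)
qed (auto simp: eqM carrier_eq le_iff)

lemma Upper_image: "X \<subseteq> carrier L \<Longrightarrow> Upper M (f ` X) = f ` Upper L X"
proof -
  assume X: "X \<subseteq> carrier L"
  have XM: "f ` X \<subseteq> carrier M" using X by (auto simp: carrier_eq)
  have "Upper M (f ` X) = {y \<in> f ` carrier L. \<forall>x\<in>X. le M (f x) y}"
    using XM by (auto simp: Upper_def carrier_eq)
  also have "\<dots> = f ` {y \<in> carrier L. \<forall>x\<in>X. le L x y}"
    using X by (auto simp: le_iff subset_iff)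
  also have "{y \<in> carrier L. \<forall>x\<in>X. le L x y} = Upper L X"
    using X by (auto simp: Upper_def)
  finally show ?thesis .
qed

lemma Lower_image: "X \<subseteq> carrier L \<Longrightarrow> Lower M (f ` X) = f ` Lower L X"
proof -
  assume X: "X \<subseteq> carrier L"
  have XM: "f ` X \<subseteq> carrier M" using X by (auto simp: carrier_eq)
  have "Lower M (f ` X) = {y \<in> f ` carrier L. \<forall>x\<in>X. le M y (f x)}"
    using XM by (auto simp: Lower_def carrier_eq)
  also have "\<dots> = f ` {y \<in> carrier L. \<forall>x\<in>X. le L y x}"
    using X by (auto simp: le_iff subset_iff)
  also have "{y \<in> carrier L. \<forall>x\<in>X. le L y x} = Lower L X"
    using X by (auto simp: Lower_def)
  finally show ?thesis .
qed

lemma least_image: "least L x X \<Longrightarrow> least M (f x) (f ` X)"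
  unfolding least_def carrier_eq by (auto simp: le_iff subset_iff)

lemma greatest_image: "greatest L x X \<Longrightarrow> greatest M (f x) (f ` X)"
  unfolding greatest_def carrier_eq by (auto simp: le_iff subset_iff)

lemma complete_lattice: "complete_lattice M"
proof (rule partial_order.complete_latticeI[OF partial_order])
  fix Y assume "Y \<subseteq> carrier M"
  then obtain X where X: "X \<subseteq> carrier L" "Y = f ` X"
    by (auto simp: carrier_eq subset_image_iff)
  show "\<exists>s. least M s (Upper M Y)"
    using least_image[OF L.sup_lub[OF X(1)]] X by (auto simp: Upper_image)
  show "\<exists>s. greatest M s (Lower M Y)"
    using greatest_image[OF L.inf_glb[OF X(1)]] X by (auto simp: Lower_image)
qed

interpretation M: complete_lattice M by (rule complete_lattice)

lemma sup_image:
  assumes X: "X \<subseteq> carrier L" shows "\<Squnion>\<^bsub>M\<^esub> (f ` X) = f (\<Squnion>\<^bsub>L\<^esub> X)"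
proof (rule M.least_unique)
  show "least M (\<Squnion>\<^bsub>M\<^esub> (f ` X)) (Upper M (f ` X))"
    by (rule M.sup_lub) (use X carrier_eq in auto)
  show "least M (f (\<Squnion>\<^bsub>L\<^esub> X)) (Upper M (f ` X))"
    using least_image[OF L.sup_lub[OF X]] by (simp add: Upper_image X)
qed

lemma inf_image:
  assumes X: "X \<subseteq> carrier L" shows "\<Sqinter>\<^bsub>M\<^esub> (f ` X) = f (\<Sqinter>\<^bsub>L\<^esub> X)"
proof (rule M.greatest_unique)
  show "greatest M (\<Sqinter>\<^bsub>M\<^esub> (f ` X)) (Lower M (f ` X))"
    by (rule M.inf_glb) (use X carrier_eq in auto)
  show "greatest M (f (\<Sqinter>\<^bsub>L\<^esub> X)) (Lower M (f ` X))"
    using greatest_image[OF L.inf_glb[OF X]] by (simp add: Lower_image X)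
qed

lemma join_image: "\<lbrakk>x \<in> carrier L; y \<in> carrier L\<rbrakk> \<Longrightarrow> f x \<squnion>\<^bsub>M\<^esub> f y = f (x \<squnion>\<^bsub>L\<^esub> y)"
  using sup_image[of "{x, y}"] by (simp add: join_def)

lemma meet_image: "\<lbrakk>x \<in> carrier L; y \<in> carrier L\<rbrakk> \<Longrightarrow> f x \<sqinter>\<^bsub>M\<^esub> f y = f (x \<sqinter>\<^bsub>L\<^esub> y)"
  using inf_image[of "{x, y}"] by (simp add: meet_def)

lemma top_image: "\<top>\<^bsub>M\<^esub> = f \<top>\<^bsub>L\<^esub>"
  by (rule M.greatest_unique[OF M.top_greatest]) (use greatest_image[OF L.top_greatest] carrier_eq in simp)

lemma bottom_image: "\<bottom>\<^bsub>M\<^esub> = f \<bottom>\<^bsub>L\<^esub>"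
  by (rule M.least_unique[OF M.bottom_least]) (use least_image[OF L.bottom_least] carrier_eq in simp)

lemma frame_image:
  assumes "frame L" shows "frame M"
proof -
  interpret F: frame L by (rule assms)
  show ?thesis
  proof (intro frame.intro complete_lattice frame_axioms.intro)
    fix b Y assume "b \<in> carrier M" "Y \<subseteq> carrier M"
    then obtain a X where aX: "a \<in> carrier L" "b = f a" "X \<subseteq> carrier L" "Y = f ` X"
      by (auto simp: carrier_eq subset_image_iff)
    have mX: "(\<lambda>x. a \<sqinter>\<^bsub>L\<^esub> x) ` X \<subseteq> carrier L" using aX by auto
    have "b \<sqinter>\<^bsub>M\<^esub> \<Squnion>\<^bsub>M\<^esub> Y = f (\<Squnion>\<^bsub>L\<^esub> ((\<lambda>x. a \<sqinter>\<^bsub>L\<^esub> x) ` X))"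
      using aX by (simp add: sup_image meet_image F.meet_sup_distrib)
    also have "\<dots> = \<Squnion>\<^bsub>M\<^esub> (f ` (\<lambda>x. a \<sqinter>\<^bsub>L\<^esub> x) ` X)" by (simp add: sup_image mX)
    also have "f ` (\<lambda>x. a \<sqinter>\<^bsub>L\<^esub> x) ` X = (\<lambda>y. b \<sqinter>\<^bsub>M\<^esub> y) ` Y"
      unfolding aX(2,4) image_image using aX(1,3)
      by (intro image_cong refl) (simp add: meet_image subset_iff)
    finally show "b \<sqinter>\<^bsub>M\<^esub> \<Squnion>\<^bsub>M\<^esub> Y = \<Squnion>\<^bsub>M\<^esub> ((\<lambda>y. b \<sqinter>\<^bsub>M\<^esub> y) ` Y)" .
  qed
qed

lemma frame_hom_restrict: "restrict f (carrier L) \<in> frame_hom L M"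
proof -
  have "restrict f (carrier L) ` X = f ` X" if "X \<subseteq> carrier L" for X
    using that by (auto simp: subset_iff)
  then show ?thesis
    unfolding frame_hom_def
    by (auto simp: top_image meet_image sup_image carrier_eq)
qed

end

lemma order_isomorphism_inverse:
  assumes "order_isomorphism L M f"
  shows "order_isomorphism M L (inv_into (carrier L) f)"
proof -
  interpret order_isomorphism L M f by (rule assms)
  show ?thesis
  proof (rule order_isomorphism.intro)
    show "complete_lattice M" by (rule complete_lattice)
    show "eq L = (=)" by (rule partial_order.eq_is_equal) (rule complete_lattice.axioms(1)[OF L])
    show "bij_betw (inv_into (carrier L) f) (carrier M) (carrier L)"
      by (rule bij_betw_inv_into[OF bij])
    show "le L (inv_into (carrier L) f x) (inv_into (carrier L) f y) \<longleftrightarrow> le M x y"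
      if "x \<in> carrier M" "y \<in> carrier M" for x y
      using that by (auto simp: carrier_eq inj le_iff)
  qed
qed

lemma frame_hom_compose:
  assumes "frame L" "h \<in> frame_hom L M" "k \<in> frame_hom M N"
  shows "compose (carrier L) k h \<in> frame_hom L N"
proof -
  interpret frame L by (rule assms)
  have h: "h x \<in> carrier M" if "x \<in> carrier L" for x
    using assms that by (auto simp: frame_hom_def)
  have img: "compose (carrier L) k h ` X = k ` h ` X" if "X \<subseteq> carrier L" for X
    using that by (force simp: compose_def)
  have hX: "h ` X \<subseteq> carrier M" if "X \<subseteq> carrier L" for X using that h by auto
  have k: "k y \<in> carrier N" if "y \<in> carrier M" for y
    using assms that by (auto simp: frame_hom_def)
  show ?thesis
    unfolding frame_hom_def
  proof (intro CollectI conjI ballI allI impI)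
    show "compose (carrier L) k h \<in> carrier L \<rightarrow>\<^sub>E carrier N"
      using h k by (auto simp: compose_def)
    show "compose (carrier L) k h \<top>\<^bsub>L\<^esub> = \<top>\<^bsub>N\<^esub>"
      using assms by (simp add: compose_eq frame_hom_def)
    show "compose (carrier L) k h (x \<sqinter>\<^bsub>L\<^esub> y) = compose (carrier L) k h x \<sqinter>\<^bsub>N\<^esub> compose (carrier L) k h y"
      if "x \<in> carrier L" "y \<in> carrier L" for x y
      using assms that h by (simp add: compose_eq frame_hom_def)
    show "compose (carrier L) k h (\<Squnion>\<^bsub>L\<^esub> X) = \<Squnion>\<^bsub>N\<^esub> (compose (carrier L) k h ` X)"
      if "X \<subseteq> carrier L" for X
      unfolding img[OF that] using assms that hX[OF that] by (simp add: compose_eq frame_hom_def)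
  qed
qed

lemma frith_hom_compose:
  assumes "frith_frame A" "h \<in> frith_hom A B" "k \<in> frith_hom B C"
  shows "compose (carrier A) k h \<in> frith_hom A C"
  using assms frith_frameD[OF assms(1)] frame_hom_compose[of A h B k C]
  by (auto simp: frith_hom_def compose_def subset_iff)

theorem complete_symmetric_any_type:
  fixes A :: "'a frith" and M :: "'m frith"
  assumes A: "complete_symmetric A" and M: "symmetric_frith M"
    and dense: "dense_map M A h" and epi: "extremal_epi M A h"
  shows "frith_iso M A h"
proof -
  have FM: "frith_frame M" and FA: "frith_frame A"
    using A M by (auto simp: complete_symmetric_def symmetric_frith_def)
  interpret M: frame M using frith_frameD[OF FM] by simp
  interpret A: frame A using frith_frameD[OF FA] by simp
  have bM: "base M \<subseteq> carrier M" by (rule frith_frameD[OF FM])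
  have h: "h \<in> frame_hom M A" and hb: "h ` base M = base A"
    using epi by (auto simp: extremal_epi_def frith_hom_def)
  have hc: "h x \<in> carrier A" if "x \<in> carrier M" for x
    using h that by (auto simp: frame_hom_def)
  have hmeet: "h (x \<sqinter>\<^bsub>M\<^esub> y) = h x \<sqinter>\<^bsub>A\<^esub> h y" if "x \<in> carrier M" "y \<in> carrier M" for x y
    using h that by (auto simp: frame_hom_def)
  have hbot: "h \<bottom>\<^bsub>M\<^esub> = \<bottom>\<^bsub>A\<^esub>"
  proof -
    have "h (\<Squnion>\<^bsub>M\<^esub> {}) = \<Squnion>\<^bsub>A\<^esub> (h ` {})" using h unfolding frame_hom_def by blast
    then show ?thesis by (metis A.eq_is_equal A.weak_sup_empty M.eq_is_equal M.weak_sup_empty image_empty)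
  qed

  \<comment> \<open>A dense homomorphism reflects the order of a Boolean base.\<close>
  have reflects: "le M x y" if x: "x \<in> base M" and y: "y \<in> base M" and le: "le A (h x) (h y)" for x y
  proof -
    obtain z where z: "z \<in> base M" "complements M y z"
      using M y by (auto simp: symmetric_frith_def)
    have c: "x \<in> carrier M" "y \<in> carrier M" "z \<in> carrier M" using x y z bM by auto
    have "le A (h (x \<sqinter>\<^bsub>M\<^esub> z)) (h y \<sqinter>\<^bsub>A\<^esub> h z)"
      using c hc le by (simp add: hmeet) (meson A.le_trans A.meet_closed A.meet_le A.meet_left A.meet_right)
    also have "h y \<sqinter>\<^bsub>A\<^esub> h z = \<bottom>\<^bsub>A\<^esub>"
      using z(2) c by (simp add: complements_def hmeet[symmetric] hbot)
    finally have "h (x \<sqinter>\<^bsub>M\<^esub> z) = \<bottom>\<^bsub>A\<^esub>"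
      using c hc by (meson A.bottom_closed A.bottom_lower A.le_antisym M.meet_closed)
    then have 0: "x \<sqinter>\<^bsub>M\<^esub> z = \<bottom>\<^bsub>M\<^esub>" using dense c by (simp add: dense_map_def)
    have "x = x \<sqinter>\<^bsub>M\<^esub> \<Squnion>\<^bsub>M\<^esub> {y, z}"
      using z(2) c by (metis M.eq_is_equal M.top_meet complements_def join_def meet_comm)
    also have "\<dots> = \<Squnion>\<^bsub>M\<^esub> {x \<sqinter>\<^bsub>M\<^esub> y, \<bottom>\<^bsub>M\<^esub>}"
      using c by (simp add: M.meet_sup_distrib 0)
    also have "\<dots> = \<bottom>\<^bsub>M\<^esub> \<squnion>\<^bsub>M\<^esub> (x \<sqinter>\<^bsub>M\<^esub> y)" by (simp add: join_def insert_commute)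
    also have "\<dots> = x \<sqinter>\<^bsub>M\<^esub> y" using c by (metis M.bottom_join M.eq_is_equal M.meet_closed)
    finally show ?thesis using c by (metis M.meet_right)
  qed

  define p where "p m = h ` {c \<in> base M. le M c m}" for m
  have p_mono: "p m \<subseteq> p n" if "le M m n" "m \<in> carrier M" "n \<in> carrier M" for m n
    using that bM unfolding p_def by (blast intro: M.le_trans)
  have p_refl: "le M m n" if s: "p m \<subseteq> p n" and m: "m \<in> carrier M" and n: "n \<in> carrier M" for m n
  proof -
    obtain X where X: "X \<subseteq> base M" "m = \<Squnion>\<^bsub>M\<^esub> X" using FM m by (auto simp: frith_frame_def)
    have "le M x n" if "x \<in> X" for x
    proof -
      have "le M x m" using X bM that by (auto intro!: M.sup_upper)
      then have "h x \<in> p m" using X(1) that by (auto simp: p_def)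
      then have "h x \<in> p n" using s by auto
      then obtain c where c: "c \<in> base M" "le M c n" "h x = h c" by (auto simp: p_def)
      have "le M x c"
        by (rule reflects) (use c X bM that hc in auto)
      then show ?thesis using c X bM that n by (meson M.le_trans subsetD)
    qed
    then show ?thesis using X bM n by (auto intro!: M.sup_least)
  qed
  have inj: "inj_on p (carrier M)"
    by (rule inj_onI) (simp add: M.le_antisym p_refl)

  define N :: "'a set frith" where
    "N = \<lparr>carrier = p ` carrier M, eq = (=), le = (\<subseteq>), base = p ` base M\<rparr>"
  have iso: "order_isomorphism M N p"
  proof (rule order_isomorphism.intro)
    show "complete_lattice M" by (rule frith_frameD[OF FM])
    show "bij_betw p (carrier M) (carrier N)" using inj by (simp add: N_def bij_betw_def)
    show "le N (p x) (p y) \<longleftrightarrow> le M x y" if "x \<in> carrier M" "y \<in> carrier M" for x y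
      using that by (auto simp: N_def dest: p_mono p_refl)
  qed (simp add: N_def)
  interpret I: order_isomorphism M N p by (rule iso)
  define q where "q = inv_into (carrier M) p"
  interpret J: order_isomorphism N M q unfolding q_def by (rule order_isomorphism_inverse[OF iso])
  have qp: "q (p m) = m" if "m \<in> carrier M" for m
    using that inj by (simp add: q_def)
  have FN: "frith_frame N"
    unfolding frith_frame_def
  proof (intro conjI ballI)
    show "frame N" by (rule I.frame_image) (rule frith_frameD[OF FM])
    show "bounded_sublattice N (base N)"
      using FM bM unfolding frith_frame_def bounded_sublattice_def
      by (auto simp: I.bottom_image I.top_image N_def[THEN arg_cong[where f = base]]
          I.carrier_eq I.meet_image I.join_image subset_iff)
    fix a assume "a \<in> carrier N"
    then obtain m where m: "m \<in> carrier M" "a = p m" by (auto simp: N_def)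
    obtain X where X: "X \<subseteq> base M" "m = \<Squnion>\<^bsub>M\<^esub> X" using FM m by (auto simp: frith_frame_def)
    show "\<exists>X. X \<subseteq> base N \<and> a = \<Squnion>\<^bsub>N\<^esub> X"
      by (rule exI[of _ "p ` X"]) (use X m bM I.sup_image[of X] in \<open>auto simp: N_def\<close>)
  qed
  have bN: "base N = p ` base M" by (simp add: N_def)
  have SN: "symmetric_frith N"
    unfolding symmetric_frith_def
  proof (intro conjI FN ballI)
    fix x assume "x \<in> base N"
    then obtain m where m: "m \<in> base M" "x = p m" by (auto simp: bN)
    obtain n where n: "n \<in> base M" "complements M m n" using M m by (auto simp: symmetric_frith_def)
    have "complements N x (p n)"
      using m n bM by (simp add: complements_def I.meet_image I.join_image I.bottom_image I.top_image subset_iff)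
    then show "\<exists>y\<in>base N. complements N x y" using n bN by auto
  qed
  define p' where "p' = restrict p (carrier M)"
  define q' where "q' = restrict q (carrier N)"
  have p': "p' \<in> frith_hom M N"
    using I.frame_hom_restrict bM by (auto simp: frith_hom_def p'_def bN)
  have q': "q' \<in> frith_hom N M"
    using J.frame_hom_restrict bM by (auto simp: frith_hom_def q'_def bN qp subset_iff I.carrier_eq)
  define g where "g = compose (carrier N) h q'"
  have hF: "h \<in> frith_hom M A" using epi by (simp add: extremal_epi_def)
  have g: "g \<in> frith_hom N A" unfolding g_def by (rule frith_hom_compose[OF FN q' hF])
  have gp: "g (p m) = h m" if "m \<in> carrier M" for m
    using that by (simp add: g_def compose_def q'_def I.carrier_eq qp)
  have "dense_map N A g"
    using dense by (auto simp: dense_map_def I.carrier_eq gp I.bottom_image)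
  moreover have "g ` base N = h ` base M"
    unfolding bN image_image by (rule image_cong) (use bM gp in auto)
  then have "extremal_epi N A g" using g hb by (simp add: extremal_epi_def)
  ultimately have "frith_iso N A g" using A SN by (auto simp: complete_symmetric_def)
  then obtain k where k: "k \<in> frith_hom A N"
    and kg: "compose (carrier N) k g = (\<lambda>x\<in>carrier N. x)"
    and gk: "compose (carrier A) g k = (\<lambda>x\<in>carrier A. x)"
    by (auto simp: frith_iso_def)
  have kc: "k a \<in> carrier N" if "a \<in> carrier A" for a
    using k that by (auto simp: frith_hom_def frame_hom_def)
  have "compose (carrier A) q' k \<in> frith_hom A M"
    by (rule frith_hom_compose[OF FA k q'])
  moreover have "compose (carrier M) (compose (carrier A) q' k) h = (\<lambda>x\<in>carrier M. x)"
  proof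
    fix m show "compose (carrier M) (compose (carrier A) q' k) h m = (\<lambda>x\<in>carrier M. x) m"
    proof (cases "m \<in> carrier M")
      case True
      then have pm: "p m \<in> carrier N" by (simp add: I.carrier_eq)
      have "k (h m) = p m" using fun_cong[OF kg, of "p m"] pm True by (simp add: compose_def gp)
      then show ?thesis using True pm by (simp add: compose_def hc q'_def qp)
    qed (simp add: compose_def)
  qed
  moreover have "compose (carrier A) h (compose (carrier A) q' k) = (\<lambda>x\<in>carrier A. x)"
  proof
    fix a show "compose (carrier A) h (compose (carrier A) q' k) a = (\<lambda>x\<in>carrier A. x) a"
    proof (cases "a \<in> carrier A")
      case True
      then show ?thesis using fun_cong[OF gk, of a] kc[OF True] by (simp add: compose_def g_def)
    qed (simp add: compose_def)
  qed
  ultimately show ?thesis unfolding frith_iso_def using hF by blast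
qed

end

theory Submission
  imports Defs
begin

text \<open>
  The whole equivalence rests on compactness.  A symmetric Frith frame is complete exactly when its
  frame is compact (\<open>complete_symmetric_iff_compact\<close>).  If the frame is compact, its complemented
  elements are compact, so for a dense morphism onto it from a symmetric Frith frame reflection of the
  order need only be checked between base elements; there density gives it, through complements.
  Conversely, \<open>I \<mapsto> \<Squnion>I\<close> from the frame of ideals of the base is a dense extremal epimorphism onto
  every symmetric Frith frame; when it is invertible, the frame is a frame of ideals of a lattice, hence
  compact.  So \<open>(L, S)\<close> is complete iff \<open>\<C>\<^sub>SL\<close> is compact (\<open>complete_frith_iff_compact\<close>).

  The adjunction is the universal property of \<open>\<C>\<^sub>SL\<close>.  Everything in \<open>\<C>\<^sub>SL\<close> is a join of cells
  \<open>\<nabla>\<^sub>s \<inter> \<Delta>\<^sub>t\<close> with \<open>s\<close>, \<open>t\<close> in the base, and such a cell is the congruence generated by the single pair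
  \<open>(t, t \<squnion> s)\<close>.  This makes the extension of \<open>h : L \<rightarrow> M\<close> a left adjoint: \<open>g \<theta> \<sqsubseteq> m\<close> iff \<open>\<theta>\<close> is contained
  in the kernel of \<open>x \<mapsto> m \<squnion> h x\<close>.  Functoriality, naturality and both triangle identities then follow
  by comparing values at the congruences \<open>\<nabla>\<^sub>a\<close>.

  For the equivalence, let \<open>K\<close> be a compact zero-dimensional biframe.  The counit sends \<open>\<nabla>\<^sub>s \<inter> \<Delta>\<^sub>t\<close> to \<open>s\<close> meet
  the complement of \<open>t\<close>, which is \<open>\<bottom>\<close> only if the cell is trivial; so the counit is dense, and by compactness
  of \<open>K\<close> injective.  It is onto because zero-dimensionality puts both parts of \<open>K\<close> in its image.  In
  particular the domain inherits compactness from \<open>K\<close>, which is completeness of \<open>Bplus K\<close>.  In the other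
  direction, if \<open>\<C>\<^sub>SL\<close> is compact then a bicomplemented \<open>\<nabla>\<^sub>a\<close> is compact, so \<open>a\<close> is a finite join of base
  elements and lies in \<open>S\<close>; hence the unit is an isomorphism.
\<close>

section \<open>Arithmetic in a frame\<close>

context frame
begin

lemma le_refl: "x \<in> carrier L \<Longrightarrow> x \<sqsubseteq> x"
  by (simp add: eq_is_equal)

lemma sup_le_iff: "X \<subseteq> carrier L \<Longrightarrow> z \<in> carrier L \<Longrightarrow> \<Squnion>X \<sqsubseteq> z \<longleftrightarrow> (\<forall>x\<in>X. x \<sqsubseteq> z)"
  by (meson le_trans sup_closed sup_least sup_upper subsetD)

lemma join_le_iff:
  "\<lbrakk>x \<in> carrier L; y \<in> carrier L; z \<in> carrier L\<rbrakk> \<Longrightarrow> x \<squnion> y \<sqsubseteq> z \<longleftrightarrow> x \<sqsubseteq> z \<and> y \<sqsubseteq> z"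
  by (meson join_closed join_le join_left join_right le_trans)

lemma le_meet_iff:
  "\<lbrakk>x \<in> carrier L; y \<in> carrier L; z \<in> carrier L\<rbrakk> \<Longrightarrow> z \<sqsubseteq> x \<sqinter> y \<longleftrightarrow> z \<sqsubseteq> x \<and> z \<sqsubseteq> y"
  by (meson meet_closed meet_le meet_left meet_right le_trans)

lemma eqI_above:
  assumes "x \<in> carrier L" "y \<in> carrier L" "\<And>z. z \<in> carrier L \<Longrightarrow> x \<sqsubseteq> z \<longleftrightarrow> y \<sqsubseteq> z"
  shows "x = y"
  using assms by (meson le_antisym le_refl)

lemma eqI_below:
  assumes "x \<in> carrier L" "y \<in> carrier L" "\<And>z. z \<in> carrier L \<Longrightarrow> z \<sqsubseteq> x \<longleftrightarrow> z \<sqsubseteq> y"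
  shows "x = y"
  using assms by (meson le_antisym le_refl)

lemma sup_empty: "\<Squnion>{} = \<bottom>"
  using weak_sup_empty by (simp add: eq_is_equal)

lemma le_bottom_iff: "x \<in> carrier L \<Longrightarrow> x \<sqsubseteq> \<bottom> \<longleftrightarrow> x = \<bottom>"
  by (metis bottom_closed bottom_lower le_antisym)

lemma join_absorb: "\<lbrakk>x \<in> carrier L; y \<in> carrier L\<rbrakk> \<Longrightarrow> x \<sqsubseteq> y \<longleftrightarrow> x \<squnion> y = y"
  by (metis join_le_iff join_closed le_antisym le_refl)

lemma meet_absorb: "\<lbrakk>x \<in> carrier L; y \<in> carrier L\<rbrakk> \<Longrightarrow> x \<sqsubseteq> y \<longleftrightarrow> x \<sqinter> y = x"
  by (metis le_meet_iff meet_closed le_antisym le_refl)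

lemma meet_idem: "x \<in> carrier L \<Longrightarrow> x \<sqinter> x = x"
  using le_refl meet_absorb by blast

lemma join_idem: "x \<in> carrier L \<Longrightarrow> x \<squnion> x = x"
  using le_refl join_absorb by blast

lemma top_meet: "x \<in> carrier L \<Longrightarrow> \<top> \<sqinter> x = x"
  by (metis le_antisym le_meet_iff le_refl meet_closed top_closed top_higher)

lemma bottom_join: "x \<in> carrier L \<Longrightarrow> \<bottom> \<squnion> x = x"
  by (metis join_absorb bottom_closed bottom_lower)

lemma top_join: "x \<in> carrier L \<Longrightarrow> \<top> \<squnion> x = \<top>"
  by (metis join_absorb join_comm top_closed top_higher)

lemma bottom_meet: "x \<in> carrier L \<Longrightarrow> \<bottom> \<sqinter> x = \<bottom>"
  by (metis meet_absorb bottom_closed bottom_lower)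

lemma meet_join_distrib:
  assumes "a \<in> carrier L" "b \<in> carrier L" "c \<in> carrier L"
  shows "a \<sqinter> (b \<squnion> c) = (a \<sqinter> b) \<squnion> (a \<sqinter> c)"
  using meet_sup_distrib[of a "{b, c}"] assms by (simp add: join_def)

lemma join_meet_distrib:
  assumes a: "a \<in> carrier L" and b: "b \<in> carrier L" and c: "c \<in> carrier L"
  shows "a \<squnion> (b \<sqinter> c) = (a \<squnion> b) \<sqinter> (a \<squnion> c)"
proof (rule le_antisym)
  have "(a \<squnion> b) \<sqinter> (a \<squnion> c) = ((a \<squnion> b) \<sqinter> a) \<squnion> ((c \<sqinter> a) \<squnion> (c \<sqinter> b))"
    using a b c by (simp only: meet_join_distrib join_closed meet_comm[of L c])
      (simp only: meet_comm[of L _ c] meet_join_distrib)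
  also have "\<dots> \<sqsubseteq> a \<squnion> (b \<sqinter> c)"
  proof -
    have "(a \<squnion> b) \<sqinter> a \<sqsubseteq> a" "c \<sqinter> a \<sqsubseteq> a" using a b c by (simp_all add: meet_right)
    moreover have "a \<sqsubseteq> a \<squnion> (b \<sqinter> c)" "c \<sqinter> b \<sqsubseteq> a \<squnion> (b \<sqinter> c)"
      using a b c by (simp_all add: join_left join_right meet_comm[of L c])
    ultimately show ?thesis
      using a b c by (meson join_closed join_le le_trans meet_closed)
  qed
  finally show "(a \<squnion> b) \<sqinter> (a \<squnion> c) \<sqsubseteq> a \<squnion> (b \<sqinter> c)" .
  show "a \<squnion> (b \<sqinter> c) \<sqsubseteq> (a \<squnion> b) \<sqinter> (a \<squnion> c)"
  proof -
    have "b \<sqinter> c \<sqsubseteq> a \<squnion> b" "b \<sqinter> c \<sqsubseteq> a \<squnion> c"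
      using a b c by (meson join_closed join_right le_trans meet_closed meet_left meet_right)+
    then show ?thesis
      using a b c by (simp add: join_le_iff le_meet_iff join_left)
  qed
qed (use a b c in auto)

lemma sup_insert: "\<lbrakk>a \<in> carrier L; X \<subseteq> carrier L\<rbrakk> \<Longrightarrow> \<Squnion>(insert a X) = a \<squnion> \<Squnion>X"
  by (rule eqI_above) (auto simp: sup_le_iff join_le_iff)

lemma sup_Un: "\<lbrakk>X \<subseteq> carrier L; Y \<subseteq> carrier L\<rbrakk> \<Longrightarrow> \<Squnion>(X \<union> Y) = \<Squnion>X \<squnion> \<Squnion>Y"
  by (rule eqI_above) (auto simp: sup_le_iff join_le_iff)

lemma sup_mono: "\<lbrakk>X \<subseteq> Y; Y \<subseteq> carrier L\<rbrakk> \<Longrightarrow> \<Squnion>X \<sqsubseteq> \<Squnion>Y"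
  by (meson sup_closed sup_least sup_upper subset_iff)

lemma sup_UN:
  assumes "\<And>i. i \<in> I \<Longrightarrow> F i \<subseteq> carrier L"
  shows "\<Squnion>(\<Union>i\<in>I. F i) = \<Squnion>((\<lambda>i. \<Squnion>(F i)) ` I)"
proof (rule eqI_above)
  have 1: "(\<Union>i\<in>I. F i) \<subseteq> carrier L" and 2: "(\<lambda>i. \<Squnion>(F i)) ` I \<subseteq> carrier L"
    using assms by auto
  then show "\<Squnion>(\<Union>i\<in>I. F i) \<in> carrier L" "\<Squnion>((\<lambda>i. \<Squnion>(F i)) ` I) \<in> carrier L" by auto
  fix z assume "z \<in> carrier L"
  then show "\<Squnion>(\<Union>i\<in>I. F i) \<sqsubseteq> z \<longleftrightarrow> \<Squnion>((\<lambda>i. \<Squnion>(F i)) ` I) \<sqsubseteq> z"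
    using 1 2 assms by (auto simp: sup_le_iff)
qed

lemma join_sup:
  assumes "a \<in> carrier L" "X \<subseteq> carrier L" "X \<noteq> {}"
  shows "a \<squnion> \<Squnion>X = \<Squnion>((\<lambda>x. a \<squnion> x) ` X)"
proof (rule eqI_above)
  have 1: "(\<lambda>x. a \<squnion> x) ` X \<subseteq> carrier L" using assms by auto
  then show "\<Squnion>((\<lambda>x. a \<squnion> x) ` X) \<in> carrier L" "a \<squnion> \<Squnion>X \<in> carrier L" using assms by auto
  fix z assume "z \<in> carrier L"
  then show "a \<squnion> \<Squnion>X \<sqsubseteq> z \<longleftrightarrow> \<Squnion>((\<lambda>x. a \<squnion> x) ` X) \<sqsubseteq> z"
    using 1 assms by (auto simp: sup_le_iff join_le_iff subset_iff)
qed

lemma sup_meet_sup: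
  assumes "X \<subseteq> carrier L" "Y \<subseteq> carrier L"
  shows "\<Squnion>X \<sqinter> \<Squnion>Y = \<Squnion>{x \<sqinter> y |x y. x \<in> X \<and> y \<in> Y}"
proof -
  have "\<Squnion>X \<sqinter> \<Squnion>Y = \<Squnion>((\<lambda>x. \<Squnion>Y \<sqinter> x) ` X)"
    using assms by (simp add: meet_comm[of L "\<Squnion>X"] meet_sup_distrib)
  also have "\<dots> = \<Squnion>((\<lambda>x. \<Squnion>((\<lambda>y. x \<sqinter> y) ` Y)) ` X)"
    using assms by (intro arg_cong[where f = "\<lambda>X. \<Squnion>X"] image_cong refl)
      (auto simp: meet_comm[of L "\<Squnion>Y"] meet_sup_distrib)
  also have "\<dots> = \<Squnion>(\<Union>x\<in>X. (\<lambda>y. x \<sqinter> y) ` Y)"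
    using assms by (intro sup_UN[symmetric]) (auto simp: subset_iff)
  also have "(\<Union>x\<in>X. (\<lambda>y. x \<sqinter> y) ` Y) = {x \<sqinter> y |x y. x \<in> X \<and> y \<in> Y}" by auto
  finally show ?thesis .
qed

text \<open>The form in which complements are used: they move a meetand across \<open>\<sqsubseteq>\<close>.\<close>

lemma complement_shunt:
  assumes c: "complements L s c" and "s \<in> carrier L" "c \<in> carrier L" "a \<in> carrier L" "m \<in> carrier L"
  shows "a \<sqinter> c \<sqsubseteq> m \<longleftrightarrow> a \<sqsubseteq> s \<squnion> m"
proof
  assume l: "a \<sqinter> c \<sqsubseteq> m"
  have "a = a \<sqinter> (s \<squnion> c)" using assms by (metis complements_def meet_comm top_meet)
  also have "\<dots> = (a \<sqinter> s) \<squnion> (a \<sqinter> c)" using assms by (simp add: meet_join_distrib)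
  also have "\<dots> \<sqsubseteq> s \<squnion> m"
  proof (rule join_le)
    show "a \<sqinter> s \<sqsubseteq> s \<squnion> m" using assms by (intro le_trans[OF meet_right join_left]) auto
    show "a \<sqinter> c \<sqsubseteq> s \<squnion> m" using assms by (intro le_trans[OF l join_right]) auto
  qed (use assms in auto)
  finally show "a \<sqsubseteq> s \<squnion> m" .
next
  assume l: "a \<sqsubseteq> s \<squnion> m"
  have "a \<sqinter> c \<sqsubseteq> c \<sqinter> (s \<squnion> m)"
    using assms by (simp add: le_meet_iff meet_right le_trans[OF meet_left l])
  also have "c \<sqinter> (s \<squnion> m) = (s \<sqinter> c) \<squnion> (c \<sqinter> m)"
    using assms by (simp add: meet_join_distrib meet_comm[of L c s])
  also have "\<dots> = c \<sqinter> m" using assms by (simp add: complements_def bottom_join)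
  also have "c \<sqinter> m \<sqsubseteq> m" using assms by (simp add: meet_right)
  finally show "a \<sqinter> c \<sqsubseteq> m" using assms by simp
qed

lemma complements_commute: "complements L x y \<longleftrightarrow> complements L y x"
  by (simp add: complements_def meet_comm[of L x] join_comm[of L x])

lemma complement_le:
  assumes "complements L s c" "complements L s d" "s \<in> carrier L" "c \<in> carrier L" "d \<in> carrier L"
  shows "c \<sqsubseteq> d"
proof -
  have "c \<sqsubseteq> s \<squnion> d" using assms by (metis complements_def top_higher)
  then have "c \<sqinter> c \<sqsubseteq> d" using complement_shunt[of s c c d] assms by simp
  then show ?thesis using assms by (metis le_refl meet_absorb)
qed

lemma complement_unique:
  assumes "complements L s c" "complements L s d" "s \<in> carrier L" "c \<in> carrier L" "d \<in> carrier L"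
  shows "c = d"
  using assms complement_le by (meson le_antisym)

lemma complements_meet_join:
  assumes "complements L s c" "complements L t d"
    and "s \<in> carrier L" "c \<in> carrier L" "t \<in> carrier L" "d \<in> carrier L"
  shows "complements L (s \<sqinter> t) (c \<squnion> d)"
proof -
  have 1: "s \<sqinter> c = \<bottom>" "t \<sqinter> d = \<bottom>" "s \<squnion> c = \<top>" "t \<squnion> d = \<top>"
    using assms by (simp_all add: complements_def)
  have "(s \<sqinter> t) \<sqinter> c \<sqsubseteq> s \<sqinter> c" "(s \<sqinter> t) \<sqinter> d \<sqsubseteq> t \<sqinter> d"
    using assms by (simp_all add: le_meet_iff meet_right le_trans[OF meet_left meet_left]
        le_trans[OF meet_left meet_right])
  then have "(s \<sqinter> t) \<sqinter> (c \<squnion> d) = \<bottom>"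
    using assms by (simp add: meet_join_distrib 1 le_bottom_iff bottom_join)
  moreover have "s \<squnion> c \<sqsubseteq> (c \<squnion> d) \<squnion> s" "t \<squnion> d \<sqsubseteq> (c \<squnion> d) \<squnion> t"
    using assms by (simp_all add: join_le_iff join_right le_trans[OF join_left join_left]
        le_trans[OF join_right join_left])
  then have "(c \<squnion> d) \<squnion> s = \<top>" "(c \<squnion> d) \<squnion> t = \<top>"
    using assms by (simp_all add: 1 le_antisym)
  then have "(s \<sqinter> t) \<squnion> (c \<squnion> d) = \<top>"
    using assms by (simp add: join_comm[of L "s \<sqinter> t"] join_meet_distrib top_meet)
  ultimately show ?thesis by (simp add: complements_def)
qed

lemma complements_join_meet:
  assumes "complements L s c" "complements L t d"
    and "s \<in> carrier L" "c \<in> carrier L" "t \<in> carrier L" "d \<in> carrier L"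
  shows "complements L (s \<squnion> t) (c \<sqinter> d)"
  using complements_meet_join[of c s d t] assms by (simp add: complements_commute)

lemma complements_top_bottom: "complements L \<top> \<bottom>"
  by (simp add: complements_def meet_comm[of L \<top>] bottom_meet top_join)

lemma finite_sup_in_sublattice:
  assumes S: "bounded_sublattice L S" and "finite F" "F \<subseteq> S"
  shows "\<Squnion>F \<in> S"
  using assms(2,3)
proof induction
  case empty
  show ?case using S by (simp add: bounded_sublattice_def sup_empty)
next
  case (insert x F)
  then have "\<Squnion>(insert x F) = x \<squnion> \<Squnion>F"
    using S by (intro sup_insert) (auto simp: bounded_sublattice_def)
  then show ?case using insert S by (simp add: bounded_sublattice_def)
qed

lemma finite_inf_insert: "\<lbrakk>a \<in> carrier L; X \<subseteq> carrier L\<rbrakk> \<Longrightarrow> \<Sqinter>(insert a X) = a \<sqinter> \<Sqinter>X"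
  using weak_inf_insert[of a X] by (simp add: eq_is_equal)

text \<open>In a compact frame complemented elements are compact, since \<open>s \<sqsubseteq> \<Squnion>X\<close> makes \<open>X\<close>
  together with the complement of \<open>s\<close> a cover of \<open>\<top>\<close>.\<close>

lemma complemented_imp_compact:
  assumes L: "compact_frame L" and c: "complements L s c" "s \<in> carrier L" "c \<in> carrier L"
    and X: "X \<subseteq> carrier L" and le: "s \<sqsubseteq> \<Squnion>X"
  shows "\<exists>F. F \<subseteq> X \<and> finite F \<and> s \<sqsubseteq> \<Squnion>F"
proof -
  have "\<top> \<sqsubseteq> c \<squnion> \<Squnion>X"
    using c X le unfolding complements_def
    by (metis join_closed join_le_iff join_left join_right le_trans sup_closed)
  then have "\<Squnion>(insert c X) = \<top>"
    using c X by (metis join_closed le_antisym sup_closed sup_insert top_closed top_higher)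
  then obtain F where F: "F \<subseteq> insert c X" "finite F" "\<Squnion>F = \<top>"
    using L c X unfolding compact_frame_def by (metis insert_subset)
  have G: "F - {c} \<subseteq> X" "F - {c} \<subseteq> carrier L" "F \<subseteq> carrier L" using F X c by auto
  have "\<Squnion>F \<sqsubseteq> \<Squnion>(insert c (F - {c}))"
    using G c by (intro sup_mono) auto
  then have "s \<sqsubseteq> c \<squnion> \<Squnion>(F - {c})"
    using F G c by (metis sup_insert join_closed le_trans sup_closed top_closed top_higher)
  then have "s \<sqinter> s \<sqsubseteq> \<Squnion>(F - {c})"
    using complement_shunt[of c s s] c G by (simp add: complements_commute)
  then have "s \<sqsubseteq> \<Squnion>(F - {c})" using c by (metis le_refl meet_absorb)
  then show ?thesis using F G by blast
qed

end

section \<open>Subframes\<close>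

definition joins :: "('a, 'x) gorder_scheme \<Rightarrow> 'a set \<Rightarrow> 'a set" where
  "joins L G = {\<Squnion>\<^bsub>L\<^esub> X |X. X \<subseteq> G}"

lemma joinsI: "X \<subseteq> G \<Longrightarrow> \<Squnion>\<^bsub>L\<^esub> X \<in> joins L G"
  by (auto simp: joins_def)

lemma joins_iff: "x \<in> joins L G \<longleftrightarrow> (\<exists>X\<subseteq>G. x = \<Squnion>\<^bsub>L\<^esub> X)"
  by (auto simp: joins_def)

lemma joins_mono: "G \<subseteq> H \<Longrightarrow> joins L G \<subseteq> joins L H"
  by (auto simp: joins_def)

context frame
begin

lemma joins_closed: "G \<subseteq> carrier L \<Longrightarrow> joins L G \<subseteq> carrier L"
  by (auto simp: joins_def)

lemma joins_superset: "G \<subseteq> carrier L \<Longrightarrow> G \<subseteq> joins L G"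
  using joinsI[of "{_}" G L] by fastforce

text \<open>Taking all generators below \<open>x\<close> gives a representation that needs no choice, which is what
  closure under arbitrary joins requires.\<close>

lemma joins_canonical:
  assumes G: "G \<subseteq> carrier L" and x: "x \<in> joins L G"
  shows "x = \<Squnion>{g \<in> G. g \<sqsubseteq> x}"
proof (rule le_antisym)
  obtain X where X: "X \<subseteq> G" "x = \<Squnion>X" using x by (auto simp: joins_def)
  have xc: "x \<in> carrier L" using X G by auto
  have sub: "{g \<in> G. g \<sqsubseteq> x} \<subseteq> carrier L" using G by auto
  have "X \<subseteq> {g \<in> G. g \<sqsubseteq> x}" using X G by (auto intro: sup_upper)
  then show "x \<sqsubseteq> \<Squnion>{g \<in> G. g \<sqsubseteq> x}" unfolding X(2) using sub X(2) by (intro sup_mono) auto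
  show "\<Squnion>{g \<in> G. g \<sqsubseteq> x} \<sqsubseteq> x" using xc sub by (auto simp: sup_le_iff)
  show "x \<in> carrier L" "\<Squnion>{g \<in> G. g \<sqsubseteq> x} \<in> carrier L" using xc sub by auto
qed

lemma joins_subframe:
  assumes G: "G \<subseteq> carrier L" and top: "\<top> \<in> G" and meet: "\<And>x y. \<lbrakk>x \<in> G; y \<in> G\<rbrakk> \<Longrightarrow> x \<sqinter> y \<in> G"
  shows "subframe L (joins L G)"
  unfolding subframe_def
proof (intro conjI ballI allI impI)
  show "joins L G \<subseteq> carrier L" by (rule joins_closed[OF G])
  show "\<top> \<in> joins L G" using joins_superset[OF G] top by auto
  show "x \<sqinter> y \<in> joins L G" if xy: "x \<in> joins L G" "y \<in> joins L G" for x y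
  proof -
    obtain X Y where XY: "X \<subseteq> G" "x = \<Squnion>X" "Y \<subseteq> G" "y = \<Squnion>Y"
      using xy by (auto simp: joins_def)
    have "x \<sqinter> y = \<Squnion>{a \<sqinter> b |a b. a \<in> X \<and> b \<in> Y}"
      using XY G by (simp add: sup_meet_sup)
    then show ?thesis using XY meet by (auto intro!: joinsI)
  qed
  show "\<Squnion>Y \<in> joins L G" if Y: "Y \<subseteq> joins L G" for Y
  proof -
    have "\<Squnion>Y = \<Squnion>((\<lambda>y. \<Squnion>{g \<in> G. g \<sqsubseteq> y}) ` Y)"
      using Y joins_canonical[OF G] by (intro arg_cong[where f = "\<lambda>X. \<Squnion>X"]) force
    also have "\<dots> = \<Squnion>(\<Union>y\<in>Y. {g \<in> G. g \<sqsubseteq> y})" using G by (intro sup_UN[symmetric]) auto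
    finally show ?thesis by (auto intro!: joinsI)
  qed
qed

lemma subframe_carrier: "subframe L (carrier L)"
  by (auto simp: subframe_def)

lemma subframe_gen_subframe: "G \<subseteq> carrier L \<Longrightarrow> subframe L (subframe_gen L G)"
  using subframe_carrier unfolding subframe_gen_def
  by (auto simp: subframe_def Inter_eq subset_iff)

lemma subframe_finite_inf:
  assumes S: "subframe L S" and "finite F" "F \<subseteq> S"
  shows "\<Sqinter>F \<in> S"
  using assms(2,3)
proof induction
  case empty
  have "\<Sqinter>{} = \<top>" using weak_inf_empty by (simp add: eq_is_equal)
  then show ?case using S by (simp add: subframe_def)
next
  case (insert x F)
  then have "\<Sqinter>(insert x F) = x \<sqinter> \<Sqinter>F"
    using S by (intro finite_inf_insert) (auto simp: subframe_def)
  then show ?case using insert S by (simp add: subframe_def)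
qed

lemma sublattice_gen_bounded_sublattice:
  assumes "G \<subseteq> carrier L"
  shows "bounded_sublattice L (bounded_sublattice_gen L G)"
proof -
  have "bounded_sublattice L (carrier L)" by (auto simp: bounded_sublattice_def)
  then show ?thesis
    using assms unfolding bounded_sublattice_gen_def bounded_sublattice_def
    by (auto 0 3)
qed

end

lemma subframe_gen_superset: "G \<subseteq> subframe_gen L G"
  by (auto simp: subframe_gen_def)

lemma subframe_gen_minimal: "\<lbrakk>subframe L X; G \<subseteq> X\<rbrakk> \<Longrightarrow> subframe_gen L G \<subseteq> X"
  by (auto simp: subframe_gen_def)

lemma sublattice_gen_superset: "G \<subseteq> bounded_sublattice_gen L G"
  by (auto simp: bounded_sublattice_gen_def)

lemma sublattice_gen_minimal: "\<lbrakk>bounded_sublattice L S; G \<subseteq> S\<rbrakk> \<Longrightarrow> bounded_sublattice_gen L G \<subseteq> S"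
  by (auto simp: bounded_sublattice_gen_def)

lemma joins_subset_subframe: "\<lbrakk>subframe L X; G \<subseteq> X\<rbrakk> \<Longrightarrow> joins L G \<subseteq> X"
  by (auto simp: subframe_def joins_def)

lemma (in frame) subframe_gen_eq_joins:
  assumes "G \<subseteq> carrier L" "\<top> \<in> G" "\<And>x y. \<lbrakk>x \<in> G; y \<in> G\<rbrakk> \<Longrightarrow> x \<sqinter> y \<in> G"
  shows "subframe_gen L G = joins L G"
proof
  show "subframe_gen L G \<subseteq> joins L G"
    using assms by (intro subframe_gen_minimal joins_subframe joins_superset)
  show "joins L G \<subseteq> subframe_gen L G"
    using assms by (intro joins_subset_subframe subframe_gen_subframe subframe_gen_superset)
qed

text \<open>A subframe is a frame with the operations of the ambient frame.  The records involved here
  (congruence frames, Frith frames, biframes) carry different extra fields, so the subframe is any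
  record with the right carrier and order.\<close>

locale frame_restriction = frame L for L (structure) +
  fixes M :: "('a, 'z) gorder_scheme"
  assumes sub: "subframe L (carrier M)" and le_M: "le M = le L" and eq_M: "eq M = eq L"
begin

lemma carrier_subset: "carrier M \<subseteq> carrier L"
  using sub by (simp add: subframe_def)

lemma partial_order_M: "partial_order M"
proof
  show "le M x z" if "le M x y" "le M y z" "x \<in> carrier M" "y \<in> carrier M" "z \<in> carrier M" for x y z
    using le_trans[of x y z] that carrier_subset by (simp add: le_M subset_iff)
  show "eq M x y" if "le M x y" "le M y x" "x \<in> carrier M" "y \<in> carrier M" for x y
    using le_antisym[of x y] that carrier_subset by (simp add: le_M eq_M eq_is_equal subset_iff)
qed (use carrier_subset in \<open>auto simp: le_M eq_M eq_is_equal le_refl subset_iff\<close>)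

lemma subset_carrier: "X \<subseteq> carrier M \<Longrightarrow> X \<subseteq> carrier L"
  using carrier_subset by blast

lemma is_lub_M:
  assumes X: "X \<subseteq> carrier M"
  shows "is_lub M (\<Squnion>X) X"
proof (rule least_UpperI)
  show "le M (\<Squnion>X) y" if "y \<in> Upper M X" for y
  proof -
    have "y \<in> carrier L" "\<forall>x\<in>X. x \<sqsubseteq> y" using that X carrier_subset by (auto simp: Upper_def le_M)
    then show ?thesis using subset_carrier[OF X] by (simp add: le_M sup_le_iff)
  qed
qed (use X sub subset_carrier[OF X] in \<open>auto simp: le_M subframe_def sup_upper\<close>)

lemma complete_lattice_M: "complete_lattice M"
proof (rule partial_order.complete_latticeI[OF partial_order_M])
  fix X assume X: "X \<subseteq> carrier M"
  show "\<exists>s. is_lub M s X" using is_lub_M[OF X] by blast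
  let ?B = "Lower M X"
  have B: "?B \<subseteq> carrier M" by simp
  have "is_glb M (\<Squnion>?B) X"
  proof (rule greatest_LowerI)
    show "le M (\<Squnion>?B) x" if "x \<in> X" for x
    proof -
      have "x \<in> carrier L" "\<forall>y\<in>?B. y \<sqsubseteq> x"
        using X that carrier_subset by (auto simp: Lower_def le_M)
      then show ?thesis using subset_carrier[OF B] by (simp add: le_M sup_le_iff)
    qed
    show "le M y (\<Squnion>?B)" if "y \<in> ?B" for y
      using sup_upper[OF subset_carrier[OF B] that] by (simp add: le_M)
    show "\<Squnion>?B \<in> carrier M" using B sub by (simp add: subframe_def)
  qed (use X in auto)
  then show "\<exists>s. is_glb M s X" by blast
qed

interpretation M: complete_lattice M by (rule complete_lattice_M)

lemma sup_M: "X \<subseteq> carrier M \<Longrightarrow> \<Squnion>\<^bsub>M\<^esub> X = \<Squnion>X"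
  using is_lub_M M.sup_lub M.least_unique by blast

lemma join_M: "\<lbrakk>x \<in> carrier M; y \<in> carrier M\<rbrakk> \<Longrightarrow> x \<squnion>\<^bsub>M\<^esub> y = x \<squnion> y"
  by (simp add: join_def sup_M)

lemma meet_M:
  assumes "x \<in> carrier M" "y \<in> carrier M"
  shows "x \<sqinter>\<^bsub>M\<^esub> y = x \<sqinter> y"
proof -
  have m: "x \<sqinter> y \<in> carrier M" using sub assms by (simp add: subframe_def)
  have c: "x \<in> carrier L" "y \<in> carrier L" using assms carrier_subset by auto
  have "greatest M (x \<sqinter> y) (Lower M {x, y})"
    using assms m c carrier_subset
    by (intro greatest_LowerI) (auto simp: le_M Lower_def le_meet_iff meet_left meet_right subset_iff)
  moreover have "greatest M (x \<sqinter>\<^bsub>M\<^esub> y) (Lower M {x, y})"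
    unfolding meet_def using assms by (intro M.inf_glb) auto
  ultimately show ?thesis using M.greatest_unique by blast
qed

lemma top_M: "\<top>\<^bsub>M\<^esub> = \<top>"
proof -
  have "greatest M \<top> (carrier M)"
    using sub carrier_subset by (auto simp: greatest_def subframe_def le_M)
  then show ?thesis using M.top_greatest M.greatest_unique by blast
qed

lemma bottom_M: "\<bottom>\<^bsub>M\<^esub> = \<bottom>"
  using sup_M[of "{}"] sup_empty M.weak_sup_empty by (simp add: M.eq_is_equal)

lemma frame_M: "frame M"
proof (intro frame.intro complete_lattice_M frame_axioms.intro)
  fix a X assume a: "a \<in> carrier M" "X \<subseteq> carrier M"
  have img: "(\<lambda>x. a \<sqinter>\<^bsub>M\<^esub> x) ` X = (\<lambda>x. a \<sqinter> x) ` X"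
    using a by (intro image_cong refl meet_M) auto
  have "(\<lambda>x. a \<sqinter> x) ` X \<subseteq> carrier M" using a sub by (auto simp: subframe_def subset_iff)
  moreover have "\<Squnion>X \<in> carrier M" using a sub by (simp add: subframe_def)
  ultimately show "a \<sqinter>\<^bsub>M\<^esub> \<Squnion>\<^bsub>M\<^esub> X = \<Squnion>\<^bsub>M\<^esub> ((\<lambda>x. a \<sqinter>\<^bsub>M\<^esub> x) ` X)"
    using a carrier_subset subset_carrier[of X] unfolding img
    by (simp add: sup_M meet_M meet_sup_distrib subsetD)
qed

lemma complements_M: "\<lbrakk>x \<in> carrier M; y \<in> carrier M\<rbrakk> \<Longrightarrow> complements M x y \<longleftrightarrow> complements L x y"
  by (simp add: complements_def meet_M join_M top_M bottom_M)

lemma subframe_M: "X \<subseteq> carrier M \<Longrightarrow> subframe M X \<longleftrightarrow> subframe L X"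
  using carrier_subset by (auto simp: subframe_def meet_M sup_M top_M subset_iff)

lemma joins_M: "G \<subseteq> carrier M \<Longrightarrow> joins M G = joins L G"
  unfolding joins_def using sup_M by (metis (no_types, lifting) subset_trans)

lemma bounded_sublattice_M:
  "X \<subseteq> carrier M \<Longrightarrow> bounded_sublattice M X \<longleftrightarrow> bounded_sublattice L X"
  using carrier_subset by (auto simp: bounded_sublattice_def meet_M join_M top_M bottom_M subset_iff)

lemma frame_hom_into_M:
  assumes N: "complete_lattice N"
  shows "h \<in> frame_hom N M \<longleftrightarrow> h \<in> frame_hom N L \<and> h ` carrier N \<subseteq> carrier M" (is "?l \<longleftrightarrow> ?r")
proof -
  interpret N: complete_lattice N by (rule N)
  have "(h \<in> carrier N \<rightarrow>\<^sub>E carrier M) \<longleftrightarrow> (h \<in> carrier N \<rightarrow>\<^sub>E carrier L) \<and> h ` carrier N \<subseteq> carrier M"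
    using carrier_subset by (auto simp: PiE_def Pi_def)
  moreover have "h x \<sqinter>\<^bsub>M\<^esub> h y = h x \<sqinter> h y"
    if "h ` carrier N \<subseteq> carrier M" "x \<in> carrier N" "y \<in> carrier N" for x y
    using that by (auto intro!: meet_M)
  moreover have "\<Squnion>\<^bsub>M\<^esub> (h ` X) = \<Squnion>(h ` X)"
    if "h ` carrier N \<subseteq> carrier M" "X \<subseteq> carrier N" for X
    using that by (intro sup_M) blast
  ultimately show ?thesis unfolding frame_hom_def by (auto simp: top_M)
qed

lemma frame_hom_restrict_M:
  assumes h: "h \<in> frame_hom L N"
  shows "restrict h (carrier M) \<in> frame_hom M N"
proof -
  have img: "restrict h (carrier M) ` X = h ` X" if "X \<subseteq> carrier M" for X
    using that by (intro image_cong) auto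
  have meet: "x \<sqinter> y \<in> carrier M" if "x \<in> carrier M" "y \<in> carrier M" for x y
    using that sub by (simp add: subframe_def)
  have sup: "\<Squnion>X \<in> carrier M" if "X \<subseteq> carrier M" for X
    using that sub by (simp add: subframe_def)
  have hx: "h x \<in> carrier N" if "x \<in> carrier M" for x
    using that h carrier_subset by (auto simp: frame_hom_def)
  show ?thesis
    unfolding frame_hom_def
  proof (intro CollectI conjI ballI allI impI)
    show "restrict h (carrier M) \<in> carrier M \<rightarrow>\<^sub>E carrier N" using hx by auto
    have "\<top> \<in> carrier M" using sub by (simp add: subframe_def)
    then show "restrict h (carrier M) \<top>\<^bsub>M\<^esub> = \<top>\<^bsub>N\<^esub>" using h by (simp add: top_M frame_hom_def)
    show "restrict h (carrier M) (x \<sqinter>\<^bsub>M\<^esub> y) = restrict h (carrier M) x \<sqinter>\<^bsub>N\<^esub> restrict h (carrier M) y"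
      if "x \<in> carrier M" "y \<in> carrier M" for x y
      using that h meet carrier_subset by (simp add: meet_M frame_hom_def subset_iff)
    show "restrict h (carrier M) (\<Squnion>\<^bsub>M\<^esub> X) = \<Squnion>\<^bsub>N\<^esub> (restrict h (carrier M) ` X)"
      if "X \<subseteq> carrier M" for X
      using that h sup subset_carrier[OF that] img[OF that] by (simp add: sup_M frame_hom_def)
  qed
qed

end

text \<open>The symmetrization and the biframe of a Frith frame are both the frame \<open>\<C>\<^sub>SL\<close> in a record with
  further fields; the lattice operations see the carrier and the order only.\<close>

lemma order_operations_cong:
  assumes "carrier M = carrier L" "le M = le L"
  shows "Lattice.sup M = Lattice.sup L" "Lattice.inf M = Lattice.inf L" "join M = join L" "meet M = meet L"
    "top M = top L" "bottom M = bottom L"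
proof -
  have "Upper M = Upper L" "Lower M = Lower L" "least M = least L" "greatest M = greatest L"
    using assms by (auto simp: Upper_def Lower_def least_def greatest_def fun_eq_iff)
  then show "Lattice.sup M = Lattice.sup L" "Lattice.inf M = Lattice.inf L" "join M = join L" "meet M = meet L"
    "top M = top L" "bottom M = bottom L"
    using assms by (auto simp: sup_def inf_def join_def meet_def top_def bottom_def fun_eq_iff)
qed

lemma frame_order_cong:
  assumes "carrier M = carrier L" "le M = le L" "eq M = eq L" "frame L"
  shows "frame M"
proof -
  interpret frame L by fact
  interpret frame_restriction L M by unfold_locales (use assms subframe_carrier in auto)
  show ?thesis by (rule frame_M)
qed

section \<open>Frame homomorphisms\<close>

lemma (in frame) identity_hom: "(\<lambda>x\<in>carrier L. x) \<in> frame_hom L L"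
proof -
  have "(\<lambda>x\<in>carrier L. x) ` X = X" if "X \<subseteq> carrier L" for X using that by auto
  then show ?thesis by (auto simp: frame_hom_def)
qed

lemma (in frame_restriction) inclusion_hom: "(\<lambda>x\<in>carrier M. x) \<in> frame_hom M L"
  using frame_hom_into_M[OF complete_lattice_M, of "\<lambda>x\<in>carrier M. x"] frame.identity_hom[OF frame_M]
  by simp

locale frame_morphism = L: frame L + M: frame M
  for L :: "('a, 'x) gorder_scheme" and M :: "('b, 'y) gorder_scheme" +
  fixes h assumes hom: "h \<in> frame_hom L M"
begin

lemma closed [simp]: "x \<in> carrier L \<Longrightarrow> h x \<in> carrier M"
  using hom by (auto simp: frame_hom_def)

lemma image_closed: "X \<subseteq> carrier L \<Longrightarrow> h ` X \<subseteq> carrier M"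
  by auto

lemma extensional: "h \<in> extensional (carrier L)"
  using hom by (auto simp: frame_hom_def PiE_def)

lemma map_top: "h \<top>\<^bsub>L\<^esub> = \<top>\<^bsub>M\<^esub>"
  using hom by (simp add: frame_hom_def)

lemma map_meet: "\<lbrakk>x \<in> carrier L; y \<in> carrier L\<rbrakk> \<Longrightarrow> h (x \<sqinter>\<^bsub>L\<^esub> y) = h x \<sqinter>\<^bsub>M\<^esub> h y"
  using hom by (simp add: frame_hom_def)

lemma map_sup: "X \<subseteq> carrier L \<Longrightarrow> h (\<Squnion>\<^bsub>L\<^esub> X) = \<Squnion>\<^bsub>M\<^esub> (h ` X)"
  using hom by (simp add: frame_hom_def)

lemma map_join: "\<lbrakk>x \<in> carrier L; y \<in> carrier L\<rbrakk> \<Longrightarrow> h (x \<squnion>\<^bsub>L\<^esub> y) = h x \<squnion>\<^bsub>M\<^esub> h y"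
  using map_sup[of "{x, y}"] by (simp add: join_def)

lemma map_bottom: "h \<bottom>\<^bsub>L\<^esub> = \<bottom>\<^bsub>M\<^esub>"
  using map_sup[of "{}"] by (simp add: L.sup_empty M.sup_empty)

lemma map_mono: "\<lbrakk>le L x y; x \<in> carrier L; y \<in> carrier L\<rbrakk> \<Longrightarrow> le M (h x) (h y)"
  by (metis L.meet_absorb M.meet_absorb closed map_meet)

lemma map_complements:
  "\<lbrakk>complements L x y; x \<in> carrier L; y \<in> carrier L\<rbrakk> \<Longrightarrow> complements M (h x) (h y)"
  by (metis complements_def map_bottom map_join map_meet map_top)

lemma equalizer_subframe:
  assumes "frame_morphism L M k"
  shows "subframe L {x \<in> carrier L. h x = k x}"
proof -
  interpret k: frame_morphism L M k by (rule assms)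
  have "h ` X = k ` X" if "X \<subseteq> {x \<in> carrier L. h x = k x}" for X
    using that by (intro image_cong) auto
  then show ?thesis
    by (auto simp: subframe_def map_top k.map_top map_meet k.map_meet map_sup k.map_sup subset_iff)
qed

lemma preimage_subframe:
  assumes "subframe M N"
  shows "subframe L {x \<in> carrier L. h x \<in> N}"
proof -
  have "h ` X \<subseteq> N" if "X \<subseteq> {x \<in> carrier L. h x \<in> N}" for X using that by auto
  then show ?thesis
    using assms unfolding subframe_def
    by (auto simp: map_top map_meet map_sup subset_iff)
qed

lemma image_subframe: "subframe M (h ` carrier L)"
  unfolding subframe_def
proof (intro conjI ballI allI impI)
  show "\<top>\<^bsub>M\<^esub> \<in> h ` carrier L" by (metis map_top imageI L.top_closed)
  show "x \<sqinter>\<^bsub>M\<^esub> y \<in> h ` carrier L" if "x \<in> h ` carrier L" "y \<in> h ` carrier L" for x y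
    using that by (auto simp: map_meet[symmetric])
  show "\<Squnion>\<^bsub>M\<^esub> Y \<in> h ` carrier L" if "Y \<subseteq> h ` carrier L" for Y
    using that by (auto simp: subset_image_iff map_sup[symmetric])
qed auto

text \<open>An injective homomorphism reflects the order, since \<open>x \<sqsubseteq> y\<close> is the equation
  \<open>x \<sqinter> y = x\<close>.\<close>

lemma bijective_imp_order_isomorphism:
  assumes "bij_betw h (carrier L) (carrier M)"
  shows "order_isomorphism L M h"
proof (rule order_isomorphism.intro)
  show "le M (h x) (h y) \<longleftrightarrow> le L x y" if "x \<in> carrier L" "y \<in> carrier L" for x y
    using that assms
    by (metis L.meet_absorb L.meet_closed M.meet_absorb bij_betw_imp_inj_on closed inj_onD map_meet)
qed (use assms M.eq_is_equal L.complete_lattice_axioms in auto)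

lemma inverse:
  assumes bij: "bij_betw h (carrier L) (carrier M)"
  obtains k where "k \<in> frame_hom M L" "\<And>x. x \<in> carrier L \<Longrightarrow> k (h x) = x"
    "compose (carrier L) k h = (\<lambda>x\<in>carrier L. x)" "compose (carrier M) h k = (\<lambda>y\<in>carrier M. y)"
proof
  let ?k = "restrict (inv_into (carrier L) h) (carrier M)"
  interpret I: order_isomorphism M L "inv_into (carrier L) h"
    by (rule order_isomorphism_inverse[OF bijective_imp_order_isomorphism[OF bij]])
  show "?k \<in> frame_hom M L" by (rule I.frame_hom_restrict)
  show 1: "?k (h x) = x" if "x \<in> carrier L" for x
    using that bij by (simp add: bij_betw_def)
  show "compose (carrier L) ?k h = (\<lambda>x\<in>carrier L. x)"
    using 1 by (auto simp: compose_def)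
  have "h (inv_into (carrier L) h y) = y" if "y \<in> carrier M" for y
    using that bij by (auto simp: bij_betw_def f_inv_into_f)
  then show "compose (carrier M) h ?k = (\<lambda>y\<in>carrier M. y)"
    by (auto simp: compose_def)
qed

end

lemma (in frame_morphism) injective_reflects_compact:
  assumes inj: "inj_on h (carrier L)" and M: "compact_frame M"
  shows "compact_frame L"
  unfolding compact_frame_def
proof (intro conjI L.frame_axioms allI impI)
  fix X assume X: "X \<subseteq> carrier L \<and> \<Squnion>\<^bsub>L\<^esub> X = \<top>\<^bsub>L\<^esub>"
  then have "\<Squnion>\<^bsub>M\<^esub> (h ` X) = \<top>\<^bsub>M\<^esub>" "h ` X \<subseteq> carrier M"
    using map_sup[of X] image_closed[of X] by (simp_all add: map_top)
  then obtain F where F: "F \<subseteq> h ` X" "finite F" "\<Squnion>\<^bsub>M\<^esub> F = \<top>\<^bsub>M\<^esub>"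
    using M unfolding compact_frame_def by blast
  then obtain G where G: "G \<subseteq> X" "finite G" "F = h ` G" by (meson finite_subset_image)
  have GL: "G \<subseteq> carrier L" using G X by auto
  have "h (\<Squnion>\<^bsub>L\<^esub> G) = h \<top>\<^bsub>L\<^esub>" using F G GL by (simp add: map_sup map_top)
  then have "\<Squnion>\<^bsub>L\<^esub> G = \<top>\<^bsub>L\<^esub>" using inj GL by (simp add: inj_on_def)
  then show "\<exists>F. F \<subseteq> X \<and> finite F \<and> \<Squnion>\<^bsub>L\<^esub> F = \<top>\<^bsub>L\<^esub>" using G by blast
qed

text \<open>If \<open>h x \<sqsubseteq> h y\<close> and \<open>c \<sqsubseteq> x\<close> is a base element, then \<open>h c\<close> is compact, hence below
  \<open>h d\<close> for a finite join \<open>d\<close> of base elements below \<open>y\<close>; density applied to \<open>c\<close> meet the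
  complement of \<open>d\<close> gives \<open>c \<sqsubseteq> d\<close>.\<close>

lemma dense_into_compact_injective:
  fixes A :: "'a frith"
  assumes A: "symmetric_frith A" and M: "compact_frame M"
    and h: "h \<in> frame_hom A M" and dense: "dense_map A M h"
  shows "inj_on h (carrier A)"
proof -
  have FA: "frith_frame A" using A by (simp add: symmetric_frith_def)
  interpret frame_morphism A M h
    using FA M h by (simp add: frame_morphism_def frame_morphism_axioms_def frith_frame_def compact_frame_def)
  have B: "base A \<subseteq> carrier A" "bounded_sublattice A (base A)"
    using FA by (auto simp: frith_frame_def bounded_sublattice_def)
  have reflects: "le A x y" if x: "x \<in> carrier A" and y: "y \<in> carrier A" and le: "le M (h x) (h y)" for x y
  proof -
    obtain X where X: "X \<subseteq> base A" "x = \<Squnion>\<^bsub>A\<^esub> X" using FA x by (auto simp: frith_frame_def)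
    obtain Y where Y: "Y \<subseteq> base A" "y = \<Squnion>\<^bsub>A\<^esub> Y" using FA y by (auto simp: frith_frame_def)
    have YA: "Y \<subseteq> carrier A" using Y B by auto
    have "le A c y" if c: "c \<in> X" for c
    proof -
      have cA: "c \<in> carrier A" "le A c x" using c X B by (auto intro: L.sup_upper)
      obtain c' where c': "c' \<in> base A" "complements A c c'"
        using A c X by (auto simp: symmetric_frith_def)
      have c'A: "c' \<in> carrier A" using c' B by auto
      have "le M (h c) (h y)"
        using M.le_trans[OF map_mono[OF cA(2,1) x] le] cA x y by simp
      then have "le M (h c) (\<Squnion>\<^bsub>M\<^esub> (h ` Y))" by (simp add: Y(2) map_sup[OF YA])
      then obtain F where F: "F \<subseteq> h ` Y" "finite F" "le M (h c) (\<Squnion>\<^bsub>M\<^esub> F)"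
        using M.complemented_imp_compact[OF M map_complements[OF c'(2) cA(1) c'A] closed closed image_closed]
          cA c'A YA by blast
      then obtain G where G: "G \<subseteq> Y" "finite G" "F = h ` G" by (meson finite_subset_image)
      define d where "d = \<Squnion>\<^bsub>A\<^esub> G"
      have d: "d \<in> base A" unfolding d_def
        using G Y B by (intro L.finite_sup_in_sublattice) auto
      then obtain e where e: "e \<in> base A" "complements A d e"
        using A by (auto simp: symmetric_frith_def)
      have de: "d \<in> carrier A" "e \<in> carrier A" using d e B by auto
      have GA: "G \<subseteq> carrier A" using G YA by auto
      have hd: "h d = \<Squnion>\<^bsub>M\<^esub> F" unfolding d_def using G GA by (simp add: map_sup)
      have he: "complements M (h d) (h e)" using map_complements e(2) de by blast
      have "le M (h c) (h d \<squnion>\<^bsub>M\<^esub> \<bottom>\<^bsub>M\<^esub>)"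
        using F(3) hd de cA by (metis M.bottom_join closed join_comm)
      then have "le M (h c \<sqinter>\<^bsub>M\<^esub> h e) \<bottom>\<^bsub>M\<^esub>"
        using M.complement_shunt[OF he] de cA by simp
      then have "c \<sqinter>\<^bsub>A\<^esub> e = \<bottom>\<^bsub>A\<^esub>"
        using dense cA de by (simp add: dense_map_def map_meet M.le_bottom_iff)
      then have "le A (c \<sqinter>\<^bsub>A\<^esub> e) \<bottom>\<^bsub>A\<^esub>" by (simp add: L.le_refl)
      then have "le A c d"
        using L.complement_shunt[OF e(2)] de cA by (simp add: join_comm[of A d] L.bottom_join)
      moreover have "le A d y" unfolding d_def Y(2) using G YA by (intro L.sup_mono)
      ultimately show ?thesis using cA de y L.le_trans by blast
    qed
    then show ?thesis using X B y by (auto simp: L.sup_le_iff)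
  qed
  show ?thesis
    by (rule inj_onI) (metis L.le_antisym M.le_refl closed reflects)
qed

section \<open>Frames of closed sets\<close>

text \<open>The last assumption provides, for closed \<open>A\<close> and \<open>Z\<close>, enough of the Heyting implication to
  test membership of a single point of \<open>A\<close>.  It makes intersection with \<open>A\<close> distribute over joins
  without any description of the join of closed sets.\<close>

locale closure_system =
  fixes U :: "'a set" and \<C> :: "'a set set"
  assumes U: "U \<in> \<C>" and sub_U: "X \<in> \<C> \<Longrightarrow> X \<subseteq> U"
    and Inter_closed: "\<lbrakk>\<X> \<subseteq> \<C>; \<X> \<noteq> {}\<rbrakk> \<Longrightarrow> \<Inter>\<X> \<in> \<C>"
    and residual: "\<lbrakk>A \<in> \<C>; Z \<in> \<C>; x \<in> A\<rbrakk> \<Longrightarrow>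
      \<exists>W\<in>\<C>. (\<forall>X\<in>\<C>. A \<inter> X \<subseteq> Z \<longrightarrow> X \<subseteq> W) \<and> (x \<in> W \<longrightarrow> x \<in> Z)"
begin

abbreviation closed_sets :: "'a set gorder" where
  "closed_sets \<equiv> \<lparr>carrier = \<C>, eq = (=), le = (\<subseteq>)\<rparr>"

lemma Int_closed: "\<lbrakk>A \<in> \<C>; B \<in> \<C>\<rbrakk> \<Longrightarrow> A \<inter> B \<in> \<C>"
  using Inter_closed[of "{A, B}"] by simp

sublocale P: partial_order closed_sets
  by unfold_locales auto

lemma is_glb_Inter: "\<lbrakk>\<X> \<subseteq> \<C>; \<X> \<noteq> {}\<rbrakk> \<Longrightarrow> is_glb closed_sets (\<Inter>\<X>) \<X>"
  using Inter_closed by (intro greatest_LowerI) (auto simp: Lower_def)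

lemma is_top: "greatest closed_sets U (carrier closed_sets)"
  using U sub_U by (auto simp: greatest_def)

sublocale P: complete_lattice closed_sets
  using is_top is_glb_Inter by (intro P.complete_lattice_criterion1) auto

lemma top_eq: "\<top>\<^bsub>closed_sets\<^esub> = U"
  using is_top P.top_greatest P.greatest_unique by blast

lemma meet_eq:
  assumes "A \<in> \<C>" "B \<in> \<C>"
  shows "A \<sqinter>\<^bsub>closed_sets\<^esub> B = A \<inter> B"
proof (rule P.greatest_unique)
  show "is_glb closed_sets (A \<sqinter>\<^bsub>closed_sets\<^esub> B) {A, B}"
    unfolding meet_def using assms by (intro P.inf_glb) auto
  show "is_glb closed_sets (A \<inter> B) {A, B}"
    using is_glb_Inter[of "{A, B}"] assms by simp
qed

lemma sup_subset_iff:
  assumes "\<X> \<subseteq> \<C>" "Z \<in> \<C>"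
  shows "\<Squnion>\<^bsub>closed_sets\<^esub> \<X> \<subseteq> Z \<longleftrightarrow> (\<forall>X\<in>\<X>. X \<subseteq> Z)"
proof
  show "\<forall>X\<in>\<X>. X \<subseteq> Z" if "\<Squnion>\<^bsub>closed_sets\<^esub> \<X> \<subseteq> Z"
    using P.sup_upper[of \<X>] assms(1) that by (simp; blast)
  show "\<Squnion>\<^bsub>closed_sets\<^esub> \<X> \<subseteq> Z" if "\<forall>X\<in>\<X>. X \<subseteq> Z"
    using P.sup_least[of \<X> Z] assms that by simp
qed

lemma frame_closed_sets: "frame closed_sets"
proof (intro frame.intro P.complete_lattice_axioms frame_axioms.intro)
  fix A \<X> assume "A \<in> carrier closed_sets" "\<X> \<subseteq> carrier closed_sets"
  then have A: "A \<in> \<C>" and \<X>: "\<X> \<subseteq> \<C>" by auto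
  define Z where "Z = \<Squnion>\<^bsub>closed_sets\<^esub> ((\<lambda>X. A \<sqinter>\<^bsub>closed_sets\<^esub> X) ` \<X>)"
  have img: "(\<lambda>X. A \<sqinter>\<^bsub>closed_sets\<^esub> X) ` \<X> = (\<lambda>X. A \<inter> X) ` \<X>"
    using A \<X> by (intro image_cong refl meet_eq) (simp_all add: subsetD)
  have imgC: "(\<lambda>X. A \<inter> X) ` \<X> \<subseteq> \<C>" using A \<X> Int_closed by auto
  have Z: "Z \<in> \<C>" using P.sup_closed[of "(\<lambda>X. A \<inter> X) ` \<X>"] imgC by (simp add: Z_def img)
  have sX: "\<Squnion>\<^bsub>closed_sets\<^esub> \<X> \<in> \<C>" using P.sup_closed[of \<X>] \<X> by simp
  have below: "A \<inter> X \<subseteq> Z" if "X \<in> \<X>" for X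
    using P.sup_upper[of "(\<lambda>X. A \<inter> X) ` \<X>" "A \<inter> X"] imgC that by (simp add: Z_def img)
  have "A \<inter> \<Squnion>\<^bsub>closed_sets\<^esub> \<X> = Z"
  proof
    show "A \<inter> \<Squnion>\<^bsub>closed_sets\<^esub> \<X> \<subseteq> Z"
    proof
      fix x assume x: "x \<in> A \<inter> \<Squnion>\<^bsub>closed_sets\<^esub> \<X>"
      then have "x \<in> A" by simp
      from residual[OF A Z this] obtain W
        where W: "W \<in> \<C>" and WX: "(\<forall>X\<in>\<C>. A \<inter> X \<subseteq> Z \<longrightarrow> X \<subseteq> W) \<and> (x \<in> W \<longrightarrow> x \<in> Z)" ..
      have "X \<subseteq> W" if "X \<in> \<X>" for X
        using conjunct1[OF WX, rule_format, OF subsetD[OF \<X> that] below[OF that]] .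
      then have "\<Squnion>\<^bsub>closed_sets\<^esub> \<X> \<subseteq> W" using sup_subset_iff[OF \<X> W] by simp
      then show "x \<in> Z" using WX x by auto
    qed
    have "X \<subseteq> \<Squnion>\<^bsub>closed_sets\<^esub> \<X>" if "X \<in> \<X>" for X
      using P.sup_upper[of \<X> X] \<X> that by simp
    then show "Z \<subseteq> A \<inter> \<Squnion>\<^bsub>closed_sets\<^esub> \<X>"
      unfolding Z_def img using imgC A sX by (subst sup_subset_iff) (auto simp: Int_closed)
  qed
  then show "A \<sqinter>\<^bsub>closed_sets\<^esub> \<Squnion>\<^bsub>closed_sets\<^esub> \<X> = \<Squnion>\<^bsub>closed_sets\<^esub> ((\<lambda>X. A \<sqinter>\<^bsub>closed_sets\<^esub> X) ` \<X>)"
    using A sX by (simp add: meet_eq Z_def)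
qed

end

section \<open>Complete symmetric Frith frames are the compact ones\<close>

text \<open>Density makes the test morphism injective; it is onto because its image is a subframe that
  contains the base.\<close>

lemma compact_symmetric_imp_complete:
  assumes sym: "symmetric_frith A" and compact: "compact_frame A"
  shows "complete_symmetric A"
  unfolding complete_symmetric_def
proof (intro conjI sym allI impI)
  fix M :: "'a set frith" and h
  assume asm: "symmetric_frith M \<and> dense_map M A h \<and> extremal_epi M A h"
  then have M: "frith_frame M" and h: "h \<in> frith_hom M A" "h \<in> frame_hom M A" "h ` base M = base A"
    by (auto simp: symmetric_frith_def extremal_epi_def frith_hom_def)
  have A: "frith_frame A" using sym by (simp add: symmetric_frith_def)
  interpret frame_morphism M A h
    using h M A by (simp add: frame_morphism_def frame_morphism_axioms_def frith_frame_def)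
  have B: "base M \<subseteq> carrier M" by (rule frith_frameD[OF M])
  have "joins A (base A) \<subseteq> h ` carrier M"
    using h(3) B image_subframe by (intro joins_subset_subframe) auto
  moreover have "carrier A \<subseteq> joins A (base A)"
    using A unfolding frith_frame_def joins_def by blast
  ultimately have "h ` carrier M = carrier A" by auto
  then have bij: "bij_betw h (carrier M) (carrier A)"
    using dense_into_compact_injective[OF _ compact h(2)] asm by (simp add: bij_betw_def)
  obtain k where k: "k \<in> frame_hom A M" "\<And>x. x \<in> carrier M \<Longrightarrow> k (h x) = x"
    "compose (carrier M) k h = (\<lambda>x\<in>carrier M. x)" "compose (carrier A) h k = (\<lambda>y\<in>carrier A. y)"
    by (rule inverse[OF bij]) (rule that)
  have "k ` base A = base M"
    unfolding h(3)[symmetric] image_image using k(2) B by (simp add: subset_iff)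
  then have kF: "k \<in> frith_hom A M" using k(1) by (simp add: frith_hom_def)
  show "frith_iso M A h" unfolding frith_iso_def by (intro conjI bexI[of _ k] h(1) kF k(3,4))
qed

text \<open>The ideals of the base form a compact frame, and the principal ideals are a copy of the base in
  it.  This is the completion of a symmetric Frith frame.\<close>

definition base_ideals :: "'a frith \<Rightarrow> 'a set set" where
  "base_ideals A = {I. I \<subseteq> base A \<and> \<bottom>\<^bsub>A\<^esub> \<in> I \<and> (\<forall>x\<in>I. \<forall>y\<in>I. x \<squnion>\<^bsub>A\<^esub> y \<in> I) \<and>
     (\<forall>x\<in>I. \<forall>y\<in>base A. le A y x \<longrightarrow> y \<in> I)}"

definition principal_ideal :: "'a frith \<Rightarrow> 'a \<Rightarrow> 'a set" where
  "principal_ideal A b = {c \<in> base A. le A c b}"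

definition ideal_frith :: "'a frith \<Rightarrow> 'a set frith" where
  "ideal_frith A = \<lparr>carrier = base_ideals A, eq = (=), le = (\<subseteq>), base = principal_ideal A ` base A\<rparr>"

locale frith = frame A for A :: "'a frith" (structure) +
  assumes frith_frame: "frith_frame A"
begin

lemma base_sub: "base A \<subseteq> carrier A"
  using frith_frame by (rule frith_frameD)

lemma base_carrier: "s \<in> base A \<Longrightarrow> s \<in> carrier A"
  using base_sub by auto

lemma base_closed:
  "\<bottom> \<in> base A" "\<top> \<in> base A"
  "\<lbrakk>s \<in> base A; t \<in> base A\<rbrakk> \<Longrightarrow> s \<sqinter> t \<in> base A" "\<lbrakk>s \<in> base A; t \<in> base A\<rbrakk> \<Longrightarrow> s \<squnion> t \<in> base A"
  using frith_frame by (auto simp: frith_frame_def bounded_sublattice_def)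

lemma carrier_joins: "carrier A = joins A (base A)"
  using frith_frame joins_closed[OF base_sub] by (auto simp: frith_frame_def joins_def)

lemma sup_base: "a \<in> carrier A \<Longrightarrow> a = \<Squnion>{s \<in> base A. s \<sqsubseteq> a}"
  using joins_canonical[OF base_sub] carrier_joins by auto

lemma base_idealsI:
  assumes "I \<subseteq> base A" "\<bottom> \<in> I" "\<And>x y. \<lbrakk>x \<in> I; y \<in> I\<rbrakk> \<Longrightarrow> x \<squnion> y \<in> I"
    "\<And>x y. \<lbrakk>x \<in> I; y \<in> base A; y \<sqsubseteq> x\<rbrakk> \<Longrightarrow> y \<in> I"
  shows "I \<in> base_ideals A"
  using assms by (auto simp: base_ideals_def)

lemma base_idealsD:
  assumes "I \<in> base_ideals A"
  shows "I \<subseteq> base A" "\<bottom> \<in> I" "\<lbrakk>x \<in> I; y \<in> I\<rbrakk> \<Longrightarrow> x \<squnion> y \<in> I"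
    "\<lbrakk>x \<in> I; y \<in> base A; y \<sqsubseteq> x\<rbrakk> \<Longrightarrow> y \<in> I" "I \<subseteq> carrier A"
  using assms base_sub by (auto simp: base_ideals_def)

lemma principal_ideal_closed:
  assumes "a \<in> carrier A"
  shows "principal_ideal A a \<in> base_ideals A"
  unfolding principal_ideal_def
  using assms base_closed base_carrier
  by (intro base_idealsI) (auto simp: join_le_iff intro: le_trans)

lemma principal_ideal_subset_iff:
  assumes "b \<in> base A" "I \<in> base_ideals A"
  shows "principal_ideal A b \<subseteq> I \<longleftrightarrow> b \<in> I"
  using assms base_idealsD[OF assms(2)] base_carrier by (auto simp: principal_ideal_def le_refl)

text \<open>For \<open>x \<in> I\<close> the residual is the ideal of all \<open>y\<close> with \<open>x \<sqinter> y \<in> Z\<close>: it contains an ideal \<open>X\<close>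
  with \<open>I \<inter> X \<subseteq> Z\<close> because \<open>x \<sqinter> y\<close> lies in both \<open>I\<close> and \<open>X\<close>, and it contains \<open>x\<close> only if \<open>x \<in> Z\<close>.\<close>

sublocale ideals: closure_system "base A" "base_ideals A"
proof
  show "base A \<in> base_ideals A" using base_closed by (intro base_idealsI) auto
  show "X \<subseteq> base A" if "X \<in> base_ideals A" for X using that by (rule base_idealsD)
  show "\<Inter>\<X> \<in> base_ideals A" if "\<X> \<subseteq> base_ideals A" "\<X> \<noteq> {}" for \<X>
    using that unfolding base_ideals_def by (auto 0 3)
  fix I Z x assume I: "I \<in> base_ideals A" and Z: "Z \<in> base_ideals A" and x: "x \<in> I"
  have xA: "x \<in> base A" "x \<in> carrier A" using base_idealsD[OF I] x by auto
  define W where "W = {y \<in> base A. x \<sqinter> y \<in> Z}"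
  have "W \<in> base_ideals A"
  proof (rule base_idealsI)
    have "x \<sqinter> \<bottom> = \<bottom>" using xA by (simp add: meet_comm[of A x] bottom_meet)
    then show "\<bottom> \<in> W" using base_idealsD(2)[OF Z] base_closed by (simp add: W_def)
    show "y \<squnion> z \<in> W" if "y \<in> W" "z \<in> W" for y z
      using that xA base_closed base_carrier base_idealsD(3)[OF Z]
      by (simp add: W_def meet_join_distrib)
    show "z \<in> W" if "y \<in> W" "z \<in> base A" "z \<sqsubseteq> y" for y z
    proof -
      have "x \<sqinter> z \<sqsubseteq> x \<sqinter> y"
        using that xA base_carrier by (simp add: W_def le_meet_iff meet_left le_trans[OF meet_right])
      then show ?thesis
        using that xA base_closed(3) base_idealsD(4)[OF Z, of "x \<sqinter> y" "x \<sqinter> z"] by (simp add: W_def)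
    qed
  qed (auto simp: W_def)
  moreover have "X \<subseteq> W" if X: "X \<in> base_ideals A" and sub: "I \<inter> X \<subseteq> Z" for X
  proof
    fix y assume y: "y \<in> X"
    have yA: "y \<in> base A" "y \<in> carrier A" using base_idealsD[OF X] y by auto
    have "x \<sqinter> y \<in> I" "x \<sqinter> y \<in> X"
      using base_idealsD(4)[OF I x] base_idealsD(4)[OF X y] xA yA base_closed
      by (simp_all add: meet_left meet_right)
    then show "y \<in> W" using sub yA by (auto simp: W_def)
  qed
  moreover have "x \<in> Z" if "x \<in> W"
    using that xA by (simp add: W_def meet_absorb[THEN iffD1, OF _ _ le_refl])
  ultimately show "\<exists>W\<in>base_ideals A. (\<forall>X\<in>base_ideals A. I \<inter> X \<subseteq> Z \<longrightarrow> X \<subseteq> W) \<and> (x \<in> W \<longrightarrow> x \<in> Z)"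
    by blast
qed

abbreviation "Idl \<equiv> ideal_frith A"

lemma ideal_restriction: "frame_restriction ideals.closed_sets Idl"
  using ideals.frame_closed_sets frame.subframe_carrier[OF ideals.frame_closed_sets]
  by (auto simp: frame_restriction_def frame_restriction_axioms_def ideal_frith_def)

sublocale IR: frame_restriction ideals.closed_sets Idl
  by (rule ideal_restriction)

sublocale Idl: frame Idl
  by (rule IR.frame_M)

lemma ideal_simps:
  "carrier Idl = base_ideals A" "le Idl = (\<subseteq>)" "base Idl = principal_ideal A ` base A"
  by (simp_all add: ideal_frith_def)

lemma principal_ideal_carrier: "a \<in> carrier A \<Longrightarrow> principal_ideal A a \<in> carrier Idl"
  by (simp add: ideal_simps principal_ideal_closed)

lemma principal_ideal_le_iff:
  "\<lbrakk>b \<in> base A; I \<in> carrier Idl\<rbrakk> \<Longrightarrow> le Idl (principal_ideal A b) I \<longleftrightarrow> b \<in> I"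
  by (simp add: ideal_simps principal_ideal_subset_iff)

lemma ideal_meet: "\<lbrakk>I \<in> base_ideals A; J \<in> base_ideals A\<rbrakk> \<Longrightarrow> I \<sqinter>\<^bsub>Idl\<^esub> J = I \<inter> J"
  using IR.meet_M[of I J] ideals.meet_eq[of I J] by (simp add: ideal_simps)

lemma ideal_top: "\<top>\<^bsub>Idl\<^esub> = base A"
  using IR.top_M ideals.top_eq by simp

lemma principal_ideal_meet:
  "\<lbrakk>a \<in> base A; b \<in> base A\<rbrakk> \<Longrightarrow> principal_ideal A a \<sqinter>\<^bsub>Idl\<^esub> principal_ideal A b = principal_ideal A (a \<sqinter> b)"
  using base_carrier
  by (simp add: ideal_meet principal_ideal_closed) (auto simp: principal_ideal_def le_meet_iff)

lemma principal_ideal_join: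
  assumes "a \<in> base A" "b \<in> base A"
  shows "principal_ideal A a \<squnion>\<^bsub>Idl\<^esub> principal_ideal A b = principal_ideal A (a \<squnion> b)"
proof (rule Idl.eqI_above)
  fix Z assume ZI: "Z \<in> carrier Idl"
  then have Z: "Z \<in> base_ideals A" by (simp add: ideal_simps)
  have "a \<squnion> b \<in> Z \<longleftrightarrow> a \<in> Z \<and> b \<in> Z"
    using base_idealsD(3,4)[OF Z] assms base_carrier base_closed(4) by (metis join_left join_right)
  then show "le Idl (principal_ideal A a \<squnion>\<^bsub>Idl\<^esub> principal_ideal A b) Z \<longleftrightarrow> le Idl (principal_ideal A (a \<squnion> b)) Z"
    using assms ZI base_carrier base_closed(4)
    by (simp add: Idl.join_le_iff principal_ideal_carrier principal_ideal_le_iff)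
qed (use assms base_carrier in \<open>auto simp: principal_ideal_carrier\<close>)

lemma principal_ideal_top: "principal_ideal A \<top> = \<top>\<^bsub>Idl\<^esub>"
  using base_carrier by (auto simp: ideal_top principal_ideal_def)

lemma principal_ideal_bottom: "principal_ideal A \<bottom> = \<bottom>\<^bsub>Idl\<^esub>"
proof -
  have "le Idl (principal_ideal A \<bottom>) \<bottom>\<^bsub>Idl\<^esub>"
    using base_idealsD(2)[of "\<bottom>\<^bsub>Idl\<^esub>"] Idl.bottom_closed
    unfolding principal_ideal_le_iff[OF base_closed(1) Idl.bottom_closed] unfolding ideal_simps by blast
  then show ?thesis by (simp add: Idl.le_bottom_iff principal_ideal_carrier)
qed

lemma ideal_frith_frame: "frith_frame Idl"
  unfolding frith_frame_def
proof (intro conjI ballI Idl.frame_axioms)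
  show "bounded_sublattice Idl (base Idl)"
    using base_closed base_carrier principal_ideal_closed
    by (auto simp: bounded_sublattice_def principal_ideal_top[symmetric]
        principal_ideal_bottom[symmetric] principal_ideal_meet principal_ideal_join ideal_simps)
  fix I assume "I \<in> carrier Idl"
  then have I: "I \<in> base_ideals A" by (simp add: ideal_simps)
  have sub: "principal_ideal A ` I \<subseteq> carrier Idl"
    using base_idealsD[OF I] principal_ideal_closed by (auto simp: ideal_simps)
  have "I = \<Squnion>\<^bsub>Idl\<^esub> (principal_ideal A ` I)"
  proof (rule Idl.eqI_above)
    fix Z assume Z: "Z \<in> carrier Idl"
    have "principal_ideal A b \<subseteq> Z \<longleftrightarrow> b \<in> Z" if "b \<in> I" for b
      using principal_ideal_subset_iff base_idealsD(1)[OF I] Z that by (auto simp: ideal_simps)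
    then show "le Idl I Z \<longleftrightarrow> le Idl (\<Squnion>\<^bsub>Idl\<^esub> (principal_ideal A ` I)) Z"
      using Idl.sup_le_iff[OF sub Z] by (auto simp: ideal_simps)
  qed (use I Idl.sup_closed[OF sub] in \<open>auto simp: ideal_simps\<close>)
  then show "\<exists>X\<subseteq>base Idl. I = \<Squnion>\<^bsub>Idl\<^esub> X"
    using base_idealsD(1)[OF I] by (intro exI[of _ "principal_ideal A ` I"]) (auto simp: ideal_simps)
qed

definition ideal_sup :: "'a set \<Rightarrow> 'a" where
  "ideal_sup = (\<lambda>I\<in>base_ideals A. \<Squnion>I)"

text \<open>Finite meets are preserved by distributivity.  For joins, the ideal of base elements below
  \<open>m = \<Squnion>\<^sub>I \<Squnion>I\<close> contains every member of the family, hence also its join.\<close>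

lemma ideal_sup_hom: "ideal_sup \<in> frame_hom Idl A"
  unfolding frame_hom_def
proof (intro CollectI conjI ballI allI impI)
  show "ideal_sup \<in> carrier Idl \<rightarrow>\<^sub>E carrier A"
    using base_idealsD(5) by (auto simp: ideal_sup_def ideal_simps)
  have "\<Squnion>(base A) = \<top>"
    using base_sub base_closed(2) by (metis le_antisym sup_closed sup_upper top_closed top_higher)
  then show "ideal_sup \<top>\<^bsub>Idl\<^esub> = \<top>" using ideals.U by (simp add: ideal_sup_def ideal_top)
  show "ideal_sup (I \<sqinter>\<^bsub>Idl\<^esub> J) = ideal_sup I \<sqinter> ideal_sup J"
    if "I \<in> carrier Idl" "J \<in> carrier Idl" for I J
  proof -
    have IJ: "I \<in> base_ideals A" "J \<in> base_ideals A" using that by (auto simp: ideal_simps)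
    have "x \<sqinter> y \<in> I \<inter> J" if "x \<in> I" "y \<in> J" for x y
    proof -
      have xy: "x \<in> base A" "y \<in> base A" using that IJ base_idealsD(1) by blast+
      then have "x \<sqinter> y \<in> I" "x \<sqinter> y \<in> J"
        using base_idealsD(4)[OF IJ(1) that(1)] base_idealsD(4)[OF IJ(2) that(2)] base_closed(3) base_carrier
        by (simp_all add: meet_left meet_right)
      then show ?thesis by simp
    qed
    moreover have "x = x \<sqinter> x" if "x \<in> I" for x
      using that base_idealsD(5)[OF IJ(1)] meet_absorb le_refl by (metis subsetD)
    ultimately have "{x \<sqinter> y |x y. x \<in> I \<and> y \<in> J} = I \<inter> J" by blast
    then show ?thesis
      using IJ sup_meet_sup[of I J] base_idealsD(5)
      by (simp add: ideal_sup_def ideal_meet ideals.Int_closed)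
  qed
  show "ideal_sup (\<Squnion>\<^bsub>Idl\<^esub> \<X>) = \<Squnion>(ideal_sup ` \<X>)" if "\<X> \<subseteq> carrier Idl" for \<X>
  proof -
    have X: "\<X> \<subseteq> base_ideals A" using that by (simp add: ideal_simps)
    have S: "\<Squnion>\<^bsub>Idl\<^esub> \<X> \<in> base_ideals A" using Idl.sup_closed[OF that] by (simp add: ideal_simps)
    have img: "ideal_sup ` \<X> = (\<lambda>I. \<Squnion>I) ` \<X>" "(\<lambda>I. \<Squnion>I) ` \<X> \<subseteq> carrier A"
      using X base_idealsD(5) by (auto simp: ideal_sup_def subset_iff)
    define m where "m = \<Squnion>((\<lambda>I. \<Squnion>I) ` \<X>)"
    have m: "m \<in> carrier A" using img by (simp add: m_def)
    have "\<Squnion>(\<Squnion>\<^bsub>Idl\<^esub> \<X>) = m"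
    proof (rule le_antisym)
      have "I \<subseteq> principal_ideal A m" if I: "I \<in> \<X>" for I
      proof
        fix b assume b: "b \<in> I"
        have IA: "I \<subseteq> carrier A" "I \<subseteq> base A"
          using base_idealsD(5,1)[OF subsetD[OF X I]] .
        have "b \<sqsubseteq> \<Squnion>I" using IA b by (simp add: sup_upper)
        also have "\<Squnion>I \<sqsubseteq> m" unfolding m_def using img(2) I by (intro sup_upper) auto
        finally show "b \<in> principal_ideal A m" using IA b m by (auto simp: principal_ideal_def)
      qed
      then have "le Idl (\<Squnion>\<^bsub>Idl\<^esub> \<X>) (principal_ideal A m)"
        using that principal_ideal_closed[OF m] by (subst Idl.sup_le_iff) (auto simp: ideal_simps)
      then have "\<forall>b\<in>\<Squnion>\<^bsub>Idl\<^esub> \<X>. b \<sqsubseteq> m" by (auto simp: ideal_simps principal_ideal_def)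
      then show "\<Squnion>(\<Squnion>\<^bsub>Idl\<^esub> \<X>) \<sqsubseteq> m" using S m base_idealsD(5) by (simp add: sup_le_iff)
      have "\<Squnion>I \<sqsubseteq> \<Squnion>(\<Squnion>\<^bsub>Idl\<^esub> \<X>)" if "I \<in> \<X>" for I
        using Idl.sup_upper[OF \<open>\<X> \<subseteq> carrier Idl\<close> that] S base_idealsD(5)
        by (intro sup_mono) (simp_all add: ideal_simps)
      then show "m \<sqsubseteq> \<Squnion>(\<Squnion>\<^bsub>Idl\<^esub> \<X>)"
        unfolding m_def using img S base_idealsD(5) by (simp add: sup_le_iff)
    qed (use S m base_idealsD(5) in auto)
    then show ?thesis using S img by (simp add: ideal_sup_def m_def)
  qed
qed

lemma ideal_sup_principal: "b \<in> base A \<Longrightarrow> ideal_sup (principal_ideal A b) = b"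
  using sup_base[OF base_carrier] principal_ideal_closed[OF base_carrier]
  by (simp add: ideal_sup_def principal_ideal_def)

text \<open>The morphism \<open>I \<mapsto> \<Squnion>I\<close> from the ideals of the base is always a dense extremal epimorphism, so
  completeness makes it injective.  A cover \<open>X\<close> of \<open>\<top>\<close> yields the ideal of base elements that lie below
  a finite join of members of \<open>X\<close>; its join is \<open>\<top>\<close>, so it is the improper ideal and contains
  \<open>\<top>\<close>.\<close>

lemma complete_imp_compact:
  assumes complete: "complete_symmetric A"
  shows "compact_frame A"
  unfolding compact_frame_def
proof (intro conjI frame_axioms allI impI)
  have "symmetric_frith Idl"
    unfolding symmetric_frith_def
  proof (intro conjI ballI ideal_frith_frame)
    fix I assume "I \<in> base Idl"
    then obtain a where a: "a \<in> base A" "I = principal_ideal A a" by (auto simp: ideal_simps)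
    then obtain b where b: "b \<in> base A" "complements A a b"
      using complete by (auto simp: complete_symmetric_def symmetric_frith_def)
    have "complements Idl I (principal_ideal A b)"
      using a b by (simp add: complements_def principal_ideal_meet principal_ideal_join
          principal_ideal_top principal_ideal_bottom)
    then show "\<exists>J\<in>base Idl. complements Idl I J" using b by (auto simp: ideal_simps)
  qed
  moreover have "dense_map Idl A ideal_sup"
    unfolding dense_map_def
  proof (intro ballI impI)
    fix I assume "I \<in> carrier Idl" and bot: "ideal_sup I = \<bottom>"
    then have I: "I \<in> base_ideals A" by (simp add: ideal_simps)
    then have "x \<sqsubseteq> \<bottom>" if "x \<in> I" for x
      using bot sup_upper[OF base_idealsD(5)[OF I] that] by (simp add: ideal_sup_def)
    then have "I \<subseteq> principal_ideal A \<bottom>"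
      using base_idealsD(1)[OF I] by (auto simp: principal_ideal_def)
    moreover have "principal_ideal A \<bottom> \<subseteq> I"
      using base_idealsD(2)[OF I] principal_ideal_subset_iff[OF base_closed(1) I] by simp
    ultimately have "I = principal_ideal A \<bottom>" by (rule subset_antisym)
    then show "I = \<bottom>\<^bsub>Idl\<^esub>" by (simp add: principal_ideal_bottom)
  qed
  moreover have "ideal_sup ` base Idl = base A"
    unfolding ideal_simps image_image using ideal_sup_principal by (simp cong: image_cong_simp)
  then have "extremal_epi Idl A ideal_sup"
    using ideal_sup_hom by (simp add: extremal_epi_def frith_hom_def)
  ultimately have "frith_iso Idl A ideal_sup" using complete by (simp add: complete_symmetric_def)
  then obtain k where k: "compose (carrier Idl) k ideal_sup = (\<lambda>x\<in>carrier Idl. x)"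
    by (auto simp: frith_iso_def)
  have inj: "I = J" if "I \<in> base_ideals A" "J \<in> base_ideals A" "\<Squnion>I = \<Squnion>J" for I J
    using fun_cong[OF k, of I] fun_cong[OF k, of J] that
    by (simp add: compose_def ideal_simps ideal_sup_def)
  fix X assume X: "X \<subseteq> carrier A \<and> \<Squnion>X = \<top>"
  define W where "W = {b \<in> base A. \<exists>F. F \<subseteq> X \<and> finite F \<and> b \<sqsubseteq> \<Squnion>F}"
  have W: "W \<in> base_ideals A"
  proof (rule base_idealsI)
    show "\<bottom> \<in> W" using base_closed(1) by (auto simp: W_def intro!: exI[of _ "{}"])
    show "x \<squnion> y \<in> W" if xy: "x \<in> W" "y \<in> W" for x y
    proof -
      obtain F G where FG: "F \<subseteq> X" "finite F" "x \<sqsubseteq> \<Squnion>F" "G \<subseteq> X" "finite G" "y \<sqsubseteq> \<Squnion>G"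
        using xy by (auto simp: W_def)
      have sub: "F \<subseteq> carrier A" "G \<subseteq> carrier A" using FG X by auto
      have c: "x \<in> carrier A" "y \<in> carrier A" using xy base_carrier by (auto simp: W_def)
      have "x \<squnion> y \<sqsubseteq> \<Squnion>(F \<union> G)"
        using sub c FG le_trans[OF _ join_left] le_trans[OF _ join_right]
        by (simp add: sup_Un join_le_iff)
      then show ?thesis
        using xy FG base_closed(4) by (auto simp: W_def intro!: exI[of _ "F \<union> G"])
    qed
    show "y \<in> W" if xy: "x \<in> W" "y \<in> base A" "y \<sqsubseteq> x" for x y
    proof -
      obtain F where F: "F \<subseteq> X" "finite F" "x \<sqsubseteq> \<Squnion>F" "x \<in> base A" using xy by (auto simp: W_def)
      have "F \<subseteq> carrier A" using F X by auto
      then have "y \<sqsubseteq> \<Squnion>F" using le_trans[OF xy(3) F(3)] xy F base_carrier by simp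
      then show ?thesis using F xy by (auto simp: W_def)
    qed
  qed (auto simp: W_def)
  have "x \<sqsubseteq> \<Squnion>W" if x: "x \<in> X" for x
  proof -
    have xA: "x \<in> carrier A" using x X by auto
    have "{s \<in> base A. s \<sqsubseteq> x} \<subseteq> W"
      using x xA by (auto simp: W_def intro!: exI[of _ "{x}"])
    then have "\<Squnion>{s \<in> base A. s \<sqsubseteq> x} \<sqsubseteq> \<Squnion>W" using base_idealsD(5)[OF W] by (rule sup_mono)
    then show ?thesis using sup_base[OF xA] by simp
  qed
  then have "\<Squnion>X \<sqsubseteq> \<Squnion>W"
    using conjunct1[OF X] base_idealsD(5)[OF W] by (intro sup_least sup_closed)
  then have "\<Squnion>W = \<top>" using X base_idealsD(5)[OF W] by (simp add: le_antisym)
  moreover have "\<Squnion>(base A) = \<top>"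
    using base_sub base_closed(2) by (metis le_antisym sup_closed sup_upper top_closed top_higher)
  ultimately have "W = base A" using inj[OF W ideals.U] by simp
  then have "\<top> \<in> W" using base_closed by simp
  then obtain F where F: "F \<subseteq> X" "finite F" "\<top> \<sqsubseteq> \<Squnion>F" by (auto simp: W_def)
  then have "\<Squnion>F = \<top>" using X by (meson le_antisym sup_closed subset_trans top_closed top_higher)
  then show "\<exists>F\<subseteq>X. finite F \<and> \<Squnion>F = \<top>" using F by blast
qed

end

lemma frith_iff: "frith A \<longleftrightarrow> frith_frame A"
  by (auto simp: frith_def frith_axioms_def frith_frame_def)

theorem complete_symmetric_iff_compact:
  "complete_symmetric A \<longleftrightarrow> symmetric_frith A \<and> compact_frame A"
  using compact_symmetric_imp_complete frith.complete_imp_compact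
  unfolding frith_iff complete_symmetric_def symmetric_frith_def by blast

section \<open>The congruence frame\<close>

lemma frame_congruenceI:
  assumes "\<theta> \<subseteq> carrier L \<times> carrier L" "\<And>x. x \<in> carrier L \<Longrightarrow> (x, x) \<in> \<theta>"
    and "\<And>x y. (x, y) \<in> \<theta> \<Longrightarrow> (y, x) \<in> \<theta>"
    and "\<And>x y z. \<lbrakk>(x, y) \<in> \<theta>; (y, z) \<in> \<theta>\<rbrakk> \<Longrightarrow> (x, z) \<in> \<theta>"
    and "\<And>x y x' y'. \<lbrakk>(x, y) \<in> \<theta>; (x', y') \<in> \<theta>\<rbrakk> \<Longrightarrow> (x \<sqinter>\<^bsub>L\<^esub> x', y \<sqinter>\<^bsub>L\<^esub> y') \<in> \<theta>"
    and "\<And>R. R \<subseteq> \<theta> \<Longrightarrow> (\<Squnion>\<^bsub>L\<^esub> (fst ` R), \<Squnion>\<^bsub>L\<^esub> (snd ` R)) \<in> \<theta>"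
  shows "frame_congruence L \<theta>"
  unfolding frame_congruence_def
proof (intro conjI allI impI)
  show "equiv (carrier L) \<theta>"
    by (intro equivI refl_onI symI transI) (rule assms(1-4); assumption)+
  show "\<forall>(x, y)\<in>\<theta>. \<forall>(x', y')\<in>\<theta>. (x \<sqinter>\<^bsub>L\<^esub> x', y \<sqinter>\<^bsub>L\<^esub> y') \<in> \<theta>"
    by (clarify, rule assms(5))
qed (rule assms(6))

lemma frame_congruenceD:
  assumes "frame_congruence L \<theta>"
  shows "\<theta> \<subseteq> carrier L \<times> carrier L" "x \<in> carrier L \<Longrightarrow> (x, x) \<in> \<theta>"
    and "(x, y) \<in> \<theta> \<Longrightarrow> (y, x) \<in> \<theta>"
    and "\<lbrakk>(x, y) \<in> \<theta>; (y, z) \<in> \<theta>\<rbrakk> \<Longrightarrow> (x, z) \<in> \<theta>"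
    and "\<lbrakk>(x, y) \<in> \<theta>; (x', y') \<in> \<theta>\<rbrakk> \<Longrightarrow> (x \<sqinter>\<^bsub>L\<^esub> x', y \<sqinter>\<^bsub>L\<^esub> y') \<in> \<theta>"
    and "R \<subseteq> \<theta> \<Longrightarrow> (\<Squnion>\<^bsub>L\<^esub> (fst ` R), \<Squnion>\<^bsub>L\<^esub> (snd ` R)) \<in> \<theta>"
    and "\<lbrakk>(x, y) \<in> \<theta>; (x', y') \<in> \<theta>\<rbrakk> \<Longrightarrow> (x \<squnion>\<^bsub>L\<^esub> x', y \<squnion>\<^bsub>L\<^esub> y') \<in> \<theta>"
proof -
  have e: "equiv (carrier L) \<theta>" using assms by (simp add: frame_congruence_def)
  show "\<theta> \<subseteq> carrier L \<times> carrier L" using e by (rule equiv_type)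
  show "x \<in> carrier L \<Longrightarrow> (x, x) \<in> \<theta>" using e by (simp add: equiv_def refl_on_def)
  show "(x, y) \<in> \<theta> \<Longrightarrow> (y, x) \<in> \<theta>" using e by (meson equivE symE)
  show "\<lbrakk>(x, y) \<in> \<theta>; (y, z) \<in> \<theta>\<rbrakk> \<Longrightarrow> (x, z) \<in> \<theta>" using e by (meson equivE transE)
  show "\<lbrakk>(x, y) \<in> \<theta>; (x', y') \<in> \<theta>\<rbrakk> \<Longrightarrow> (x \<sqinter>\<^bsub>L\<^esub> x', y \<sqinter>\<^bsub>L\<^esub> y') \<in> \<theta>"
    using assms[unfolded frame_congruence_def, THEN conjunct2, THEN conjunct1, rule_format, of "(x, y)"]
    by (metis (mono_tags, lifting) case_prodD)
  show sup: "R \<subseteq> \<theta> \<Longrightarrow> (\<Squnion>\<^bsub>L\<^esub> (fst ` R), \<Squnion>\<^bsub>L\<^esub> (snd ` R)) \<in> \<theta>" for R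
    using assms by (simp add: frame_congruence_def)
  show "\<lbrakk>(x, y) \<in> \<theta>; (x', y') \<in> \<theta>\<rbrakk> \<Longrightarrow> (x \<squnion>\<^bsub>L\<^esub> x', y \<squnion>\<^bsub>L\<^esub> y') \<in> \<theta>"
    using sup[of "{(x, y), (x', y')}"] by (simp add: join_def)
qed

text \<open>The congruences \<open>\<nabla>\<^sub>a\<close> and \<open>\<Delta>\<^sub>a\<close>, the residuals that yield distributivity, and the kernels that
  yield the universal property are all pullbacks.  The map may move \<open>\<bottom>\<close> and \<open>\<top>\<close>, so that
  \<open>p \<mapsto> a \<squnion> p\<close>, \<open>p \<mapsto> a \<sqinter> p\<close>, \<open>p \<mapsto> (a \<squnion> p) \<sqinter> b\<close> and \<open>p \<mapsto> m \<squnion> h p\<close> are all covered.\<close>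

lemma pullback_congruence:
  fixes L :: "('a, 'x) gorder_scheme" and M :: "('b, 'y) gorder_scheme"
  assumes L: "frame L" and \<chi>: "frame_congruence M \<chi>"
    and closed: "\<And>x. x \<in> carrier L \<Longrightarrow> f x \<in> carrier M"
    and meet: "\<And>x y. \<lbrakk>x \<in> carrier L; y \<in> carrier L\<rbrakk> \<Longrightarrow> f (x \<sqinter>\<^bsub>L\<^esub> y) = f x \<sqinter>\<^bsub>M\<^esub> f y"
    and sup: "\<And>X. \<lbrakk>X \<subseteq> carrier L; X \<noteq> {}\<rbrakk> \<Longrightarrow> f (\<Squnion>\<^bsub>L\<^esub> X) = \<Squnion>\<^bsub>M\<^esub> (f ` X)"
  shows "frame_congruence L {(x, y). x \<in> carrier L \<and> y \<in> carrier L \<and> (f x, f y) \<in> \<chi>}" (is "frame_congruence L ?W")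
proof (rule frame_congruenceI)
  interpret frame L by (rule L)
  note D = frame_congruenceD[OF \<chi>]
  show "(x, x) \<in> ?W" if "x \<in> carrier L" for x using that closed D(2) by simp
  show "(y, x) \<in> ?W" if "(x, y) \<in> ?W" for x y using that D(3) by simp
  show "(x, z) \<in> ?W" if "(x, y) \<in> ?W" "(y, z) \<in> ?W" for x y z using that D(4)[of "f x" "f y" "f z"] by simp
  show "(x \<sqinter>\<^bsub>L\<^esub> x', y \<sqinter>\<^bsub>L\<^esub> y') \<in> ?W" if "(x, y) \<in> ?W" "(x', y') \<in> ?W" for x y x' y'
    using that D(5) meet by simp
  show "(\<Squnion>\<^bsub>L\<^esub> (fst ` R), \<Squnion>\<^bsub>L\<^esub> (snd ` R)) \<in> ?W" if R: "R \<subseteq> ?W" for R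
  proof -
    have c: "fst ` R \<subseteq> carrier L" "snd ` R \<subseteq> carrier L" using R by auto
    have "(f (\<Squnion>\<^bsub>L\<^esub> (fst ` R)), f (\<Squnion>\<^bsub>L\<^esub> (snd ` R))) \<in> \<chi>"
    proof (cases "R = {}")
      case True
      then show ?thesis using D(2) closed by simp
    next
      case False
      let ?S = "(\<lambda>r. (f (fst r), f (snd r))) ` R"
      have "?S \<subseteq> \<chi>" using R by auto
      then have "(\<Squnion>\<^bsub>M\<^esub> (fst ` ?S), \<Squnion>\<^bsub>M\<^esub> (snd ` ?S)) \<in> \<chi>" by (rule D(6))
      moreover have "fst ` ?S = f ` fst ` R" "snd ` ?S = f ` snd ` R" by (simp_all add: image_image)
      ultimately show ?thesis using sup[OF c(1)] sup[OF c(2)] False by simp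
    qed
    then show ?thesis using c by simp
  qed
qed auto

context frame
begin

lemma Id_congruence: "frame_congruence L (Id_on (carrier L))"
proof (rule frame_congruenceI)
  fix R assume R: "R \<subseteq> Id_on (carrier L)"
  have "fst ` R = snd ` R" using R by (intro image_cong refl) auto
  moreover have "snd ` R \<subseteq> carrier L" using R by auto
  ultimately show "(\<Squnion> (fst ` R), \<Squnion> (snd ` R)) \<in> Id_on (carrier L)" by auto
qed auto

lemma kernel_congruence:
  fixes M :: "('m, 'y) gorder_scheme"
  assumes M: "frame M"
    and closed: "\<And>x. x \<in> carrier L \<Longrightarrow> f x \<in> carrier M"
    and meet: "\<And>x y. \<lbrakk>x \<in> carrier L; y \<in> carrier L\<rbrakk> \<Longrightarrow> f (x \<sqinter> y) = f x \<sqinter>\<^bsub>M\<^esub> f y"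
    and sup: "\<And>X. \<lbrakk>X \<subseteq> carrier L; X \<noteq> {}\<rbrakk> \<Longrightarrow> f (\<Squnion>X) = \<Squnion>\<^bsub>M\<^esub> (f ` X)"
  shows "frame_congruence L {(x, y). x \<in> carrier L \<and> y \<in> carrier L \<and> f x = f y}"
proof -
  have "frame_congruence L {(x, y). x \<in> carrier L \<and> y \<in> carrier L \<and> (f x, f y) \<in> Id_on (carrier M)}"
    by (rule pullback_congruence[OF frame_axioms frame.Id_congruence[OF M] closed meet sup])
  moreover have "{(x, y). x \<in> carrier L \<and> y \<in> carrier L \<and> (f x, f y) \<in> Id_on (carrier M)}
    = {(x, y). x \<in> carrier L \<and> y \<in> carrier L \<and> f x = f y}"
    using closed by (auto simp: Id_on_def)
  ultimately show ?thesis by simp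
qed

lemma nabla_congruence: "a \<in> carrier L \<Longrightarrow> frame_congruence L (nabla L a)"
proof -
  assume a: "a \<in> carrier L"
  have "nabla L a = {(x, y). x \<in> carrier L \<and> y \<in> carrier L \<and> a \<squnion> x = a \<squnion> y}"
    by (auto simp: nabla_def)
  also have "frame_congruence L \<dots>"
    using a by (intro kernel_congruence[OF frame_axioms]) (auto simp: join_meet_distrib join_sup)
  finally show ?thesis .
qed

lemma delta_congruence: "a \<in> carrier L \<Longrightarrow> frame_congruence L (delta L a)"
proof -
  assume a: "a \<in> carrier L"
  have idem: "a \<sqinter> (x \<sqinter> y) = (a \<sqinter> x) \<sqinter> (a \<sqinter> y)" if "x \<in> carrier L" "y \<in> carrier L" for x y
    using a that by (intro eqI_below) (auto simp: le_meet_iff)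
  have "delta L a = {(x, y). x \<in> carrier L \<and> y \<in> carrier L \<and> a \<sqinter> x = a \<sqinter> y}"
    by (auto simp: delta_def)
  also have "frame_congruence L \<dots>"
    using a by (intro kernel_congruence[OF frame_axioms]) (auto simp: idem meet_sup_distrib)
  finally show ?thesis .
qed

text \<open>The residuals, hence distributivity of the congruence lattice, come from intervals of \<open>L\<close>.  Let \<open>(a, b) \<in> \<theta>\<close> and put \<open>x = a \<sqinter> b\<close>,
  \<open>y = a \<squnion> b\<close>.  All elements of the interval from \<open>x\<close> to \<open>y\<close> are \<open>\<theta>\<close>-related, and
  \<open>p \<mapsto> (x \<squnion> p) \<sqinter> y\<close> maps into this interval and fixes \<open>a\<close> and \<open>b\<close>.  So the pullback of \<open>\<chi>\<close>
  along this map contains every \<open>\<psi>\<close> with \<open>\<theta> \<inter> \<psi> \<subseteq> \<chi>\<close>.\<close>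

lemma congruences_closure_system: "closure_system (carrier L \<times> carrier L) {\<theta>. frame_congruence L \<theta>}"
proof
  show "carrier L \<times> carrier L \<in> {\<theta>. frame_congruence L \<theta>}"
  proof (intro CollectI frame_congruenceI)
    fix R assume R: "R \<subseteq> carrier L \<times> carrier L"
    then have "fst ` R \<subseteq> carrier L" "snd ` R \<subseteq> carrier L" by auto
    then show "(\<Squnion>(fst ` R), \<Squnion>(snd ` R)) \<in> carrier L \<times> carrier L" by simp
  qed auto
  show "X \<subseteq> carrier L \<times> carrier L" if "X \<in> {\<theta>. frame_congruence L \<theta>}" for X
    using that frame_congruenceD(1) by auto
  show "\<Inter>\<X> \<in> {\<theta>. frame_congruence L \<theta>}" if X: "\<X> \<subseteq> {\<theta>. frame_congruence L \<theta>}" "\<X> \<noteq> {}" for \<X>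
  proof -
    have D: "frame_congruence L \<theta>" if "\<theta> \<in> \<X>" for \<theta> using X that by auto
    note E = frame_congruenceD[OF D]
    show ?thesis
    proof (intro CollectI frame_congruenceI)
      show "\<Inter>\<X> \<subseteq> carrier L \<times> carrier L" using E(1) X(2) by blast
      show "(x, x) \<in> \<Inter>\<X>" if "x \<in> carrier L" for x using E(2) that by blast
      show "(y, x) \<in> \<Inter>\<X>" if "(x, y) \<in> \<Inter>\<X>" for x y using E(3) that by blast
      show "(x, z) \<in> \<Inter>\<X>" if "(x, y) \<in> \<Inter>\<X>" "(y, z) \<in> \<Inter>\<X>" for x y z using E(4) that by blast
      show "(x \<sqinter> x', y \<sqinter> y') \<in> \<Inter>\<X>" if "(x, y) \<in> \<Inter>\<X>" "(x', y') \<in> \<Inter>\<X>" for x y x' y'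
        using E(5) that by blast
      show "(\<Squnion>(fst ` R), \<Squnion>(snd ` R)) \<in> \<Inter>\<X>" if R: "R \<subseteq> \<Inter>\<X>" for R
      proof
        fix \<theta> assume t: "\<theta> \<in> \<X>"
        show "(\<Squnion>(fst ` R), \<Squnion>(snd ` R)) \<in> \<theta>" by (rule E(6)[OF t]) (use R t in blast)
      qed
    qed
  qed
  fix \<theta> \<chi> r assume \<theta>: "\<theta> \<in> {\<theta>. frame_congruence L \<theta>}" and \<chi>: "\<chi> \<in> {\<theta>. frame_congruence L \<theta>}" and r: "r \<in> \<theta>"
  note D = frame_congruenceD[OF \<theta>[simplified]]
  obtain a b where ab: "r = (a, b)" "a \<in> carrier L" "b \<in> carrier L" "(a, b) \<in> \<theta>"
    using D(1) r by (cases r) auto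
  define x where "x = a \<sqinter> b"
  define y where "y = a \<squnion> b"
  define f where "f p = (x \<squnion> p) \<sqinter> y" for p
  have c: "x \<in> carrier L" "y \<in> carrier L" using ab by (auto simp: x_def y_def)
  have fc: "f p \<in> carrier L" if "p \<in> carrier L" for p using that c by (simp add: f_def)
  have xy: "(x, y) \<in> \<theta>"
  proof -
    have "(a \<sqinter> b, a \<sqinter> a) \<in> \<theta>" using D(5)[OF D(2)[OF ab(2)] D(3)[OF ab(4)]] .
    moreover have "(a \<squnion> a, a \<squnion> b) \<in> \<theta>" using D(7)[OF D(2)[OF ab(2)] ab(4)] .
    moreover have "a \<sqinter> a = a" "a \<squnion> a = a" using ab by (simp_all add: meet_idem join_idem)
    ultimately show ?thesis unfolding x_def y_def using D(4) by metis
  qed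
  have lexy: "x \<sqsubseteq> a" "x \<sqsubseteq> b" "a \<sqsubseteq> y" "b \<sqsubseteq> y"
    using ab by (simp_all add: x_def y_def meet_left meet_right join_left join_right)
  then have lexy': "x \<sqsubseteq> y" using c ab le_trans by blast
  have f\<theta>: "(x, f p) \<in> \<theta>" if p: "p \<in> carrier L" for p
  proof -
    have "x \<sqsubseteq> f p" "f p \<sqsubseteq> y" using p c lexy' by (simp_all add: f_def le_meet_iff join_left meet_right)
    then have "x \<sqinter> f p = x" "y \<sqinter> f p = f p" using c fc[OF p] by (metis meet_absorb meet_comm)+
    then show ?thesis using D(5)[OF xy D(2)[OF fc[OF p]]] by simp
  qed
  define W where "W = {(p, q). p \<in> carrier L \<and> q \<in> carrier L \<and> (f p, f q) \<in> \<chi>}"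
  have "frame_congruence L W" unfolding W_def
  proof (rule pullback_congruence[OF frame_axioms \<chi>[simplified] fc])
    show "f (p \<sqinter> q) = f p \<sqinter> f q" if pq: "p \<in> carrier L" "q \<in> carrier L" for p q
    proof -
      have "f (p \<sqinter> q) = ((x \<squnion> p) \<sqinter> (x \<squnion> q)) \<sqinter> y" using pq c by (simp add: f_def join_meet_distrib)
      also have "\<dots> = f p \<sqinter> f q"
        using pq c unfolding f_def by (intro eqI_below) (auto simp: le_meet_iff)
      finally show ?thesis .
    qed
    show "f (\<Squnion>X) = \<Squnion>(f ` X)" if X: "X \<subseteq> carrier L" "X \<noteq> {}" for X
    proof -
      have s: "(\<lambda>p. x \<squnion> p) ` X \<subseteq> carrier L" using X c by auto
      have "f (\<Squnion>X) = y \<sqinter> \<Squnion>((\<lambda>p. x \<squnion> p) ` X)"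
        using X c by (simp add: f_def join_sup meet_comm[of L _ y])
      also have "\<dots> = \<Squnion>((\<lambda>q. y \<sqinter> q) ` (\<lambda>p. x \<squnion> p) ` X)" using s c by (simp add: meet_sup_distrib)
      also have "(\<lambda>q. y \<sqinter> q) ` (\<lambda>p. x \<squnion> p) ` X = f ` X"
        by (simp add: image_image f_def meet_comm[of L y])
      finally show ?thesis .
    qed
  qed
  moreover have "\<psi> \<subseteq> W" if \<psi>: "frame_congruence L \<psi>" and sub: "\<theta> \<inter> \<psi> \<subseteq> \<chi>" for \<psi>
  proof
    fix r assume r': "r \<in> \<psi>"
    note E = frame_congruenceD[OF \<psi>]
    obtain p q where pq: "r = (p, q)" "p \<in> carrier L" "q \<in> carrier L" "(p, q) \<in> \<psi>"
      using E(1) r' by (cases r) auto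
    have "(f p, f q) \<in> \<psi>" unfolding f_def by (intro E(5) E(7) E(2) pq c)
    moreover have "(f p, f q) \<in> \<theta>" using D(4)[OF D(3)[OF f\<theta>[OF pq(2)]] f\<theta>[OF pq(3)]] .
    ultimately show "r \<in> W" using sub pq by (auto simp: W_def)
  qed
  moreover have "r \<in> \<chi>" if "r \<in> W"
  proof -
    have "x \<squnion> a = a" "x \<squnion> b = b" "a \<sqinter> y = a" "b \<sqinter> y = b"
      using lexy c ab by (simp_all add: join_absorb[symmetric] meet_absorb[symmetric])
    then show ?thesis using that ab by (simp add: W_def f_def)
  qed
  ultimately show "\<exists>W\<in>{\<theta>. frame_congruence L \<theta>}. (\<forall>\<psi>\<in>{\<theta>. frame_congruence L \<theta>}. \<theta> \<inter> \<psi> \<subseteq> \<chi> \<longrightarrow> \<psi> \<subseteq> W) \<and> (r \<in> W \<longrightarrow> r \<in> \<chi>)"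
    by (intro bexI[of _ W]) simp_all
qed

interpretation congruences: closure_system "carrier L \<times> carrier L" "{\<theta>. frame_congruence L \<theta>}"
  by (rule congruences_closure_system)

lemma congruence_frame_simps:
  "carrier (congruence_frame L) = {\<theta>. frame_congruence L \<theta>}" "le (congruence_frame L) = (\<subseteq>)"
  "eq (congruence_frame L) = (=)"
  by (simp_all add: congruence_frame_def)

lemma frame_congruence_frame: "frame (congruence_frame L)"
  unfolding congruence_frame_def by (rule congruences.frame_closed_sets)

interpretation CL: frame "congruence_frame L"
  by (rule frame_congruence_frame)

lemma congruence_meet:
  "\<lbrakk>frame_congruence L \<theta>; frame_congruence L \<psi>\<rbrakk> \<Longrightarrow> \<theta> \<sqinter>\<^bsub>congruence_frame L\<^esub> \<psi> = \<theta> \<inter> \<psi>"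
  unfolding congruence_frame_def by (rule congruences.meet_eq) auto

lemma congruence_top: "\<top>\<^bsub>congruence_frame L\<^esub> = carrier L \<times> carrier L"
  unfolding congruence_frame_def by (rule congruences.top_eq)

lemma congruence_Int:
  "\<lbrakk>frame_congruence L \<theta>; frame_congruence L \<psi>\<rbrakk> \<Longrightarrow> frame_congruence L (\<theta> \<inter> \<psi>)"
  using congruences.Int_closed by simp

text \<open>Joining \<open>(\<bottom>, a)\<close> with \<open>(x, x)\<close> gives \<open>(x, a \<squnion> x)\<close>, so that one pair generates \<open>\<nabla>\<^sub>a\<close>.  The behaviour
  of \<open>\<nabla>\<close> on joins and order reduces to this.\<close>

lemma nabla_subset_iff:
  assumes a: "a \<in> carrier L" and \<chi>: "frame_congruence L \<chi>"
  shows "nabla L a \<subseteq> \<chi> \<longleftrightarrow> (\<bottom>, a) \<in> \<chi>"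
proof
  note D = frame_congruenceD[OF \<chi>]
  have "(\<bottom>, a) \<in> nabla L a"
    using a by (simp add: nabla_def join_comm[of L a \<bottom>] bottom_join join_absorb[THEN iffD1, OF _ _ le_refl])
  then show "nabla L a \<subseteq> \<chi> \<Longrightarrow> (\<bottom>, a) \<in> \<chi>" by auto
  assume m: "(\<bottom>, a) \<in> \<chi>"
  have 1: "(x, a \<squnion> x) \<in> \<chi>" if "x \<in> carrier L" for x
    using D(7)[OF m D(2)[OF that]] that by (simp add: bottom_join)
  show "nabla L a \<subseteq> \<chi>"
  proof (rule subrelI)
    fix x y assume "(x, y) \<in> nabla L a"
    then have "x \<in> carrier L" "y \<in> carrier L" "a \<squnion> x = a \<squnion> y" by (auto simp: nabla_def)
    then show "(x, y) \<in> \<chi>" using 1 D(3,4) by metis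
  qed
qed

text \<open>If \<open>(x, y) \<in> \<nabla>\<^sub>a \<inter> \<Delta>\<^sub>s\<close> and \<open>z = x \<squnion> y\<close>, then \<open>x = x \<squnion> (s \<sqinter> z)\<close> and
  \<open>z = x \<squnion> ((s \<squnion> a) \<sqinter> z)\<close>, so \<open>(x, z)\<close> is obtained from \<open>(s, s \<squnion> a)\<close> by a meet and a join, and likewise
  \<open>(y, z)\<close>.  Hence that one pair generates the congruence.\<close>

lemma nabla_delta_subset_iff:
  assumes a: "a \<in> carrier L" and s: "s \<in> carrier L" and \<chi>: "frame_congruence L \<chi>"
  shows "nabla L a \<inter> delta L s \<subseteq> \<chi> \<longleftrightarrow> (s, s \<squnion> a) \<in> \<chi>"
proof
  note D = frame_congruenceD[OF \<chi>]
  have "a \<squnion> s = a \<squnion> (s \<squnion> a)" using a s by (intro eqI_above) (auto simp: join_le_iff)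
  moreover have "s \<sqinter> s = s \<sqinter> (s \<squnion> a)" using a s by (metis join_closed join_left le_refl meet_absorb)
  ultimately have "(s, s \<squnion> a) \<in> nabla L a \<inter> delta L s" using a s by (simp add: nabla_def delta_def)
  then show "nabla L a \<inter> delta L s \<subseteq> \<chi> \<Longrightarrow> (s, s \<squnion> a) \<in> \<chi>" by blast
  assume m: "(s, s \<squnion> a) \<in> \<chi>"
  have half: "(x, x \<squnion> y) \<in> \<chi>"
    if xy: "x \<in> carrier L" "y \<in> carrier L" and 1: "a \<squnion> x = a \<squnion> y" "s \<sqinter> x = s \<sqinter> y" for x y
  proof -
    define z where "z = x \<squnion> y"
    have z: "z \<in> carrier L" using xy by (simp add: z_def)
    have "(x \<squnion> (s \<sqinter> z), x \<squnion> ((s \<squnion> a) \<sqinter> z)) \<in> \<chi>" by (intro D(7) D(5) D(2) m z xy)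
    moreover have "x \<squnion> (s \<sqinter> z) = x"
    proof -
      have "s \<sqinter> z = (s \<sqinter> x) \<squnion> (s \<sqinter> x)" using xy s 1 by (simp add: z_def meet_join_distrib)
      also have "\<dots> = s \<sqinter> x" using xy s by (metis join_absorb le_refl meet_closed)
      finally show ?thesis using xy s by (metis join_absorb join_comm meet_closed meet_right)
    qed
    moreover have "x \<squnion> ((s \<squnion> a) \<sqinter> z) = z"
    proof (rule le_antisym)
      have "y \<sqsubseteq> a \<squnion> x" using 1 xy a join_right by metis
      moreover have "a \<squnion> x \<sqsubseteq> x \<squnion> (s \<squnion> a)"
        using xy a s by (simp add: join_le_iff join_left le_trans[OF join_right join_right])
      ultimately have "z \<sqsubseteq> x \<squnion> (s \<squnion> a)"
        using xy a s le_trans[of y "a \<squnion> x" "x \<squnion> (s \<squnion> a)"]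
        by (simp add: z_def join_le_iff join_left)
      then have "z \<sqsubseteq> (x \<squnion> (s \<squnion> a)) \<sqinter> (x \<squnion> z)"
        using xy a s z by (simp add: le_meet_iff join_right)
      then show "z \<sqsubseteq> x \<squnion> ((s \<squnion> a) \<sqinter> z)" using xy a s z by (simp add: join_meet_distrib)
      show "x \<squnion> ((s \<squnion> a) \<sqinter> z) \<sqsubseteq> z"
        using xy a s z by (simp add: join_le_iff meet_right) (simp add: z_def join_left)
    qed (use xy a s z in auto)
    ultimately show ?thesis by (simp add: z_def)
  qed
  show "nabla L a \<inter> delta L s \<subseteq> \<chi>"
  proof (rule subrelI)
    fix x y assume "(x, y) \<in> nabla L a \<inter> delta L s"
    then have xy: "x \<in> carrier L" "y \<in> carrier L" "a \<squnion> x = a \<squnion> y" "s \<sqinter> x = s \<sqinter> y"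
      by (auto simp: nabla_def delta_def)
    have "(x, x \<squnion> y) \<in> \<chi>" by (rule half[OF xy])
    moreover have "(y, y \<squnion> x) \<in> \<chi>" using half[OF xy(2,1)] xy(3,4) by simp
    ultimately show "(x, y) \<in> \<chi>" using D(3,4) by (metis join_comm)
  qed
qed

lemma nabla_mono_iff:
  assumes "a \<in> carrier L" "b \<in> carrier L"
  shows "nabla L a \<subseteq> nabla L b \<longleftrightarrow> a \<sqsubseteq> b"
proof -
  have "(\<bottom>, a) \<in> nabla L b \<longleftrightarrow> b = a \<squnion> b"
    using assms by (simp add: nabla_def join_comm[of L b] bottom_join)
  then show ?thesis using assms nabla_subset_iff nabla_congruence join_absorb by metis
qed

lemma nabla_Int:
  assumes "a \<in> carrier L" "b \<in> carrier L"
  shows "nabla L a \<inter> nabla L b = nabla L (a \<sqinter> b)"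
proof
  show "nabla L (a \<sqinter> b) \<subseteq> nabla L a \<inter> nabla L b"
    using assms by (simp add: nabla_mono_iff meet_left meet_right)
  show "nabla L a \<inter> nabla L b \<subseteq> nabla L (a \<sqinter> b)"
    using assms by (auto simp: nabla_def join_comm[of L "a \<sqinter> b"] join_meet_distrib)
      (simp add: join_comm[of L a] join_comm[of L b])
qed

lemma delta_Int:
  assumes "a \<in> carrier L" "b \<in> carrier L"
  shows "delta L a \<inter> delta L b = delta L (a \<squnion> b)"
proof
  have dist: "(a \<squnion> b) \<sqinter> x = (a \<sqinter> x) \<squnion> (b \<sqinter> x)" if "x \<in> carrier L" for x
    using assms that meet_join_distrib[of x a b] by (simp add: meet_comm[of L x])
  show "delta L a \<inter> delta L b \<subseteq> delta L (a \<squnion> b)"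
    using assms by (auto simp: delta_def dist)
  have absorb: "a \<sqinter> x = a \<sqinter> ((a \<squnion> b) \<sqinter> x)" "b \<sqinter> x = b \<sqinter> ((a \<squnion> b) \<sqinter> x)" if "x \<in> carrier L" for x
  proof -
    have "a \<sqinter> x \<sqsubseteq> a \<squnion> b" "b \<sqinter> x \<sqsubseteq> a \<squnion> b"
      using assms that by (simp_all add: le_trans[OF meet_left join_left] le_trans[OF meet_left join_right])
    then show "a \<sqinter> x = a \<sqinter> ((a \<squnion> b) \<sqinter> x)" "b \<sqinter> x = b \<sqinter> ((a \<squnion> b) \<sqinter> x)"
      using assms that
      by (auto intro!: le_antisym simp: le_meet_iff meet_left meet_right le_trans[OF meet_right meet_right])
  qed
  show "delta L (a \<squnion> b) \<subseteq> delta L a \<inter> delta L b"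
  proof (rule subrelI)
    fix x y assume "(x, y) \<in> delta L (a \<squnion> b)"
    then have xy: "x \<in> carrier L" "y \<in> carrier L" "(a \<squnion> b) \<sqinter> x = (a \<squnion> b) \<sqinter> y"
      by (auto simp: delta_def)
    have "a \<sqinter> x = a \<sqinter> y" "b \<sqinter> x = b \<sqinter> y"
      unfolding absorb[OF xy(1)] absorb[OF xy(2)] xy(3) by simp_all
    then show "(x, y) \<in> delta L a \<inter> delta L b" using xy by (simp add: delta_def)
  qed
qed

lemma nabla_top: "nabla L \<top> = carrier L \<times> carrier L"
  by (auto simp: nabla_def top_join)

lemma delta_bottom: "delta L \<bottom> = carrier L \<times> carrier L"
  by (auto simp: delta_def bottom_meet)

lemma nabla_sup:
  assumes X: "X \<subseteq> carrier L"
  shows "\<Squnion>\<^bsub>congruence_frame L\<^esub> (nabla L ` X) = nabla L (\<Squnion>X)"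
proof (rule CL.eqI_above)
  have sub: "nabla L ` X \<subseteq> carrier (congruence_frame L)"
    using X nabla_congruence by (auto simp: congruence_frame_simps)
  then show "\<Squnion>\<^bsub>congruence_frame L\<^esub> (nabla L ` X) \<in> carrier (congruence_frame L)" by simp
  show "nabla L (\<Squnion>X) \<in> carrier (congruence_frame L)"
    using X nabla_congruence by (simp add: congruence_frame_simps)
  fix Z assume Z: "Z \<in> carrier (congruence_frame L)"
  then have Zc: "frame_congruence L Z" by (simp add: congruence_frame_simps)
  note D = frame_congruenceD[OF Zc]
  have "(\<forall>x\<in>X. (\<bottom>, x) \<in> Z) \<longleftrightarrow> (\<bottom>, \<Squnion>X) \<in> Z"
  proof
    assume "\<forall>x\<in>X. (\<bottom>, x) \<in> Z"
    then have "Pair \<bottom> ` X \<subseteq> Z" by auto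
    from D(6)[OF this] have "(\<Squnion>((\<lambda>x. \<bottom>) ` X), \<Squnion>X) \<in> Z" by (simp add: image_image)
    moreover have "\<Squnion>((\<lambda>x. \<bottom>) ` X) = \<bottom>" by (cases "X = {}") (auto simp: sup_empty image_constant_conv)
    ultimately show "(\<bottom>, \<Squnion>X) \<in> Z" by simp
  next
    assume m: "(\<bottom>, \<Squnion>X) \<in> Z"
    show "\<forall>x\<in>X. (\<bottom>, x) \<in> Z"
    proof
      fix x assume x: "x \<in> X"
      then have xc: "x \<in> carrier L" using X by auto
      have "x \<sqinter> \<Squnion>X = x" using meet_absorb[of x "\<Squnion>X"] x X xc by (simp add: sup_upper)
      then show "(\<bottom>, x) \<in> Z"
        using D(5)[OF m D(2)[OF xc]] xc by (simp add: bottom_meet meet_comm[of L "\<Squnion>X"])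
    qed
  qed
  then show "le (congruence_frame L) (\<Squnion>\<^bsub>congruence_frame L\<^esub> (nabla L ` X)) Z
    \<longleftrightarrow> le (congruence_frame L) (nabla L (\<Squnion>X)) Z"
    unfolding CL.sup_le_iff[OF sub Z] using X nabla_subset_iff[OF _ Zc]
    by (simp add: congruence_frame_simps subset_iff[of X])
qed

lemma nabla_delta_complements: "a \<in> carrier L \<Longrightarrow> complements (congruence_frame L) (nabla L a) (delta L a)"
proof -
  assume a: "a \<in> carrier L"
  have c: "nabla L a \<in> carrier (congruence_frame L)" "delta L a \<in> carrier (congruence_frame L)"
    using a nabla_congruence delta_congruence by (auto simp: congruence_frame_simps)
  have bot: "frame_congruence L \<bottom>\<^bsub>congruence_frame L\<^esub>"
    using CL.bottom_closed unfolding congruence_frame_simps by simp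
  have "nabla L a \<inter> delta L a \<subseteq> \<bottom>\<^bsub>congruence_frame L\<^esub>"
    using a frame_congruenceD(2)[OF bot a] join_absorb[of a a] le_refl
    by (simp add: nabla_delta_subset_iff[OF _ _ bot])
  then have "le (congruence_frame L) (nabla L a \<sqinter>\<^bsub>congruence_frame L\<^esub> delta L a) \<bottom>\<^bsub>congruence_frame L\<^esub>"
    using a by (simp add: congruence_meet nabla_congruence delta_congruence congruence_frame_simps)
  then have 1: "nabla L a \<sqinter>\<^bsub>congruence_frame L\<^esub> delta L a = \<bottom>\<^bsub>congruence_frame L\<^esub>"
    using c by (simp add: CL.le_bottom_iff)
  define Z where "Z = nabla L a \<squnion>\<^bsub>congruence_frame L\<^esub> delta L a"
  have Z: "Z \<in> carrier (congruence_frame L)" "frame_congruence L Z"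
    using c CL.join_closed[OF c] by (simp_all add: Z_def congruence_frame_simps)
  have "nabla L a \<subseteq> Z" "delta L a \<subseteq> Z"
    using CL.join_left[OF c] CL.join_right[OF c] by (simp_all add: Z_def congruence_frame_simps)
  moreover have "(\<bottom>, a) \<in> nabla L a" "(a, \<top>) \<in> delta L a"
    using a meet_absorb[of a a] join_absorb[of a a] le_refl[of a]
    by (simp_all add: nabla_def delta_def join_comm[of L a \<bottom>] bottom_join meet_comm[of L a \<top>] top_meet)
  ultimately have "(\<bottom>, \<top>) \<in> Z" using frame_congruenceD(4)[OF Z(2)] by blast
  then have "carrier L \<times> carrier L \<subseteq> Z"
    using nabla_subset_iff[OF top_closed Z(2)] by (simp add: nabla_top)
  then have "Z = \<top>\<^bsub>congruence_frame L\<^esub>"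
    using frame_congruenceD(1)[OF Z(2)] by (simp add: congruence_top)
  then show ?thesis using 1 by (simp add: complements_def Z_def)
qed

end

section \<open>The frame \<open>\<C>\<^sub>SL\<close> and its universal property\<close>

context frith
begin

sublocale CL: frame "congruence_frame A"
  by (rule frame_congruence_frame)

text \<open>Both indices of a cell range over the base.  The elements of \<open>L\<close> are joins of base elements, so
  these cells already generate \<open>\<C>\<^sub>SL\<close> under joins; and they also lie in the base of the symmetrization.\<close>

definition base_cells :: "('a \<times> 'a) set set" where
  "base_cells = {nabla A s \<inter> delta A t |s t. s \<in> base A \<and> t \<in> base A}"

lemma base_cellI: "\<lbrakk>s \<in> base A; t \<in> base A\<rbrakk> \<Longrightarrow> nabla A s \<inter> delta A t \<in> base_cells"
  by (auto simp: base_cells_def)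

lemma cell_congruence:
  "\<lbrakk>a \<in> carrier A; s \<in> carrier A\<rbrakk> \<Longrightarrow> frame_congruence A (nabla A a \<inter> delta A s)"
  by (simp add: congruence_Int nabla_congruence delta_congruence)

lemma base_cells_sub: "base_cells \<subseteq> carrier (congruence_frame A)"
  using base_carrier cell_congruence by (auto simp: base_cells_def congruence_frame_simps)

lemma nabla_cell: "a \<in> carrier A \<Longrightarrow> nabla A a = nabla A a \<inter> delta A \<bottom>"
  by (auto simp: delta_bottom nabla_def)

lemma delta_cell: "a \<in> carrier A \<Longrightarrow> delta A a = nabla A \<top> \<inter> delta A a"
  by (auto simp: nabla_top delta_def)

lemma nabla_base_cells: "s \<in> base A \<Longrightarrow> nabla A s \<in> base_cells"
  using base_cellI[OF _ base_closed(1)] nabla_cell[OF base_carrier] by metis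

lemma delta_base_cells: "s \<in> base A \<Longrightarrow> delta A s \<in> base_cells"
  using base_cellI[OF base_closed(2)] delta_cell[OF base_carrier] by metis

lemma top_base_cells: "\<top>\<^bsub>congruence_frame A\<^esub> \<in> base_cells"
  using delta_base_cells[OF base_closed(1)] by (simp add: congruence_top delta_bottom)

lemma base_cells_meet:
  assumes "\<theta> \<in> base_cells" "\<psi> \<in> base_cells"
  shows "\<theta> \<sqinter>\<^bsub>congruence_frame A\<^esub> \<psi> \<in> base_cells"
proof -
  obtain s t s' t' where st: "s \<in> base A" "t \<in> base A" "\<theta> = nabla A s \<inter> delta A t"
    "s' \<in> base A" "t' \<in> base A" "\<psi> = nabla A s' \<inter> delta A t'"
    using assms by (auto simp: base_cells_def)
  have c: "s \<in> carrier A" "t \<in> carrier A" "s' \<in> carrier A" "t' \<in> carrier A"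
    using st base_carrier by auto
  have "\<theta> \<sqinter>\<^bsub>congruence_frame A\<^esub> \<psi> = \<theta> \<inter> \<psi>"
    using st c by (simp add: congruence_meet cell_congruence)
  also have "\<dots> = (nabla A s \<inter> nabla A s') \<inter> (delta A t \<inter> delta A t')" using st by auto
  also have "\<dots> = nabla A (s \<sqinter> s') \<inter> delta A (t \<squnion> t')" using c by (simp add: nabla_Int delta_Int)
  finally show ?thesis using st base_closed(3,4) base_cellI by simp
qed

lemma delta_subframe_eq_joins: "delta_subframe A = joins (congruence_frame A) (delta A ` base A)"
  unfolding delta_subframe_def
proof (rule CL.subframe_gen_eq_joins)
  show "delta A ` base A \<subseteq> carrier (congruence_frame A)"
    using delta_congruence base_carrier by (auto simp: congruence_frame_simps)
  show "\<top>\<^bsub>congruence_frame A\<^esub> \<in> delta A ` base A"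
    using base_closed(1) by (auto simp: congruence_top delta_bottom[symmetric])
  show "\<theta> \<sqinter>\<^bsub>congruence_frame A\<^esub> \<psi> \<in> delta A ` base A"
    if "\<theta> \<in> delta A ` base A" "\<psi> \<in> delta A ` base A" for \<theta> \<psi>
    using that base_closed(4) base_carrier
    by (auto simp: congruence_meet delta_congruence delta_Int)
qed

lemma delta_base_sub: "delta A ` base A \<subseteq> carrier (congruence_frame A)"
  using base_cells_sub delta_base_cells by auto

lemma nabla_carrier_sub: "nabla A ` carrier A \<subseteq> carrier (congruence_frame A)"
  using nabla_congruence by (auto simp: congruence_frame_simps)

lemma nabla_sup_base:
  "a \<in> carrier A \<Longrightarrow> nabla A a = \<Squnion>\<^bsub>congruence_frame A\<^esub> (nabla A ` {s \<in> base A. s \<sqsubseteq> a})"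
  using nabla_sup[of "{s \<in> base A. s \<sqsubseteq> a}"] sup_base base_sub by auto

text \<open>The cells are closed under finite meets, since
  \<open>(\<nabla> s \<inter> \<Delta> t) \<inter> (\<nabla> s' \<inter> \<Delta> t') = \<nabla> (s \<sqinter> s') \<inter> \<Delta> (t \<squnion> t')\<close>; so their joins are a subframe.\<close>

lemma carrier_CS: "carrier (CS A) = joins (congruence_frame A) base_cells"
proof -
  let ?J = "joins (congruence_frame A) base_cells"
  let ?G = "nabla A ` carrier A \<union> delta_subframe A"
  have sub: "subframe (congruence_frame A) ?J"
    by (rule CL.joins_subframe[OF base_cells_sub top_base_cells base_cells_meet])
  have "nabla A a \<in> ?J" if "a \<in> carrier A" for a
    unfolding nabla_sup_base[OF that] using nabla_base_cells by (intro joinsI) auto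
  moreover have "delta_subframe A \<subseteq> ?J"
    unfolding delta_subframe_eq_joins using delta_base_cells by (intro joins_mono) auto
  ultimately have "subframe_gen (congruence_frame A) ?G \<subseteq> ?J"
    by (intro subframe_gen_minimal[OF sub]) auto
  moreover have "?J \<subseteq> subframe_gen (congruence_frame A) ?G"
  proof (rule joins_subset_subframe)
    have GC: "?G \<subseteq> carrier (congruence_frame A)"
      using nabla_carrier_sub CL.joins_closed[OF delta_base_sub]
      by (simp add: delta_subframe_eq_joins)
    then show S: "subframe (congruence_frame A) (subframe_gen (congruence_frame A) ?G)"
      by (rule CL.subframe_gen_subframe)
    show "base_cells \<subseteq> subframe_gen (congruence_frame A) ?G"
    proof
      fix \<theta> assume "\<theta> \<in> base_cells"
      then obtain s t where st: "s \<in> base A" "t \<in> base A" "\<theta> = nabla A s \<inter> delta A t"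
        by (auto simp: base_cells_def)
      have "delta A t \<in> delta_subframe A"
        using st CL.joins_superset[OF delta_base_sub] by (auto simp: delta_subframe_eq_joins)
      then have "nabla A s \<in> subframe_gen (congruence_frame A) ?G"
        "delta A t \<in> subframe_gen (congruence_frame A) ?G"
        using st base_carrier subframe_gen_superset[of ?G] by auto
      then have "nabla A s \<sqinter>\<^bsub>congruence_frame A\<^esub> delta A t \<in> subframe_gen (congruence_frame A) ?G"
        using S by (simp add: subframe_def)
      then show "\<theta> \<in> subframe_gen (congruence_frame A) ?G"
        using st base_carrier by (simp add: congruence_meet nabla_congruence delta_congruence)
    qed
  qed
  ultimately show ?thesis by (simp add: CS_def)
qed

sublocale CSR: frame_restriction "congruence_frame A" "CS A"
proof
  show "subframe (congruence_frame A) (carrier (CS A))"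
    unfolding carrier_CS
    by (rule CL.joins_subframe[OF base_cells_sub top_base_cells base_cells_meet])
qed (simp_all add: CS_def)

sublocale CS: frame "CS A"
  by (rule CSR.frame_M)

lemma base_cells_CS: "base_cells \<subseteq> carrier (CS A)"
  unfolding carrier_CS by (rule CL.joins_superset[OF base_cells_sub])

lemma CS_joins: "carrier (CS A) = joins (CS A) base_cells"
  using CSR.joins_M[OF base_cells_CS] carrier_CS by simp

lemma CS_le: "le (CS A) = (\<subseteq>)"
  by (simp add: CS_def congruence_frame_simps)

lemma CS_congruence: "\<theta> \<in> carrier (CS A) \<Longrightarrow> frame_congruence A \<theta>"
  using CSR.carrier_subset by (auto simp: congruence_frame_simps)

lemma nabla_CS: "a \<in> carrier A \<Longrightarrow> nabla A a \<in> carrier (CS A)"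
  unfolding carrier_CS
  by (subst nabla_sup_base) (use nabla_base_cells in \<open>auto intro!: joinsI\<close>)

lemma delta_CS: "s \<in> base A \<Longrightarrow> delta A s \<in> carrier (CS A)"
  using delta_base_cells base_cells_CS by auto

lemma delta_subframe_CS: "delta_subframe A \<subseteq> carrier (CS A)"
  unfolding delta_subframe_eq_joins carrier_CS using delta_base_cells by (intro joins_mono) auto

lemma CS_meet: "\<lbrakk>\<theta> \<in> carrier (CS A); \<psi> \<in> carrier (CS A)\<rbrakk> \<Longrightarrow> \<theta> \<sqinter>\<^bsub>CS A\<^esub> \<psi> = \<theta> \<inter> \<psi>"
  by (simp add: CSR.meet_M congruence_meet CS_congruence)

lemma CS_complements: "s \<in> base A \<Longrightarrow> complements (CS A) (nabla A s) (delta A s)"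
  using nabla_delta_complements by (simp add: CSR.complements_M nabla_CS delta_CS base_carrier)

lemma unit_map_hom: "unit_map A \<in> frame_hom A (CS A)"
  unfolding frame_hom_def
proof (intro CollectI conjI ballI allI impI)
  show "unit_map A \<in> carrier A \<rightarrow>\<^sub>E carrier (CS A)" using nabla_CS by (auto simp: unit_map_def)
  show "unit_map A \<top> = \<top>\<^bsub>CS A\<^esub>"
    by (simp add: unit_map_def CSR.top_M congruence_top nabla_top)
  show "unit_map A (x \<sqinter> y) = unit_map A x \<sqinter>\<^bsub>CS A\<^esub> unit_map A y" if "x \<in> carrier A" "y \<in> carrier A" for x y
    using that by (simp add: unit_map_def CS_meet nabla_CS nabla_Int)
  show "unit_map A (\<Squnion>X) = \<Squnion>\<^bsub>CS A\<^esub> (unit_map A ` X)" if "X \<subseteq> carrier A" for X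
  proof -
    have "unit_map A ` X = nabla A ` X" using that by (intro image_cong) (auto simp: unit_map_def)
    moreover have "nabla A ` X \<subseteq> carrier (CS A)" using that nabla_CS by auto
    ultimately show ?thesis using that by (simp add: unit_map_def CSR.sup_M nabla_sup)
  qed
qed

text \<open>The equalizer of two homomorphisms is a subframe.  For \<open>s\<close> in the base it contains \<open>\<Delta>\<^sub>s\<close> along with \<open>\<nabla>\<^sub>s\<close>,
  because complements are preserved and unique.\<close>

lemma CS_hom_unique:
  assumes M: "frame M" and g: "g \<in> frame_hom (CS A) M" and g': "g' \<in> frame_hom (CS A) M"
    and eq: "\<And>a. a \<in> carrier A \<Longrightarrow> g (nabla A a) = g' (nabla A a)"
  shows "g = g'"
proof -
  interpret g: frame_morphism "CS A" M g
    using M g CS.frame_axioms by (simp add: frame_morphism_def frame_morphism_axioms_def)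
  interpret g': frame_morphism "CS A" M g'
    using M g' CS.frame_axioms by (simp add: frame_morphism_def frame_morphism_axioms_def)
  let ?E = "{\<theta> \<in> carrier (CS A). g \<theta> = g' \<theta>}"
  have E: "subframe (CS A) ?E" by (rule g.equalizer_subframe[OF g'.frame_morphism_axioms])
  have d: "delta A s \<in> ?E" if s: "s \<in> base A" for s
  proof -
    have c: "nabla A s \<in> carrier (CS A)" "delta A s \<in> carrier (CS A)" "s \<in> carrier A"
      using s nabla_CS delta_CS base_carrier by auto
    have "g (delta A s) = g' (delta A s)"
      using g.M.complement_unique[OF g.map_complements[OF CS_complements[OF s]]]
        g'.map_complements[OF CS_complements[OF s]] eq c by simp
    then show ?thesis using c by simp
  qed
  have "base_cells \<subseteq> ?E"
  proof
    fix \<theta> assume "\<theta> \<in> base_cells"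
    then obtain s t where st: "s \<in> base A" "t \<in> base A" "\<theta> = nabla A s \<inter> delta A t"
      by (auto simp: base_cells_def)
    have "nabla A s \<in> ?E" using st eq nabla_CS base_carrier by simp
    then have "nabla A s \<sqinter>\<^bsub>CS A\<^esub> delta A t \<in> ?E" using E d[OF st(2)] by (simp add: subframe_def)
    then show "\<theta> \<in> ?E" using st nabla_CS delta_CS base_carrier by (simp add: CS_meet)
  qed
  then have "joins (CS A) base_cells \<subseteq> ?E" by (rule joins_subset_subframe[OF E])
  then have "carrier (CS A) \<subseteq> ?E" using CS_joins by simp
  then have "g \<theta> = g' \<theta>" if "\<theta> \<in> carrier (CS A)" for \<theta> using that by auto
  then show ?thesis using extensionalityI[OF g.extensional g'.extensional] by blast
qed

text \<open>Let \<open>\<rho> m\<close> be the kernel of \<open>x \<mapsto> m \<squnion> h x\<close>.  The extension \<open>g\<close> of \<open>h\<close> is the left adjoint of \<open>\<rho>\<close>: both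
  \<open>g \<theta> \<sqsubseteq> m\<close> and \<open>\<theta> \<subseteq> \<rho> m\<close> say that, for every cell \<open>\<nabla>\<^sub>s \<inter> \<Delta>\<^sub>t\<close> contained in \<open>\<theta>\<close>, the meet of \<open>h s\<close> with
  the complement of \<open>h t\<close> lies below \<open>m\<close>.  Preservation of joins and the values at \<open>\<nabla>\<^sub>a\<close> follow from
  the adjunction; preservation of binary meets is read off from the defining join.\<close>

lemma CS_hom_exists:
  fixes M :: "('m, 'y) gorder_scheme"
  assumes M: "frame M" and h: "h \<in> frame_hom A M"
    and compl: "\<And>s. s \<in> base A \<Longrightarrow> \<exists>c\<in>carrier M. complements M (h s) c"
  shows "\<exists>g\<in>frame_hom (CS A) M. \<forall>a\<in>carrier A. g (nabla A a) = h a"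
proof -
  interpret h: frame_morphism A M h
    using M h frame_axioms by (simp add: frame_morphism_def frame_morphism_axioms_def)
  define \<rho> where "\<rho> m = {(x, y). x \<in> carrier A \<and> y \<in> carrier A \<and> m \<squnion>\<^bsub>M\<^esub> h x = m \<squnion>\<^bsub>M\<^esub> h y}" for m
  have rho: "frame_congruence A (\<rho> m)" if "m \<in> carrier M" for m
    unfolding \<rho>_def
  proof (rule kernel_congruence[OF M])
    fix X assume X: "X \<subseteq> carrier A" "X \<noteq> {}"
    have "m \<squnion>\<^bsub>M\<^esub> h (\<Squnion>X) = \<Squnion>\<^bsub>M\<^esub> ((\<lambda>y. m \<squnion>\<^bsub>M\<^esub> y) ` h ` X)"
      using X that h.image_closed by (simp add: h.map_sup h.M.join_sup)
    then show "m \<squnion>\<^bsub>M\<^esub> h (\<Squnion>X) = \<Squnion>\<^bsub>M\<^esub> ((\<lambda>x. m \<squnion>\<^bsub>M\<^esub> h x) ` X)" by (simp add: image_image)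
  qed (use that in \<open>auto simp: h.map_meet h.M.join_meet_distrib\<close>)
  \<comment> \<open>Letting \<open>c\<close> range over all complements of \<open>h t\<close>, of which there is just one, avoids a choice.\<close>
  define P where "P \<theta> = {h s \<sqinter>\<^bsub>M\<^esub> c |s t c. s \<in> base A \<and> t \<in> base A \<and> c \<in> carrier M \<and>
    complements M (h t) c \<and> nabla A s \<inter> delta A t \<subseteq> \<theta>}" for \<theta>
  have PM: "P \<theta> \<subseteq> carrier M" for \<theta> using base_carrier by (auto simp: P_def)
  have cell: "h s \<sqinter>\<^bsub>M\<^esub> c \<sqsubseteq>\<^bsub>M\<^esub> m \<longleftrightarrow> nabla A s \<inter> delta A t \<subseteq> \<rho> m"
    if st: "s \<in> carrier A" "t \<in> carrier A" and c: "c \<in> carrier M" "complements M (h t) c" and m: "m \<in> carrier M" for s t c m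
  proof -
    have "(t, t \<squnion> s) \<in> \<rho> m \<longleftrightarrow> m \<squnion>\<^bsub>M\<^esub> h t = h s \<squnion>\<^bsub>M\<^esub> (m \<squnion>\<^bsub>M\<^esub> h t)"
      using st m by (simp add: \<rho>_def h.map_join h.M.join_assoc[symmetric] join_comm[of M "h s"])
    also have "\<dots> \<longleftrightarrow> h s \<sqsubseteq>\<^bsub>M\<^esub> h t \<squnion>\<^bsub>M\<^esub> m"
      using st m h.M.join_absorb[of "h s" "m \<squnion>\<^bsub>M\<^esub> h t"] by (auto simp: join_comm[of M m])
    finally show ?thesis
      using st c m h.M.complement_shunt[of "h t" c "h s" m] nabla_delta_subset_iff[OF st rho[OF m]] by simp
  qed
  have adj: "\<Squnion>\<^bsub>M\<^esub> (P \<theta>) \<sqsubseteq>\<^bsub>M\<^esub> m \<longleftrightarrow> \<theta> \<subseteq> \<rho> m" if \<theta>: "\<theta> \<in> carrier (CS A)" and m: "m \<in> carrier M" for \<theta> m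
  proof
    assume le: "\<Squnion>\<^bsub>M\<^esub> (P \<theta>) \<sqsubseteq>\<^bsub>M\<^esub> m"
    have "\<kappa> \<subseteq> \<rho> m" if \<kappa>: "\<kappa> \<in> {\<kappa> \<in> base_cells. \<kappa> \<subseteq> \<theta>}" for \<kappa>
    proof -
      obtain s t where st: "s \<in> base A" "t \<in> base A" "\<kappa> = nabla A s \<inter> delta A t"
        using \<kappa> by (auto simp: base_cells_def)
      obtain c where c: "c \<in> carrier M" "complements M (h t) c" using compl st by blast
      have "h s \<sqinter>\<^bsub>M\<^esub> c \<in> P \<theta>" using st c \<kappa> by (auto simp: P_def)
      then have "h s \<sqinter>\<^bsub>M\<^esub> c \<sqsubseteq>\<^bsub>M\<^esub> m" using le m h.M.sup_le_iff[OF PM m] by blast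
      then show ?thesis using cell[OF _ _ c m] st base_carrier by simp
    qed
    moreover have "{\<kappa> \<in> base_cells. \<kappa> \<subseteq> \<theta>} \<subseteq> carrier (congruence_frame A)" using base_cells_sub by auto
    ultimately have "\<Squnion>\<^bsub>congruence_frame A\<^esub> {\<kappa> \<in> base_cells. \<kappa> \<subseteq> \<theta>} \<subseteq> \<rho> m"
      using CL.sup_least[of "{\<kappa> \<in> base_cells. \<kappa> \<subseteq> \<theta>}" "\<rho> m"] rho[OF m] by (simp add: congruence_frame_simps)
    moreover have "\<theta> = \<Squnion>\<^bsub>congruence_frame A\<^esub> {\<kappa> \<in> base_cells. \<kappa> \<subseteq> \<theta>}"
      using CL.joins_canonical[OF base_cells_sub] \<theta> by (simp add: carrier_CS congruence_frame_simps)
    ultimately show "\<theta> \<subseteq> \<rho> m" by simp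
  next
    assume sub: "\<theta> \<subseteq> \<rho> m"
    have "p \<sqsubseteq>\<^bsub>M\<^esub> m" if "p \<in> P \<theta>" for p
    proof -
      obtain s t c where p: "p = h s \<sqinter>\<^bsub>M\<^esub> c" "s \<in> base A" "t \<in> base A" "c \<in> carrier M"
        "complements M (h t) c" "nabla A s \<inter> delta A t \<subseteq> \<theta>"
        using \<open>p \<in> P \<theta>\<close> by (auto simp: P_def)
      then show ?thesis using cell[OF _ _ p(4,5) m, of s] base_carrier sub by (simp add: subset_trans)
    qed
    then show "\<Squnion>\<^bsub>M\<^esub> (P \<theta>) \<sqsubseteq>\<^bsub>M\<^esub> m" using PM m by (simp add: h.M.sup_le_iff)
  qed
  define g where "g = (\<lambda>\<theta>\<in>carrier (CS A). \<Squnion>\<^bsub>M\<^esub> (P \<theta>))"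
  have gc: "g \<theta> \<in> carrier M" if "\<theta> \<in> carrier (CS A)" for \<theta> using that PM by (simp add: g_def)
  have g_adj: "g \<theta> \<sqsubseteq>\<^bsub>M\<^esub> m \<longleftrightarrow> \<theta> \<subseteq> \<rho> m" if "\<theta> \<in> carrier (CS A)" "m \<in> carrier M" for \<theta> m
    using adj that by (simp add: g_def)
  have g_nabla: "g (nabla A a) = h a" if a: "a \<in> carrier A" for a
  proof (rule h.M.eqI_above)
    fix m assume m: "m \<in> carrier M"
    have "g (nabla A a) \<sqsubseteq>\<^bsub>M\<^esub> m \<longleftrightarrow> (\<bottom>, a) \<in> \<rho> m"
      using a m by (simp add: g_adj nabla_CS nabla_subset_iff rho)
    also have "\<dots> \<longleftrightarrow> m = h a \<squnion>\<^bsub>M\<^esub> m"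
      using a m by (simp add: \<rho>_def h.map_bottom join_comm[of M m] h.M.bottom_join)
    finally show "g (nabla A a) \<sqsubseteq>\<^bsub>M\<^esub> m \<longleftrightarrow> h a \<sqsubseteq>\<^bsub>M\<^esub> m"
      using h.M.join_absorb[of "h a" m] a m by auto
  qed (use a gc nabla_CS in auto)
  have "g \<in> frame_hom (CS A) M"
    unfolding frame_hom_def
  proof (intro CollectI conjI ballI allI impI)
    show "g \<in> carrier (CS A) \<rightarrow>\<^sub>E carrier M" using gc by (auto simp: g_def)
    have "\<top>\<^bsub>CS A\<^esub> = nabla A \<top>" by (simp add: CSR.top_M congruence_top nabla_top)
    then show "g \<top>\<^bsub>CS A\<^esub> = \<top>\<^bsub>M\<^esub>" by (simp add: g_nabla h.map_top)
    show "g (\<theta> \<sqinter>\<^bsub>CS A\<^esub> \<psi>) = g \<theta> \<sqinter>\<^bsub>M\<^esub> g \<psi>" if \<theta>: "\<theta> \<in> carrier (CS A)" and \<psi>: "\<psi> \<in> carrier (CS A)" for \<theta> \<psi>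
    proof (rule h.M.le_antisym)
      have I: "\<theta> \<inter> \<psi> \<in> carrier (CS A)" using CS.meet_closed[OF \<theta> \<psi>] CS_meet[OF \<theta> \<psi>] by simp
      have "P (\<theta> \<inter> \<psi>) \<subseteq> P \<theta>" "P (\<theta> \<inter> \<psi>) \<subseteq> P \<psi>" by (auto simp: P_def)
      then show "g (\<theta> \<sqinter>\<^bsub>CS A\<^esub> \<psi>) \<sqsubseteq>\<^bsub>M\<^esub> g \<theta> \<sqinter>\<^bsub>M\<^esub> g \<psi>"
        using I \<theta> \<psi> PM by (simp add: g_def CS_meet h.M.le_meet_iff h.M.sup_mono)
      have "{x \<sqinter>\<^bsub>M\<^esub> y |x y. x \<in> P \<theta> \<and> y \<in> P \<psi>} \<subseteq> P (\<theta> \<inter> \<psi>)"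
      proof clarify
        fix x y assume "x \<in> P \<theta>" "y \<in> P \<psi>"
        then obtain s t c s' t' c' where x: "x = h s \<sqinter>\<^bsub>M\<^esub> c" "s \<in> base A" "t \<in> base A" "c \<in> carrier M"
          "complements M (h t) c" "nabla A s \<inter> delta A t \<subseteq> \<theta>"
          and y: "y = h s' \<sqinter>\<^bsub>M\<^esub> c'" "s' \<in> base A" "t' \<in> base A" "c' \<in> carrier M"
          "complements M (h t') c'" "nabla A s' \<inter> delta A t' \<subseteq> \<psi>"
          by (auto simp: P_def)
        have c: "s \<in> carrier A" "t \<in> carrier A" "s' \<in> carrier A" "t' \<in> carrier A"
          using x y base_carrier by auto
        have "x \<sqinter>\<^bsub>M\<^esub> y = h (s \<sqinter> s') \<sqinter>\<^bsub>M\<^esub> (c \<sqinter>\<^bsub>M\<^esub> c')"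
          unfolding x(1) y(1) using c x(4) y(4)
          by (intro h.M.eqI_below) (simp_all add: h.map_meet h.M.le_meet_iff conj_ac)
        moreover have "complements M (h (t \<squnion> t')) (c \<sqinter>\<^bsub>M\<^esub> c')"
          using h.M.complements_join_meet[OF x(5) y(5)] c x(4) y(4) by (simp add: h.map_join)
        moreover have "nabla A (s \<sqinter> s') \<inter> delta A (t \<squnion> t') \<subseteq> \<theta> \<inter> \<psi>"
          using x(6) y(6) c by (auto simp: nabla_Int[symmetric] delta_Int[symmetric])
        ultimately show "x \<sqinter>\<^bsub>M\<^esub> y \<in> P (\<theta> \<inter> \<psi>)"
          unfolding P_def using base_closed(3)[OF x(2) y(2)] base_closed(4)[OF x(3) y(3)]
            h.M.meet_closed[OF x(4) y(4)]
          by (intro CollectI exI[of _ "s \<sqinter> s'"] exI[of _ "t \<squnion> t'"] exI[of _ "c \<sqinter>\<^bsub>M\<^esub> c'"]) simp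
      qed
      then show "g \<theta> \<sqinter>\<^bsub>M\<^esub> g \<psi> \<sqsubseteq>\<^bsub>M\<^esub> g (\<theta> \<sqinter>\<^bsub>CS A\<^esub> \<psi>)"
        using I \<theta> \<psi> PM by (simp add: g_def CS_meet h.M.sup_meet_sup h.M.sup_mono)
    qed (use \<theta> \<psi> gc in auto)
    show "g (\<Squnion>\<^bsub>CS A\<^esub> X) = \<Squnion>\<^bsub>M\<^esub> (g ` X)" if X: "X \<subseteq> carrier (CS A)" for X
    proof (rule h.M.eqI_above)
      have gX: "g ` X \<subseteq> carrier M" using X gc by auto
      then show "\<Squnion>\<^bsub>M\<^esub> (g ` X) \<in> carrier M" by simp
      show "g (\<Squnion>\<^bsub>CS A\<^esub> X) \<in> carrier M" using X gc by simp
      fix m assume m: "m \<in> carrier M"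
      have "\<Squnion>\<^bsub>CS A\<^esub> X \<subseteq> \<rho> m \<longleftrightarrow> (\<forall>\<theta>\<in>X. \<theta> \<subseteq> \<rho> m)"
        using CL.sup_le_iff[OF CSR.subset_carrier[OF X], of "\<rho> m"] rho[OF m]
        by (simp add: CSR.sup_M[OF X] congruence_frame_simps)
      then show "g (\<Squnion>\<^bsub>CS A\<^esub> X) \<sqsubseteq>\<^bsub>M\<^esub> m \<longleftrightarrow> \<Squnion>\<^bsub>M\<^esub> (g ` X) \<sqsubseteq>\<^bsub>M\<^esub> m"
        using X m g_adj by (simp add: h.M.sup_le_iff[OF gX m] subset_iff)
    qed
  qed
  then show ?thesis using g_nabla by blast
qed

lemma CS_extension:
  fixes M :: "('m, 'y) gorder_scheme"
  assumes M: "frame M" and h: "restrict h (carrier A) \<in> frame_hom A M"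
    and compl: "\<And>s. s \<in> base A \<Longrightarrow> \<exists>c\<in>carrier M. complements M (h s) c"
  shows "CS_extension A M h \<in> frame_hom (CS A) M"
    and "a \<in> carrier A \<Longrightarrow> CS_extension A M h (nabla A a) = h a"
proof -
  have "\<exists>g\<in>frame_hom (CS A) M. \<forall>a\<in>carrier A. g (nabla A a) = restrict h (carrier A) a"
    by (rule CS_hom_exists[OF M h]) (use compl base_carrier in simp)
  then obtain g where g: "g \<in> frame_hom (CS A) M \<and> (\<forall>a\<in>carrier A. g (nabla A a) = h a)" by auto
  have "CS_extension A M h = g"
    unfolding CS_extension_def
  proof (rule the_equality)
    show "g \<in> frame_hom (CS A) M \<and> (\<forall>a\<in>carrier A. g (nabla A a) = h a)" by (rule g)
    fix g' assume g': "g' \<in> frame_hom (CS A) M \<and> (\<forall>a\<in>carrier A. g' (nabla A a) = h a)"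
    show "g' = g" by (rule CS_hom_unique[OF M]) (use g g' in auto)
  qed
  then show "CS_extension A M h \<in> frame_hom (CS A) M"
    and "a \<in> carrier A \<Longrightarrow> CS_extension A M h (nabla A a) = h a"
    using g by auto
qed

lemma CS_extension_delta:
  fixes M :: "('m, 'y) gorder_scheme"
  assumes M: "frame M" and h: "restrict h (carrier A) \<in> frame_hom A M"
    and compl: "\<And>s. s \<in> base A \<Longrightarrow> \<exists>c\<in>carrier M. complements M (h s) c"
    and s: "s \<in> base A" and c: "c \<in> carrier M" "complements M (h s) c"
  shows "CS_extension A M h (delta A s) = c"
proof -
  have E: "CS_extension A M h \<in> frame_hom (CS A) M" by (rule CS_extension(1)[OF M h compl])
  interpret g: frame_morphism "CS A" M "CS_extension A M h"
    using M E CS.frame_axioms by (simp add: frame_morphism_def frame_morphism_axioms_def)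
  have m: "nabla A s \<in> carrier (CS A)" "delta A s \<in> carrier (CS A)"
    using s nabla_CS delta_CS base_carrier by auto
  have "complements M (CS_extension A M h (nabla A s)) (CS_extension A M h (delta A s))"
    by (rule g.map_complements[OF CS_complements[OF s] m])
  moreover have "CS_extension A M h (nabla A s) = h s"
    by (rule CS_extension(2)[OF M h compl base_carrier[OF s]])
  ultimately show ?thesis
    using g.M.complement_unique[of "h s" _ c] c g.closed[OF m(1)] g.closed[OF m(2)] by simp
qed

end

section \<open>The symmetrization and the biframe of a Frith frame\<close>

context frith
begin

lemma symmetrization_simps:
  "carrier (symmetrization A) = carrier (CS A)" "le (symmetrization A) = le (CS A)"
  "eq (symmetrization A) = eq (CS A)"
  by (simp_all add: symmetrization_def)

lemma Sk_simps:
  "carrier (Sk A) = carrier (CS A)" "le (Sk A) = le (CS A)" "eq (Sk A) = eq (CS A)"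
  "pos (Sk A) = nabla A ` carrier A" "neg (Sk A) = delta_subframe A"
  by (simp_all add: Sk_def)

lemmas Sk_operations = order_operations_cong[OF Sk_simps(1,2)]
lemmas symmetrization_operations = order_operations_cong[OF symmetrization_simps(1,2)]

lemma Sk_frame: "frame (Sk A)"
  by (rule frame_order_cong[OF Sk_simps(1-3) CS.frame_axioms])

lemma frame_hom_Sk: "frame_hom (Sk A) N = frame_hom (CS A) N" "frame_hom N' (Sk A) = frame_hom N' (CS A)"
  by (simp_all add: frame_hom_def Sk_simps Sk_operations)

lemma frame_hom_symmetrization: "frame_hom (symmetrization A) N = frame_hom (CS A) N"
  by (simp add: frame_hom_def symmetrization_simps symmetrization_operations)

lemma subframe_Sk: "subframe (Sk A) X \<longleftrightarrow> subframe (CS A) X"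
  by (simp add: subframe_def Sk_simps Sk_operations)

lemma complements_Sk: "complements (Sk A) x y \<longleftrightarrow> complements (CS A) x y"
  by (simp add: complements_def Sk_operations)

lemma compact_symmetrization_iff: "compact_frame (symmetrization A) \<longleftrightarrow> compact_frame (CS A)"
  using frame_order_cong[OF symmetrization_simps CS.frame_axioms] CS.frame_axioms
  by (simp add: compact_frame_def symmetrization_simps symmetrization_operations)

lemma compact_Sk_iff: "compact_frame (Sk A) \<longleftrightarrow> compact_frame (CS A)"
  using Sk_frame CS.frame_axioms by (simp add: compact_frame_def Sk_simps Sk_operations)

text \<open>The elements of the base with a complement in the base form a bounded sublattice containing the
  generators, by the De Morgan laws, so they are the whole base.\<close>

lemma symmetrization_symmetric: "symmetric_frith (symmetrization A)"
proof -
  let ?G = "nabla A ` base A \<union> delta A ` base A"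
  let ?B = "bounded_sublattice_gen (CS A) ?G"
  have G: "?G \<subseteq> carrier (CS A)" using nabla_CS delta_CS base_carrier by auto
  have B: "bounded_sublattice (CS A) ?B" by (rule CS.sublattice_gen_bounded_sublattice[OF G])
  have BC: "?B \<subseteq> carrier (CS A)" using B by (simp add: bounded_sublattice_def)
  have GB: "?G \<subseteq> ?B" by (rule sublattice_gen_superset)
  have B_closed: "\<bottom>\<^bsub>CS A\<^esub> \<in> ?B" "\<top>\<^bsub>CS A\<^esub> \<in> ?B"
    "\<And>x y. \<lbrakk>x \<in> ?B; y \<in> ?B\<rbrakk> \<Longrightarrow> x \<sqinter>\<^bsub>CS A\<^esub> y \<in> ?B" "\<And>x y. \<lbrakk>x \<in> ?B; y \<in> ?B\<rbrakk> \<Longrightarrow> x \<squnion>\<^bsub>CS A\<^esub> y \<in> ?B"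
    using B by (auto simp: bounded_sublattice_def)
  have base: "base (symmetrization A) = ?B" by (simp add: symmetrization_def)
  have "frith_frame (symmetrization A)"
    unfolding frith_frame_def
  proof (intro conjI ballI)
    show "frame (symmetrization A)"
      by (rule frame_order_cong[OF symmetrization_simps CS.frame_axioms])
    show "bounded_sublattice (symmetrization A) (base (symmetrization A))"
      using B unfolding base by (simp add: bounded_sublattice_def symmetrization_simps symmetrization_operations)
    fix \<theta> assume "\<theta> \<in> carrier (symmetrization A)"
    then have "\<theta> \<in> joins (CS A) base_cells" using CS_joins by (simp add: symmetrization_simps)
    moreover have "base_cells \<subseteq> ?B"
    proof
      fix \<kappa> assume "\<kappa> \<in> base_cells"
      then obtain s t where st: "s \<in> base A" "t \<in> base A" "\<kappa> = nabla A s \<inter> delta A t"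
        by (auto simp: base_cells_def)
      have "nabla A s \<sqinter>\<^bsub>CS A\<^esub> delta A t \<in> ?B" using st GB by (intro B_closed(3)) auto
      then show "\<kappa> \<in> ?B" using st nabla_CS delta_CS base_carrier by (simp add: CS_meet)
    qed
    ultimately have "\<theta> \<in> joins (CS A) ?B" using joins_mono by blast
    then show "\<exists>X\<subseteq>base (symmetrization A). \<theta> = \<Squnion>\<^bsub>symmetrization A\<^esub> X"
      unfolding base symmetrization_operations by (auto simp: joins_def)
  qed
  moreover have "\<exists>y\<in>?B. complements (CS A) x y" if "x \<in> ?B" for x
  proof -
    let ?C = "{x \<in> ?B. \<exists>y\<in>?B. complements (CS A) x y}"
    have "bounded_sublattice (CS A) ?C"
      unfolding bounded_sublattice_def
    proof (intro conjI ballI)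
      show "?C \<subseteq> carrier (CS A)" using BC by auto
      show "\<top>\<^bsub>CS A\<^esub> \<in> ?C" using B_closed(1,2) CS.complements_top_bottom by blast
      show "\<bottom>\<^bsub>CS A\<^esub> \<in> ?C"
        using B_closed(1,2) CS.complements_top_bottom CS.complements_commute by blast
      fix x y assume "x \<in> ?C" "y \<in> ?C"
      then obtain c d where xy: "x \<in> ?B" "c \<in> ?B" "complements (CS A) x c" "y \<in> ?B" "d \<in> ?B" "complements (CS A) y d"
        by blast
      have c: "x \<in> carrier (CS A)" "c \<in> carrier (CS A)" "y \<in> carrier (CS A)" "d \<in> carrier (CS A)"
        using xy BC by auto
      show "x \<sqinter>\<^bsub>CS A\<^esub> y \<in> ?C"
        using CS.complements_meet_join[OF xy(3,6) c] B_closed(3)[OF xy(1,4)] B_closed(4)[OF xy(2,5)] by blast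
      show "x \<squnion>\<^bsub>CS A\<^esub> y \<in> ?C"
        using CS.complements_join_meet[OF xy(3,6) c] B_closed(4)[OF xy(1,4)] B_closed(3)[OF xy(2,5)] by blast
    qed
    moreover have "?G \<subseteq> ?C"
      using GB CS_complements CS.complements_commute by blast
    ultimately have "?B \<subseteq> ?C" by (rule sublattice_gen_minimal)
    then show ?thesis using that by blast
  qed
  ultimately show ?thesis
    unfolding symmetric_frith_def base by (simp add: complements_def symmetrization_operations)
qed

lemma complete_frith_iff_compact: "complete_frith A \<longleftrightarrow> compact_frame (CS A)"
  using symmetrization_symmetric frith_frame
  by (simp add: complete_frith_def complete_symmetric_iff_compact compact_symmetrization_iff)

lemma nabla_subframe: "subframe (CS A) (nabla A ` carrier A)"
proof -
  interpret unit: frame_morphism A "CS A" "unit_map A"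
    using unit_map_hom frame_axioms CS.frame_axioms by (simp add: frame_morphism_def frame_morphism_axioms_def)
  have "unit_map A ` carrier A = nabla A ` carrier A" by (intro image_cong) (auto simp: unit_map_def)
  then show ?thesis using unit.image_subframe by simp
qed

lemma delta_subframe_subframe: "subframe (CS A) (delta_subframe A)"
proof -
  have "subframe (congruence_frame A) (delta_subframe A)"
    unfolding delta_subframe_def by (rule CL.subframe_gen_subframe[OF delta_base_sub])
  then show ?thesis by (simp add: CSR.subframe_M[OF delta_subframe_CS])
qed

lemma delta_subframe_joins: "delta_subframe A = joins (CS A) (delta A ` base A)"
  using CSR.joins_M[of "delta A ` base A"] delta_CS by (auto simp: delta_subframe_eq_joins)

lemma delta_in_delta_subframe: "s \<in> base A \<Longrightarrow> delta A s \<in> delta_subframe A"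
  using CL.joins_superset[OF delta_base_sub] by (auto simp: delta_subframe_eq_joins)

lemma nabla_CS_joins: "a \<in> carrier A \<Longrightarrow> nabla A a \<in> joins (CS A) (nabla A ` base A)"
proof -
  assume a: "a \<in> carrier A"
  have "nabla A ` base A \<subseteq> carrier (CS A)" using nabla_CS base_carrier by auto
  then have "joins (CS A) (nabla A ` base A) = joins (congruence_frame A) (nabla A ` base A)"
    by (rule CSR.joins_M)
  then show ?thesis
    unfolding nabla_sup_base[OF a] by (auto intro: joinsI)
qed

lemma Sk_biframe: "is_biframe (Sk A)"
  unfolding is_biframe_def
proof (intro conjI ballI)
  show "frame (Sk A)" by (rule Sk_frame)
  show "subframe (Sk A) (pos (Sk A))" using nabla_subframe by (simp add: subframe_Sk Sk_simps)
  show "subframe (Sk A) (neg (Sk A))" using delta_subframe_subframe by (simp add: subframe_Sk Sk_simps)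
  fix \<theta> assume "\<theta> \<in> carrier (Sk A)"
  then have "\<theta> \<in> joins (CS A) base_cells" using CS_joins by (simp add: Sk_simps)
  moreover have "base_cells \<subseteq> {\<Sqinter>\<^bsub>Sk A\<^esub> F |F. finite F \<and> F \<subseteq> pos (Sk A) \<union> neg (Sk A)}"
  proof
    fix \<kappa> assume "\<kappa> \<in> base_cells"
    then obtain s t where st: "s \<in> base A" "t \<in> base A" "\<kappa> = nabla A s \<inter> delta A t"
      by (auto simp: base_cells_def)
    have "\<kappa> = \<Sqinter>\<^bsub>Sk A\<^esub> {nabla A s, delta A t}"
      using st nabla_CS delta_CS base_carrier CS_meet[of "nabla A s" "delta A t"]
      by (simp add: meet_def Sk_operations)
    moreover have "{nabla A s, delta A t} \<subseteq> pos (Sk A) \<union> neg (Sk A)"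
      using st base_carrier delta_in_delta_subframe by (auto simp: Sk_simps)
    ultimately show "\<kappa> \<in> {\<Sqinter>\<^bsub>Sk A\<^esub> F |F. finite F \<and> F \<subseteq> pos (Sk A) \<union> neg (Sk A)}" by blast
  qed
  ultimately have "\<theta> \<in> joins (CS A) {\<Sqinter>\<^bsub>Sk A\<^esub> F |F. finite F \<and> F \<subseteq> pos (Sk A) \<union> neg (Sk A)}"
    by (rule subsetD[OF joins_mono, rotated])
  then show "\<exists>X\<subseteq>{\<Sqinter>\<^bsub>Sk A\<^esub> F |F. finite F \<and> F \<subseteq> pos (Sk A) \<union> neg (Sk A)}. \<theta> = \<Squnion>\<^bsub>Sk A\<^esub> X"
    unfolding joins_iff Sk_operations .
qed

lemma nabla_bicomplemented: "s \<in> base A \<Longrightarrow> nabla A s \<in> pos_bicomplemented (Sk A)"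
  using CS_complements base_carrier delta_in_delta_subframe
  by (auto simp: pos_bicomplemented_def Sk_simps complements_Sk)

lemma delta_bicomplemented: "s \<in> base A \<Longrightarrow> delta A s \<in> neg_bicomplemented (Sk A)"
  using CS_complements[of s] base_carrier[of s] delta_in_delta_subframe[of s]
    CS.complements_commute[of "delta A s" "nabla A s"]
  unfolding neg_bicomplemented_def Sk_simps complements_Sk by blast

lemma Sk_zero_dimensional: "zero_dimensional (Sk A)"
proof -
  have "pos (Sk A) \<subseteq> joins (CS A) (pos_bicomplemented (Sk A))"
    using nabla_CS_joins joins_mono[of "nabla A ` base A" "pos_bicomplemented (Sk A)" "CS A"] nabla_bicomplemented
    by (auto simp: Sk_simps)
  moreover have "neg (Sk A) \<subseteq> joins (CS A) (neg_bicomplemented (Sk A))"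
    using joins_mono[of "delta A ` base A" "neg_bicomplemented (Sk A)" "CS A"] delta_bicomplemented
    by (auto simp: Sk_simps delta_subframe_joins)
  ultimately show ?thesis
    unfolding zero_dimensional_def joins_def Sk_operations by blast
qed

end

section \<open>The Frith frame of a biframe\<close>

locale biframe = frame K for K :: "'a biframe" (structure) +
  assumes biframe: "is_biframe K"
begin

lemma pos_sub: "pos K \<subseteq> carrier K" and neg_sub: "neg K \<subseteq> carrier K"
  and pos_subframe: "subframe K (pos K)" and neg_subframe: "subframe K (neg K)"
  using biframe by (auto simp: is_biframe_def subframe_def)

lemma pos_bicomplementedE:
  assumes "a \<in> pos_bicomplemented K"
  obtains b where "a \<in> pos K" "b \<in> neg K" "complements K a b" "a \<in> carrier K" "b \<in> carrier K"
  using assms pos_sub neg_sub unfolding pos_bicomplemented_def by blast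

lemma subframe_join: "\<lbrakk>subframe K S; x \<in> S; y \<in> S\<rbrakk> \<Longrightarrow> x \<squnion> y \<in> S"
  by (simp add: subframe_def join_def)

lemma subframe_bottom: "subframe K S \<Longrightarrow> \<bottom> \<in> S"
  using sup_empty unfolding subframe_def by (metis empty_subsetI)

lemma pos_bicomplemented_sublattice: "bounded_sublattice K (pos_bicomplemented K)"
  unfolding bounded_sublattice_def
proof (intro conjI ballI)
  show "pos_bicomplemented K \<subseteq> carrier K" using pos_sub by (auto simp: pos_bicomplemented_def)
  have top: "\<top> \<in> pos K" "\<top> \<in> neg K"
    using pos_subframe neg_subframe by (auto simp: subframe_def)
  have bottom: "\<bottom> \<in> pos K" "\<bottom> \<in> neg K"
    using subframe_bottom pos_subframe neg_subframe by auto
  show "\<top> \<in> pos_bicomplemented K"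
    using top bottom complements_top_bottom by (auto simp: pos_bicomplemented_def)
  have "complements K \<bottom> \<top>" using complements_top_bottom complements_commute by blast
  then show "\<bottom> \<in> pos_bicomplemented K"
    using top bottom by (auto simp: pos_bicomplemented_def)
  fix x y assume "x \<in> pos_bicomplemented K" "y \<in> pos_bicomplemented K"
  then obtain c d where x: "x \<in> pos K" "c \<in> neg K" "complements K x c" "x \<in> carrier K" "c \<in> carrier K"
    and y: "y \<in> pos K" "d \<in> neg K" "complements K y d" "y \<in> carrier K" "d \<in> carrier K"
    by (metis pos_bicomplementedE)
  have "x \<sqinter> y \<in> pos K" "c \<sqinter> d \<in> neg K" "x \<squnion> y \<in> pos K" "c \<squnion> d \<in> neg K"
    using x y pos_subframe neg_subframe subframe_join by (auto simp: subframe_def)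
  then show "x \<sqinter> y \<in> pos_bicomplemented K" "x \<squnion> y \<in> pos_bicomplemented K"
    using complements_meet_join[OF x(3) y(3) x(4,5) y(4,5)] complements_join_meet[OF x(3) y(3) x(4,5) y(4,5)]
    by (auto simp: pos_bicomplemented_def)
qed

lemma pos_bicomplemented_sub: "pos_bicomplemented K \<subseteq> carrier K"
  using pos_bicomplemented_sublattice by (simp add: bounded_sublattice_def)

text \<open>A bounded sublattice is closed under finite meets, so the subframe it generates consists of its
  joins; these are the same whether computed in \<open>K\<close> or in its positive part.\<close>

lemma carrier_Bplus: "carrier (Bplus K) = joins K (pos_bicomplemented K)"
proof -
  let ?P = "K\<lparr>carrier := pos K\<rparr>"
  interpret P: frame_restriction K ?P by unfold_locales (simp_all add: pos_subframe)
  interpret PF: frame ?P by (rule P.frame_M)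
  have sub: "pos_bicomplemented K \<subseteq> carrier ?P" by (auto simp: pos_bicomplemented_def)
  have "subframe_gen ?P (pos_bicomplemented K) = joins ?P (pos_bicomplemented K)"
  proof (rule PF.subframe_gen_eq_joins[OF sub])
    show "\<top>\<^bsub>?P\<^esub> \<in> pos_bicomplemented K"
      using pos_bicomplemented_sublattice unfolding P.top_M by (simp add: bounded_sublattice_def)
    show "x \<sqinter>\<^bsub>?P\<^esub> y \<in> pos_bicomplemented K" if "x \<in> pos_bicomplemented K" "y \<in> pos_bicomplemented K" for x y
      using pos_bicomplemented_sublattice P.meet_M[OF subsetD[OF sub that(1)] subsetD[OF sub that(2)]] that
      by (simp add: bounded_sublattice_def)
  qed
  also have "\<dots> = joins K (pos_bicomplemented K)" by (rule P.joins_M[OF sub])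
  finally show ?thesis by (simp add: Bplus_def)
qed

lemma base_Bplus: "base (Bplus K) = pos_bicomplemented K"
  by (simp add: Bplus_def)

sublocale BR: frame_restriction K "Bplus K"
proof
  show "subframe K (carrier (Bplus K))"
    unfolding carrier_Bplus using pos_bicomplemented_sublattice
    by (intro joins_subframe) (auto simp: bounded_sublattice_def)
qed (simp_all add: Bplus_def)

lemma base_Bplus_sub: "pos_bicomplemented K \<subseteq> carrier (Bplus K)"
  unfolding carrier_Bplus by (rule joins_superset[OF pos_bicomplemented_sub])

lemma Bplus_frith: "frith_frame (Bplus K)"
  unfolding frith_frame_def base_Bplus
proof (intro conjI ballI)
  show "frame (Bplus K)" by (rule BR.frame_M)
  show "bounded_sublattice (Bplus K) (pos_bicomplemented K)"
    using BR.bounded_sublattice_M[OF base_Bplus_sub] pos_bicomplemented_sublattice by simp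
  fix a assume "a \<in> carrier (Bplus K)"
  then have "a \<in> joins (Bplus K) (pos_bicomplemented K)"
    using carrier_Bplus BR.joins_M[OF base_Bplus_sub] by simp
  then show "\<exists>X\<subseteq>pos_bicomplemented K. a = \<Squnion>\<^bsub>Bplus K\<^esub> X" by (auto simp: joins_def)
qed

sublocale B: frith "Bplus K"
  by (simp add: frith_iff Bplus_frith)

lemma carrier_Bplus_pos: "carrier (Bplus K) \<subseteq> pos K"
  unfolding carrier_Bplus using pos_subframe
  by (intro joins_subset_subframe) (auto simp: pos_bicomplemented_def)

end

lemma biframe_iff: "biframe K \<longleftrightarrow> is_biframe K"
  by (auto simp: biframe_def biframe_axioms_def is_biframe_def)

section \<open>The functor from Frith frames to biframes\<close>

context frith
begin

lemma unit_map_Bplus: "unit_map A \<in> frith_hom A (Bplus (Sk A))"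
proof -
  interpret Sk: biframe "Sk A" using Sk_biframe by (simp add: biframe_iff)
  have "nabla A a \<in> carrier (Bplus (Sk A))" if a: "a \<in> carrier A" for a
  proof -
    have "joins (CS A) (nabla A ` base A) \<subseteq> joins (Sk A) (pos_bicomplemented (Sk A))"
      using nabla_bicomplemented joins_mono[of "nabla A ` base A" "pos_bicomplemented (Sk A)" "CS A"]
      by (auto simp: joins_def Sk_operations)
    then show ?thesis using nabla_CS_joins[OF a] unfolding Sk.carrier_Bplus by blast
  qed
  then have "unit_map A \<in> frame_hom A (Bplus (Sk A))"
    using unit_map_hom unfolding Sk.BR.frame_hom_into_M[OF complete_lattice_axioms] frame_hom_Sk
    by (auto simp: unit_map_def)
  moreover have "unit_map A ` base A \<subseteq> base (Bplus (Sk A))"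
    using nabla_bicomplemented base_carrier unfolding Sk.base_Bplus by (auto simp: unit_map_def)
  ultimately show ?thesis by (simp add: frith_hom_def)
qed

end

locale frith_morphism = A: frith A + B: frith B for A :: "'a frith" and B :: "'b frith" +
  fixes h assumes frith_hom: "h \<in> frith_hom A B"
begin

sublocale frame_morphism A B h
  using frith_hom A.frame_axioms B.frame_axioms
  by (simp add: frith_hom_def frame_morphism_def frame_morphism_axioms_def)

lemma map_base: "s \<in> base A \<Longrightarrow> h s \<in> base B"
  using frith_hom by (auto simp: frith_hom_def)

lemma nabla_map_hom: "restrict (\<lambda>a. nabla B (h a)) (carrier A) \<in> frame_hom A (CS B)"
proof -
  have "restrict (\<lambda>a. nabla B (h a)) (carrier A) = compose (carrier A) (unit_map B) h"
    unfolding compose_def by (intro restrict_ext) (simp add: unit_map_def)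
  then show ?thesis using frame_hom_compose[OF A.frame_axioms hom B.unit_map_hom] by simp
qed

lemma nabla_map_complement: "s \<in> base A \<Longrightarrow> complements (CS B) (nabla B (h s)) (delta B (h s))"
  by (rule B.CS_complements[OF map_base])

lemma nabla_map_complemented: "s \<in> base A \<Longrightarrow> \<exists>c\<in>carrier (CS B). complements (CS B) (nabla B (h s)) c"
  using nabla_map_complement B.delta_CS map_base by blast

lemma Sk_map_hom: "Sk_map A B h \<in> frame_hom (CS A) (CS B)"
  unfolding Sk_map_def
  by (rule A.CS_extension(1)[OF B.CS.frame_axioms nabla_map_hom nabla_map_complemented])

lemma Sk_map_nabla: "a \<in> carrier A \<Longrightarrow> Sk_map A B h (nabla A a) = nabla B (h a)"
  unfolding Sk_map_def
  by (rule A.CS_extension(2)[OF B.CS.frame_axioms nabla_map_hom nabla_map_complemented])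

lemma Sk_map_delta: "s \<in> base A \<Longrightarrow> Sk_map A B h (delta A s) = delta B (h s)"
  unfolding Sk_map_def
  by (rule A.CS_extension_delta[OF B.CS.frame_axioms nabla_map_hom nabla_map_complemented])
    (use nabla_map_complement B.delta_CS map_base in auto)

text \<open>Negative elements are joins of some \<open>\<Delta>\<^sub>s\<close> with \<open>s\<close> in the base, and \<open>\<Delta>\<^sub>s\<close> goes to \<open>\<Delta>\<close> at \<open>h s\<close>, which is where
  \<open>h\<close> mapping base to base enters.\<close>

lemma Sk_map_biframe_hom: "Sk_map A B h \<in> biframe_hom (Sk A) (Sk B)"
proof -
  interpret S: frame_morphism "CS A" "CS B" "Sk_map A B h"
    using Sk_map_hom A.CS.frame_axioms B.CS.frame_axioms
    by (simp add: frame_morphism_def frame_morphism_axioms_def)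
  have "joins (CS A) (delta A ` base A) \<subseteq> {\<theta> \<in> carrier (CS A). Sk_map A B h \<theta> \<in> delta_subframe B}"
    using A.delta_CS B.delta_in_delta_subframe map_base
    by (intro joins_subset_subframe S.preimage_subframe B.delta_subframe_subframe)
      (auto simp: Sk_map_delta)
  then have "Sk_map A B h ` delta_subframe A \<subseteq> delta_subframe B"
    by (auto simp: A.delta_subframe_joins)
  moreover have "Sk_map A B h ` nabla A ` carrier A \<subseteq> nabla B ` carrier B"
    by (auto simp: Sk_map_nabla)
  ultimately show ?thesis
    using Sk_map_hom by (simp add: biframe_hom_def A.frame_hom_Sk B.frame_hom_Sk A.Sk_simps B.Sk_simps)
qed

end

lemma frith_morphism_iff: "frith_morphism A B h \<longleftrightarrow> frith_frame A \<and> frith_frame B \<and> h \<in> frith_hom A B"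
  by (simp add: frith_morphism_def frith_morphism_axioms_def frith_iff)

lemma Sk_map_identity:
  assumes "frith_frame A"
  shows "Sk_map A A (\<lambda>x\<in>carrier A. x) = (\<lambda>x\<in>carrier (Sk A). x)"
proof -
  interpret frith A using assms by (simp add: frith_iff)
  interpret frith_morphism A A "\<lambda>x\<in>carrier A. x"
    using assms identity_hom base_carrier by (auto simp: frith_morphism_iff frith_hom_def)
  show ?thesis
    unfolding Sk_simps
    by (rule CS_hom_unique[OF CS.frame_axioms Sk_map_hom CS.identity_hom])
      (simp add: Sk_map_nabla nabla_CS)
qed

lemma Sk_map_compose:
  assumes "frith_frame A" "frith_frame B" "frith_frame C" "h \<in> frith_hom A B" "k \<in> frith_hom B C"
  shows "Sk_map A C (compose (carrier A) k h) = compose (carrier (Sk A)) (Sk_map B C k) (Sk_map A B h)"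
proof -
  interpret h: frith_morphism A B h using assms by (simp add: frith_morphism_iff)
  interpret k: frith_morphism B C k using assms by (simp add: frith_morphism_iff)
  interpret kh: frith_morphism A C "compose (carrier A) k h"
    using assms frith_hom_compose[OF assms(1,4,5)] by (simp add: frith_morphism_iff)
  show ?thesis
    unfolding h.A.Sk_simps
  proof (rule h.A.CS_hom_unique[OF k.B.CS.frame_axioms kh.Sk_map_hom])
    show "compose (carrier (CS A)) (Sk_map B C k) (Sk_map A B h) \<in> frame_hom (CS A) (CS C)"
      by (rule frame_hom_compose[OF h.A.CS.frame_axioms h.Sk_map_hom k.Sk_map_hom])
    show "Sk_map A C (compose (carrier A) k h) (nabla A a)
      = compose (carrier (CS A)) (Sk_map B C k) (Sk_map A B h) (nabla A a)" if "a \<in> carrier A" for a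
      using that by (simp add: kh.Sk_map_nabla compose_eq h.A.nabla_CS h.Sk_map_nabla k.Sk_map_nabla)
  qed
qed

section \<open>The functor from biframes to Frith frames\<close>

locale biframe_morphism = K: biframe K + N: biframe N for K :: "'a biframe" and N :: "'b biframe" +
  fixes h assumes biframe_hom: "h \<in> biframe_hom K N"
begin

sublocale frame_morphism K N h
  using biframe_hom K.frame_axioms N.frame_axioms
  by (simp add: biframe_hom_def frame_morphism_def frame_morphism_axioms_def)

lemma map_pos_bicomplemented:
  assumes "a \<in> pos_bicomplemented K"
  shows "h a \<in> pos_bicomplemented N"
proof -
  obtain b where b: "a \<in> pos K" "b \<in> neg K" "complements K a b" "a \<in> carrier K" "b \<in> carrier K"
    using assms by (rule K.pos_bicomplementedE)
  then have "h a \<in> pos N" "h b \<in> neg N" using biframe_hom by (auto simp: biframe_hom_def)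
  then show ?thesis using map_complements[OF b(3-5)] by (auto simp: pos_bicomplemented_def)
qed

lemma map_Bplus: "a \<in> carrier (Bplus K) \<Longrightarrow> h a \<in> carrier (Bplus N)"
proof -
  have "joins K (pos_bicomplemented K) \<subseteq> {a \<in> carrier K. h a \<in> carrier (Bplus N)}"
    using map_pos_bicomplemented N.base_Bplus_sub K.pos_bicomplemented_sub
    by (intro joins_subset_subframe preimage_subframe N.BR.sub) auto
  then show "a \<in> carrier (Bplus K) \<Longrightarrow> h a \<in> carrier (Bplus N)"
    by (auto simp: K.carrier_Bplus)
qed

lemma Bplus_map_hom: "Bplus_map K N h \<in> frith_hom (Bplus K) (Bplus N)"
proof -
  have "Bplus_map K N h \<in> frame_hom (Bplus K) N"
    unfolding Bplus_map_def by (rule K.BR.frame_hom_restrict_M[OF hom])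
  then have "Bplus_map K N h \<in> frame_hom (Bplus K) (Bplus N)"
    using map_Bplus K.BR.complete_lattice_M by (subst N.BR.frame_hom_into_M) (auto simp: Bplus_map_def)
  moreover have "Bplus_map K N h ` base (Bplus K) \<subseteq> base (Bplus N)"
    using map_pos_bicomplemented K.base_Bplus_sub by (auto simp: Bplus_map_def K.base_Bplus N.base_Bplus)
  ultimately show ?thesis by (simp add: frith_hom_def)
qed

sublocale Bplus: frith_morphism "Bplus K" "Bplus N" "Bplus_map K N h"
  by unfold_locales (rule Bplus_map_hom)

end

lemma biframe_morphism_iff:
  "biframe_morphism K N h \<longleftrightarrow> is_biframe K \<and> is_biframe N \<and> h \<in> biframe_hom K N"
  by (simp add: biframe_morphism_def biframe_morphism_axioms_def biframe_iff)

lemma Bplus_map_identity: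
  assumes "is_biframe K"
  shows "Bplus_map K K (\<lambda>x\<in>carrier K. x) = (\<lambda>x\<in>carrier (Bplus K). x)"
proof -
  interpret biframe K using assms by (simp add: biframe_iff)
  show ?thesis using BR.carrier_subset by (auto simp: Bplus_map_def fun_eq_iff)
qed

lemma Bplus_map_compose:
  assumes "is_biframe K" "is_biframe N" "h \<in> biframe_hom K N"
  shows "Bplus_map K P (compose (carrier K) k h) =
    compose (carrier (Bplus K)) (Bplus_map N P k) (Bplus_map K N h)"
proof -
  interpret biframe_morphism K N h using assms by (simp add: biframe_morphism_iff)
  show ?thesis
    using K.BR.carrier_subset map_Bplus by (auto simp: Bplus_map_def compose_def fun_eq_iff)
qed

section \<open>The adjunction\<close>

context biframe
begin

lemma inclusion_complemented: "a \<in> base (Bplus K) \<Longrightarrow> \<exists>c\<in>carrier K. complements K a c"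
  unfolding base_Bplus by (metis pos_bicomplementedE)

lemma counit_hom: "counit_map K \<in> frame_hom (CS (Bplus K)) K"
  unfolding counit_map_def
  by (rule B.CS_extension(1)[OF frame_axioms BR.inclusion_hom inclusion_complemented])

lemma counit_nabla: "a \<in> carrier (Bplus K) \<Longrightarrow> counit_map K (nabla (Bplus K) a) = a"
  unfolding counit_map_def
  by (rule B.CS_extension(2)[OF frame_axioms BR.inclusion_hom inclusion_complemented])

lemma counit_delta:
  "\<lbrakk>a \<in> pos_bicomplemented K; c \<in> carrier K; complements K a c\<rbrakk> \<Longrightarrow> counit_map K (delta (Bplus K) a) = c"
  unfolding counit_map_def
  by (rule B.CS_extension_delta[OF frame_axioms BR.inclusion_hom inclusion_complemented])
    (auto simp: base_Bplus)

sublocale counit: frame_morphism "CS (Bplus K)" K "counit_map K"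
  using counit_hom frame_axioms B.CS.frame_axioms by (simp add: frame_morphism_def frame_morphism_axioms_def)

lemma counit_biframe_hom: "counit_map K \<in> biframe_hom (Sk (Bplus K)) K"
proof -
  have "counit_map K (delta (Bplus K) a) \<in> neg K" if a: "a \<in> pos_bicomplemented K" for a
    using pos_bicomplementedE[OF a] counit_delta[OF a] by metis
  then have "joins (CS (Bplus K)) (delta (Bplus K) ` base (Bplus K))
    \<subseteq> {\<theta> \<in> carrier (CS (Bplus K)). counit_map K \<theta> \<in> neg K}"
    using B.delta_CS by (intro joins_subset_subframe counit.preimage_subframe neg_subframe) (auto simp: base_Bplus)
  then have "counit_map K ` delta_subframe (Bplus K) \<subseteq> neg K" by (auto simp: B.delta_subframe_joins)
  moreover have "counit_map K ` nabla (Bplus K) ` carrier (Bplus K) \<subseteq> pos K"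
    using carrier_Bplus_pos by (auto simp: counit_nabla)
  ultimately show ?thesis
    using counit_hom by (simp add: biframe_hom_def B.frame_hom_Sk B.Sk_simps)
qed

lemma counit_unit_triangle:
  "compose (carrier (Bplus K)) (Bplus_map (Sk (Bplus K)) K (counit_map K)) (unit_map (Bplus K)) =
    (\<lambda>x\<in>carrier (Bplus K). x)"
proof -
  have "unit_map (Bplus K) a \<in> carrier (Bplus (Sk (Bplus K)))" if "a \<in> carrier (Bplus K)" for a
    using B.unit_map_Bplus that by (auto simp: frith_hom_def frame_hom_def)
  then show ?thesis
    by (auto simp: compose_def fun_eq_iff Bplus_map_def) (simp_all add: unit_map_def counit_nabla)
qed

end

lemma unit_natural:
  assumes "frith_frame A" "frith_frame B" "h \<in> frith_hom A B"
  shows "compose (carrier A) (Bplus_map (Sk A) (Sk B) (Sk_map A B h)) (unit_map A) =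
    compose (carrier A) (unit_map B) h"
proof -
  interpret frith_morphism A B h using assms by (simp add: frith_morphism_iff)
  have "unit_map A a \<in> carrier (Bplus (Sk A))" if "a \<in> carrier A" for a
    using A.unit_map_Bplus that by (auto simp: frith_hom_def frame_hom_def)
  then show ?thesis
    by (auto simp: compose_def fun_eq_iff Bplus_map_def) (simp_all add: unit_map_def Sk_map_nabla)
qed

lemma counit_natural:
  assumes "is_biframe K" "is_biframe N" "h \<in> biframe_hom K N"
  shows "compose (carrier (Sk (Bplus K))) h (counit_map K) =
    compose (carrier (Sk (Bplus K))) (counit_map N) (Sk_map (Bplus K) (Bplus N) (Bplus_map K N h))"
proof -
  interpret biframe_morphism K N h using assms by (simp add: biframe_morphism_iff)
  show ?thesis
    unfolding K.B.Sk_simps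
  proof (rule K.B.CS_hom_unique[OF N.frame_axioms])
    show "compose (carrier (CS (Bplus K))) h (counit_map K) \<in> frame_hom (CS (Bplus K)) N"
      by (rule frame_hom_compose[OF K.B.CS.frame_axioms K.counit_hom hom])
    show "compose (carrier (CS (Bplus K))) (counit_map N) (Sk_map (Bplus K) (Bplus N) (Bplus_map K N h))
      \<in> frame_hom (CS (Bplus K)) N"
      by (rule frame_hom_compose[OF K.B.CS.frame_axioms Bplus.Sk_map_hom N.counit_hom])
    fix a assume a: "a \<in> carrier (Bplus K)"
    then have "Bplus_map K N h a = h a" by (simp add: Bplus_map_def)
    then show "compose (carrier (CS (Bplus K))) h (counit_map K) (nabla (Bplus K) a) =
      compose (carrier (CS (Bplus K))) (counit_map N) (Sk_map (Bplus K) (Bplus N) (Bplus_map K N h)) (nabla (Bplus K) a)"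
      using a map_Bplus[OF a]
      by (simp add: compose_eq K.B.nabla_CS K.counit_nabla Bplus.Sk_map_nabla N.counit_nabla)
  qed
qed

lemma unit_counit_triangle:
  assumes "frith_frame A"
  shows "compose (carrier (Sk A)) (counit_map (Sk A)) (Sk_map A (Bplus (Sk A)) (unit_map A)) =
    (\<lambda>x\<in>carrier (Sk A). x)"
proof -
  interpret frith A using assms by (simp add: frith_iff)
  interpret S: biframe "Sk A" using Sk_biframe by (simp add: biframe_iff)
  interpret unit: frith_morphism A "Bplus (Sk A)" "unit_map A"
    by unfold_locales (rule unit_map_Bplus)
  have counit: "counit_map (Sk A) \<in> frame_hom (CS (Bplus (Sk A))) (CS A)"
    using S.counit_hom unfolding frame_hom_Sk .
  show ?thesis
    unfolding Sk_simps
  proof (rule CS_hom_unique[OF CS.frame_axioms _ CS.identity_hom])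
    show "compose (carrier (CS A)) (counit_map (Sk A)) (Sk_map A (Bplus (Sk A)) (unit_map A)) \<in> frame_hom (CS A) (CS A)"
      by (rule frame_hom_compose[OF CS.frame_axioms unit.Sk_map_hom counit])
    fix a assume a: "a \<in> carrier A"
    then show "compose (carrier (CS A)) (counit_map (Sk A)) (Sk_map A (Bplus (Sk A)) (unit_map A)) (nabla A a)
      = (\<lambda>x\<in>carrier (CS A). x) (nabla A a)"
      using unit.closed[OF a] by (simp add: compose_eq nabla_CS unit.Sk_map_nabla S.counit_nabla)
        (simp add: unit_map_def)
  qed
qed

section \<open>The equivalence\<close>

context biframe
begin

text \<open>A cell \<open>\<nabla>\<^sub>s \<inter> \<Delta>\<^sub>t\<close> is sent to \<open>s\<close> meet the complement of \<open>t\<close>; if that is \<open>\<bottom>\<close> then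
  \<open>s \<sqsubseteq> t\<close>, and the cell was already trivial.  So the counit is dense for every biframe.\<close>

lemma counit_dense: "dense_map (symmetrization (Bplus K)) K (counit_map K)"
  unfolding dense_map_def B.symmetrization_simps B.symmetrization_operations
proof (intro ballI impI)
  let ?C = "CS (Bplus K)"
  fix \<theta> assume \<theta>: "\<theta> \<in> carrier ?C" and zero: "counit_map K \<theta> = \<bottom>"
  have bot: "frame_congruence (Bplus K) \<bottom>\<^bsub>?C\<^esub>" by (rule B.CS_congruence[OF B.CS.bottom_closed])
  have "\<kappa> \<subseteq> \<bottom>\<^bsub>?C\<^esub>" if \<kappa>: "\<kappa> \<in> B.base_cells" "\<kappa> \<subseteq> \<theta>" for \<kappa>
  proof -
    obtain s t where st: "s \<in> pos_bicomplemented K" "t \<in> pos_bicomplemented K"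
      "\<kappa> = nabla (Bplus K) s \<inter> delta (Bplus K) t"
      using \<kappa> by (auto simp: B.base_cells_def base_Bplus)
    obtain c where c: "complements K t c" "t \<in> carrier K" "c \<in> carrier K"
      using st by (metis pos_bicomplementedE)
    have sc: "s \<in> carrier K" "s \<in> carrier (Bplus K)" "t \<in> carrier (Bplus K)"
      using st pos_bicomplemented_sub base_Bplus_sub by auto
    have m: "nabla (Bplus K) s \<in> carrier ?C" "delta (Bplus K) t \<in> carrier ?C"
      using st sc B.nabla_CS B.delta_CS by (auto simp: base_Bplus)
    have k: "\<kappa> \<in> carrier ?C" using \<kappa>(1) B.base_cells_CS by auto
    have "counit_map K \<kappa> = counit_map K (nabla (Bplus K) s \<sqinter>\<^bsub>?C\<^esub> delta (Bplus K) t)"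
      using st m by (simp add: B.CS_meet)
    also have "\<dots> = s \<sqinter> c"
      using m st sc c by (simp add: counit.map_meet counit_nabla counit_delta)
    finally have "s \<sqinter> c \<sqsubseteq> \<bottom>"
      using counit.map_mono[of \<kappa> \<theta>] k \<theta> \<kappa>(2) zero by (simp add: B.CS_le)
    then have "s \<sqsubseteq> t"
      using complement_shunt[OF c sc(1), of \<bottom>] c by (simp add: join_comm[of K t] bottom_join)
    then have "t \<squnion>\<^bsub>Bplus K\<^esub> s = t"
      using sc c by (simp add: BR.join_M join_comm[of K t] join_absorb[symmetric])
    then show ?thesis
      using B.nabla_delta_subset_iff[OF sc(2,3) bot] frame_congruenceD(2)[OF bot sc(3)] st(3) by simp
  qed
  moreover have "\<theta> = \<Squnion>\<^bsub>?C\<^esub> {\<kappa> \<in> B.base_cells. \<kappa> \<subseteq> \<theta>}"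
    using B.CS.joins_canonical[OF B.base_cells_CS, of \<theta>] \<theta> B.CS_joins by (simp add: B.CS_le)
  moreover have "{\<kappa> \<in> B.base_cells. \<kappa> \<subseteq> \<theta>} \<subseteq> carrier ?C" using B.base_cells_CS by auto
  ultimately have "le ?C \<theta> \<bottom>\<^bsub>?C\<^esub>"
    using B.CS.sup_least[of "{\<kappa> \<in> B.base_cells. \<kappa> \<subseteq> \<theta>}" "\<bottom>\<^bsub>?C\<^esub>"] by (simp add: B.CS_le)
  then show "\<theta> = \<bottom>\<^bsub>?C\<^esub>" using \<theta> by (simp add: B.CS.le_bottom_iff)
qed

lemma counit_injective:
  assumes "compact_frame K"
  shows "inj_on (counit_map K) (carrier (CS (Bplus K)))"
  using dense_into_compact_injective[OF B.symmetrization_symmetric assms _ counit_dense] counit_hom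
  by (simp add: B.frame_hom_symmetrization B.symmetrization_simps)

lemma neg_bicomplementedE:
  assumes "b \<in> neg_bicomplemented K"
  obtains a where "a \<in> pos_bicomplemented K" "complements K a b" "b \<in> carrier K"
  using assms neg_sub complements_commute unfolding neg_bicomplemented_def pos_bicomplemented_def by blast

lemma counit_delta_neg:
  assumes "b \<in> neg_bicomplemented K"
  shows "\<exists>a\<in>pos_bicomplemented K. b = counit_map K (delta (Bplus K) a)"
  using neg_bicomplementedE[OF assms] counit_delta by metis

lemma zero_dimensional_pos:
  assumes "zero_dimensional K"
  shows "carrier (Bplus K) = pos K"
proof
  have "pos K \<subseteq> joins K (pos_bicomplemented K)"
    using assms by (auto simp: zero_dimensional_def joins_iff)
  then show "pos K \<subseteq> carrier (Bplus K)" by (simp add: carrier_Bplus)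
qed (rule carrier_Bplus_pos)

text \<open>The image is a subframe.  It contains the positive part, which
  zero-dimensionality makes the carrier of \<open>Bplus K\<close>, as the values at the \<open>\<nabla>\<^sub>a\<close>, and the negative
  bicomplemented elements as the values at the \<open>\<Delta>\<^sub>a\<close>.\<close>

lemma counit_surjective:
  assumes zd: "zero_dimensional K"
  shows "counit_map K ` carrier (CS (Bplus K)) = carrier K"
proof
  let ?I = "counit_map K ` carrier (CS (Bplus K))"
  show "?I \<subseteq> carrier K" by auto
  have pos: "pos K \<subseteq> ?I"
    using counit_nabla B.nabla_CS zero_dimensional_pos[OF zd] by (metis image_eqI subsetI)
  have "neg_bicomplemented K \<subseteq> ?I"
    using counit_delta_neg B.delta_CS unfolding base_Bplus by blast
  then have "joins K (neg_bicomplemented K) \<subseteq> ?I"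
    by (rule joins_subset_subframe[OF counit.image_subframe])
  moreover have "neg K \<subseteq> joins K (neg_bicomplemented K)"
    using zd by (auto simp: zero_dimensional_def joins_iff)
  ultimately have both: "pos K \<union> neg K \<subseteq> ?I" using pos by auto
  have "\<Sqinter>F \<in> ?I" if "finite F" "F \<subseteq> pos K \<union> neg K" for F
    using subframe_finite_inf[OF counit.image_subframe that(1)] that(2) both by (meson subset_trans)
  then have "{\<Sqinter>F |F. finite F \<and> F \<subseteq> pos K \<union> neg K} \<subseteq> ?I" by blast
  then have "joins K {\<Sqinter>F |F. finite F \<and> F \<subseteq> pos K \<union> neg K} \<subseteq> ?I"
    by (rule joins_subset_subframe[OF counit.image_subframe])
  moreover have "carrier K \<subseteq> joins K {\<Sqinter>F |F. finite F \<and> F \<subseteq> pos K \<union> neg K}"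
    using biframe unfolding is_biframe_def joins_iff[symmetric] by blast
  ultimately show "carrier K \<subseteq> ?I" by blast
qed

text \<open>Compactness passes from \<open>K\<close> to the domain of the injective counit.\<close>

lemma KZ_imp_complete:
  assumes "KZ_biframe K"
  shows "complete_frith (Bplus K)"
proof -
  have K: "compact_frame K" using assms by (simp add: KZ_biframe_def)
  show ?thesis
    unfolding B.complete_frith_iff_compact
    by (rule counit.injective_reflects_compact[OF counit_injective[OF K] K])
qed

lemma KZ_counit_iso:
  assumes "KZ_biframe K"
  shows "biframe_iso (Sk (Bplus K)) K (counit_map K)"
proof -
  have K: "compact_frame K" and zd: "zero_dimensional K" using assms by (auto simp: KZ_biframe_def)
  have "bij_betw (counit_map K) (carrier (CS (Bplus K))) (carrier K)"
    using counit_injective[OF K] counit_surjective[OF zd] by (simp add: bij_betw_def)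
  from counit.inverse[OF this] obtain k where k: "k \<in> frame_hom K (CS (Bplus K))"
    and k_counit: "\<And>\<theta>. \<theta> \<in> carrier (CS (Bplus K)) \<Longrightarrow> k (counit_map K \<theta>) = \<theta>"
    and inv: "compose (carrier (CS (Bplus K))) k (counit_map K) = (\<lambda>x\<in>carrier (CS (Bplus K)). x)"
      "compose (carrier K) (counit_map K) k = (\<lambda>y\<in>carrier K. y)" by metis
  interpret k: frame_morphism K "CS (Bplus K)" k
    using k frame_axioms B.CS.frame_axioms by (simp add: frame_morphism_def frame_morphism_axioms_def)
  have pos: "k ` pos K \<subseteq> nabla (Bplus K) ` carrier (Bplus K)"
  proof
    fix \<theta> assume "\<theta> \<in> k ` pos K"
    then obtain a where a: "a \<in> carrier (Bplus K)" "\<theta> = k a" using zero_dimensional_pos[OF zd] by auto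
    then have "\<theta> = nabla (Bplus K) a" using k_counit[OF B.nabla_CS] counit_nabla by metis
    then show "\<theta> \<in> nabla (Bplus K) ` carrier (Bplus K)" using a by blast
  qed
  have "neg_bicomplemented K \<subseteq> {b \<in> carrier K. k b \<in> delta_subframe (Bplus K)}"
  proof
    fix b assume b: "b \<in> neg_bicomplemented K"
    then obtain a where a: "a \<in> base (Bplus K)" "b = counit_map K (delta (Bplus K) a)"
      using counit_delta_neg by (auto simp: base_Bplus)
    then have "k b = delta (Bplus K) a" using k_counit[OF B.delta_CS] by simp
    then show "b \<in> {b \<in> carrier K. k b \<in> delta_subframe (Bplus K)}"
      using a B.delta_in_delta_subframe B.delta_CS by simp
  qed
  then have "joins K (neg_bicomplemented K) \<subseteq> {b \<in> carrier K. k b \<in> delta_subframe (Bplus K)}"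
    by (intro joins_subset_subframe k.preimage_subframe B.delta_subframe_subframe)
  moreover have "neg K \<subseteq> joins K (neg_bicomplemented K)"
    using zd by (auto simp: zero_dimensional_def joins_iff)
  ultimately have "k ` neg K \<subseteq> delta_subframe (Bplus K)" by auto
  then have kB: "k \<in> biframe_hom K (Sk (Bplus K))"
    using k pos by (simp add: biframe_hom_def B.frame_hom_Sk B.Sk_simps)
  show ?thesis
    unfolding biframe_iso_def B.Sk_simps
    by (intro conjI bexI[of _ k] counit_biframe_hom inv kB)
qed

end

context frith
begin

lemma complete_imp_KZ: "complete_frith A \<Longrightarrow> KZ_biframe (Sk A)"
  using Sk_biframe Sk_zero_dimensional
  by (simp add: KZ_biframe_def complete_frith_iff_compact compact_Sk_iff)

text \<open>A complemented \<open>\<nabla>\<^sub>a\<close> is compact in the compact frame \<open>\<C>\<^sub>SL\<close>, and it is the join of the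
  \<open>\<nabla>\<^sub>s\<close> with \<open>s \<sqsubseteq> a\<close> in the base; so \<open>a\<close> is a finite join of such \<open>s\<close>.  This is
  why the unit of a complete Frith frame is onto the base of its codomain.\<close>

lemma compact_pos_bicomplemented:
  assumes compact: "compact_frame (CS A)"
  shows "pos_bicomplemented (Sk A) = nabla A ` base A"
proof
  show "nabla A ` base A \<subseteq> pos_bicomplemented (Sk A)" using nabla_bicomplemented by auto
  show "pos_bicomplemented (Sk A) \<subseteq> nabla A ` base A"
  proof
    fix \<theta> assume "\<theta> \<in> pos_bicomplemented (Sk A)"
    then obtain a \<psi> where a: "a \<in> carrier A" "\<theta> = nabla A a"
      and \<psi>: "\<psi> \<in> delta_subframe A" "complements (CS A) (nabla A a) \<psi>"
      by (auto simp: pos_bicomplemented_def Sk_simps complements_Sk)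
    let ?S = "{s \<in> base A. s \<sqsubseteq> a}"
    have \<psi>C: "\<psi> \<in> carrier (CS A)" using \<psi> delta_subframe_CS by auto
    have sub: "nabla A ` ?S \<subseteq> carrier (CS A)" using nabla_CS base_carrier by auto
    have "le (CS A) (nabla A a) (\<Squnion>\<^bsub>CS A\<^esub> (nabla A ` ?S))"
      using nabla_sup_base[OF a(1)] by (simp add: CSR.sup_M[OF sub] CS_le)
    then obtain F where F: "F \<subseteq> nabla A ` ?S" "finite F" "le (CS A) (nabla A a) (\<Squnion>\<^bsub>CS A\<^esub> F)"
      using CS.complemented_imp_compact[OF compact \<psi>(2) nabla_CS[OF a(1)] \<psi>C sub] by blast
    then obtain G where G: "G \<subseteq> ?S" "finite G" "F = nabla A ` G" by (meson finite_subset_image)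
    have GA: "G \<subseteq> carrier A" "G \<subseteq> base A" using G base_sub by auto
    have "nabla A ` G \<subseteq> carrier (CS A)" using GA nabla_CS by auto
    then have "nabla A a \<subseteq> nabla A (\<Squnion>G)"
      using F(3) GA by (simp add: G(3) CSR.sup_M nabla_sup CS_le)
    then have "a \<sqsubseteq> \<Squnion>G" using a GA by (simp add: nabla_mono_iff)
    moreover have "\<Squnion>G \<sqsubseteq> a" using G GA a by (intro sup_least) auto
    ultimately have "a = \<Squnion>G" using a GA by (simp add: le_antisym)
    moreover have "\<Squnion>G \<in> base A"
      using frith_frame G(2) GA(2) by (intro finite_sup_in_sublattice) (auto simp: frith_frame_def)
    ultimately show "\<theta> \<in> nabla A ` base A" using a by simp
  qed
qed

lemma complete_unit_iso:
  assumes "complete_frith A"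
  shows "frith_iso A (Bplus (Sk A)) (unit_map A)"
proof -
  have B: "pos_bicomplemented (Sk A) = nabla A ` base A"
    using assms compact_pos_bicomplemented by (simp add: complete_frith_iff_compact)
  interpret S: biframe "Sk A" using Sk_biframe by (simp add: biframe_iff)
  interpret unit: frith_morphism A "Bplus (Sk A)" "unit_map A"
    by unfold_locales (rule unit_map_Bplus)
  have "carrier (Bplus (Sk A)) \<subseteq> nabla A ` carrier A"
    using S.carrier_Bplus_pos by (simp add: Sk_simps)
  then have "unit_map A ` carrier A = carrier (Bplus (Sk A))"
    using unit.image_closed[OF subset_refl] by (auto simp: unit_map_def)
  moreover have "inj_on (unit_map A) (carrier A)"
    by (rule inj_onI) (metis unit_map_def restrict_apply nabla_mono_iff le_antisym subset_refl)
  ultimately have "bij_betw (unit_map A) (carrier A) (carrier (Bplus (Sk A)))" by (simp add: bij_betw_def)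
  from unit.inverse[OF this] obtain k where k: "k \<in> frame_hom (Bplus (Sk A)) A"
    and k_unit: "\<And>a. a \<in> carrier A \<Longrightarrow> k (unit_map A a) = a"
    and inv: "compose (carrier A) k (unit_map A) = (\<lambda>x\<in>carrier A. x)"
      "compose (carrier (Bplus (Sk A))) (unit_map A) k = (\<lambda>y\<in>carrier (Bplus (Sk A)). y)" by metis
  have "k (nabla A s) = s" if "s \<in> base A" for s
    using k_unit[OF base_carrier[OF that]] base_carrier[OF that] by (simp add: unit_map_def)
  then have "k ` base (Bplus (Sk A)) \<subseteq> base A" by (auto simp: S.base_Bplus B)
  then have kF: "k \<in> frith_hom (Bplus (Sk A)) A" using k by (simp add: frith_hom_def)
  show ?thesis
    unfolding frith_iso_def by (intro conjI bexI[of _ k] unit_map_Bplus inv kF)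
qed

end

lemma complete_frith_frith: "complete_frith A \<Longrightarrow> frith A"
  by (simp add: complete_frith_def frith_iff)

lemma KZ_biframe_biframe: "KZ_biframe K \<Longrightarrow> biframe K"
  by (simp add: KZ_biframe_def biframe_iff)

theorem corollary5p17:
  shows
    "\<comment> \<open>Sk : Frith -> BiFrm is a functor\<close>
     (\<forall>A :: 'a frith. frith_frame A \<longrightarrow> is_biframe (Sk A)) \<and>
     (\<forall>(A :: 'a frith) (B :: 'b frith) h. frith_frame A \<and> frith_frame B \<and> h \<in> frith_hom A B
        \<longrightarrow> Sk_map A B h \<in> biframe_hom (Sk A) (Sk B)) \<and>
     (\<forall>A :: 'a frith. frith_frame A
        \<longrightarrow> Sk_map A A (\<lambda>x\<in>carrier A. x) = (\<lambda>x\<in>carrier (Sk A). x)) \<and>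
     (\<forall>(A :: 'a frith) (B :: 'b frith) (C :: 'c frith) h k.
        frith_frame A \<and> frith_frame B \<and> frith_frame C \<and> h \<in> frith_hom A B \<and> k \<in> frith_hom B C
        \<longrightarrow> Sk_map A C (compose (carrier A) k h) =
              compose (carrier (Sk A)) (Sk_map B C k) (Sk_map A B h)) \<and>

     \<comment> \<open>Bplus : BiFrm -> Frith is a functor\<close>
     (\<forall>K :: 'd biframe. is_biframe K \<longrightarrow> frith_frame (Bplus K)) \<and>
     (\<forall>(K :: 'd biframe) (N :: 'e biframe) h. is_biframe K \<and> is_biframe N \<and> h \<in> biframe_hom K N
        \<longrightarrow> Bplus_map K N h \<in> frith_hom (Bplus K) (Bplus N)) \<and>
     (\<forall>K :: 'd biframe. is_biframe K
        \<longrightarrow> Bplus_map K K (\<lambda>x\<in>carrier K. x) = (\<lambda>x\<in>carrier (Bplus K). x)) \<and>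
     (\<forall>(K :: 'd biframe) (N :: 'e biframe) (P :: 'f biframe) h k.
        is_biframe K \<and> is_biframe N \<and> is_biframe P \<and> h \<in> biframe_hom K N \<and> k \<in> biframe_hom N P
        \<longrightarrow> Bplus_map K P (compose (carrier K) k h) =
              compose (carrier (Bplus K)) (Bplus_map N P k) (Bplus_map K N h)) \<and>

     \<comment> \<open>adjunction: the unit and the counit are natural\<close>
     (\<forall>A :: 'a frith. frith_frame A \<longrightarrow> unit_map A \<in> frith_hom A (Bplus (Sk A))) \<and>
     (\<forall>(A :: 'a frith) (B :: 'b frith) h. frith_frame A \<and> frith_frame B \<and> h \<in> frith_hom A B
        \<longrightarrow> compose (carrier A) (Bplus_map (Sk A) (Sk B) (Sk_map A B h)) (unit_map A) =
              compose (carrier A) (unit_map B) h) \<and>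
     (\<forall>K :: 'd biframe. is_biframe K \<longrightarrow> counit_map K \<in> biframe_hom (Sk (Bplus K)) K) \<and>
     (\<forall>(K :: 'd biframe) (N :: 'e biframe) h. is_biframe K \<and> is_biframe N \<and> h \<in> biframe_hom K N
        \<longrightarrow> compose (carrier (Sk (Bplus K))) h (counit_map K) =
              compose (carrier (Sk (Bplus K)))
                (counit_map N) (Sk_map (Bplus K) (Bplus N) (Bplus_map K N h))) \<and>
     \<comment> \<open>adjunction: the triangle identities\<close>
     (\<forall>A :: 'a frith. frith_frame A
        \<longrightarrow> compose (carrier (Sk A)) (counit_map (Sk A)) (Sk_map A (Bplus (Sk A)) (unit_map A)) =
              (\<lambda>x\<in>carrier (Sk A). x)) \<and>
     (\<forall>K :: 'd biframe. is_biframe K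
        \<longrightarrow> compose (carrier (Bplus K))
                (Bplus_map (Sk (Bplus K)) K (counit_map K)) (unit_map (Bplus K)) =
              (\<lambda>x\<in>carrier (Bplus K). x)) \<and>

     \<comment> \<open>it restricts to an equivalence between the full subcategories CFrith and BiFrm_KZ\<close>
     (\<forall>A :: 'a frith. complete_frith A \<longrightarrow> KZ_biframe (Sk A)) \<and>
     (\<forall>K :: 'd biframe. KZ_biframe K \<longrightarrow> complete_frith (Bplus K)) \<and>
     (\<forall>A :: 'a frith. complete_frith A \<longrightarrow> frith_iso A (Bplus (Sk A)) (unit_map A)) \<and>
     (\<forall>K :: 'd biframe. KZ_biframe K \<longrightarrow> biframe_iso (Sk (Bplus K)) K (counit_map K))"
proof (intro conjI allI impI; (elim conjE)?)
  fix A :: "'a frith" assume "frith_frame A"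
  then interpret frith A by (simp add: frith_iff)
  show "is_biframe (Sk A)" by (rule Sk_biframe)
  show "Sk_map A A (\<lambda>x\<in>carrier A. x) = (\<lambda>x\<in>carrier (Sk A). x)"
    by (rule Sk_map_identity[OF frith_frame])
  show "unit_map A \<in> frith_hom A (Bplus (Sk A))" by (rule unit_map_Bplus)
  show "compose (carrier (Sk A)) (counit_map (Sk A)) (Sk_map A (Bplus (Sk A)) (unit_map A)) =
    (\<lambda>x\<in>carrier (Sk A). x)" by (rule unit_counit_triangle[OF frith_frame])
next
  fix K :: "'d biframe" assume "is_biframe K"
  then interpret biframe K by (simp add: biframe_iff)
  show "frith_frame (Bplus K)" by (rule Bplus_frith)
  show "Bplus_map K K (\<lambda>x\<in>carrier K. x) = (\<lambda>x\<in>carrier (Bplus K). x)"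
    by (rule Bplus_map_identity[OF biframe])
  show "counit_map K \<in> biframe_hom (Sk (Bplus K)) K" by (rule counit_biframe_hom)
  show "compose (carrier (Bplus K)) (Bplus_map (Sk (Bplus K)) K (counit_map K)) (unit_map (Bplus K)) =
    (\<lambda>x\<in>carrier (Bplus K). x)" by (rule counit_unit_triangle)
next
  fix A :: "'a frith" assume A: "complete_frith A"
  then interpret frith A by (rule complete_frith_frith)
  show "KZ_biframe (Sk A)" by (rule complete_imp_KZ[OF A])
  show "frith_iso A (Bplus (Sk A)) (unit_map A)" by (rule complete_unit_iso[OF A])
next
  fix K :: "'d biframe" assume K: "KZ_biframe K"
  then interpret biframe K by (rule KZ_biframe_biframe)
  show "complete_frith (Bplus K)" by (rule KZ_imp_complete[OF K])
  show "biframe_iso (Sk (Bplus K)) K (counit_map K)" by (rule KZ_counit_iso[OF K])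
next
  fix A :: "'a frith" and B :: "'b frith" and h
  assume h: "frith_frame A" "frith_frame B" "h \<in> frith_hom A B"
  then interpret frith_morphism A B h by (simp add: frith_morphism_iff)
  show "Sk_map A B h \<in> biframe_hom (Sk A) (Sk B)" by (rule Sk_map_biframe_hom)
  show "compose (carrier A) (Bplus_map (Sk A) (Sk B) (Sk_map A B h)) (unit_map A) =
    compose (carrier A) (unit_map B) h" by (rule unit_natural[OF h])
next
  fix K :: "'d biframe" and N :: "'e biframe" and h
  assume h: "is_biframe K" "is_biframe N" "h \<in> biframe_hom K N"
  then interpret biframe_morphism K N h by (simp add: biframe_morphism_iff)
  show "Bplus_map K N h \<in> frith_hom (Bplus K) (Bplus N)" by (rule Bplus_map_hom)
  show "compose (carrier (Sk (Bplus K))) h (counit_map K) =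
    compose (carrier (Sk (Bplus K))) (counit_map N) (Sk_map (Bplus K) (Bplus N) (Bplus_map K N h))"
    by (rule counit_natural[OF h])
qed (rule Sk_map_compose Bplus_map_compose; assumption)+

end
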